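(* We have $$\lim_{V \downarrow 0} \beta^\pm_{\delta_0}(\infty) = \lim_{V \downarrow 0} \lim_{p \uparrow \infty} \beta^\pm_{\delta_0}(p) = 1,$$ uniformly in $\omega \in \mathbb{T}$, where the time-average is given by $\langle f \rangle(T) = \frac{2}{T} \int_0^\infty e^{-2t/T} f(t)\,dt$.
   Context: Let $\alpha = \frac{\sqrt{5}-1}{2}$. For $V>0$ and $\omega \in \mathbb{T} = \mathbb{R}/\mathbb{Z}$, the Fibonacci Hamiltonian is the bounded self-adjoint operator on $\ell^2(\mathbb{Z})$ given by $$[H_{V,\omega} \psi](n) = \psi(n+1) + \psi(n-1) + V \chi_{[1-\alpha,1)}(n\alpha + \omega \bmod 1)\, \psi(n).$$ $\{\delta_n\}_{n\in\mathbb{Z}}$ is the standard basis of $\ell^2(\mathbb{Z})$. Transport exponents (depending on $V$ and $\omega$): for $\psi\in\ell^2(\mathbb{Z})$ and $p>0$ put $$\langle |X|_\psi^p\rangle(t) = \sum_{n\in\mathbb{Z}} |n|^p\, |\langle \delta_n, e^{-itH_{V,\omega}}\psi\rangle|^2 ,$$ let $\langle\langle |X|_\psi^p\rangle\rangle(T)$ denote the time average $\langle f\rangle(T)$ of $f(t)=\langle |X|_\psi^p\rangle(t)$, and define $$\beta_\psi^+(p) = \limsup_{T\to\infty} \frac{\log \langle\langle |X|_\psi^p\rangle\rangle(T)}{p\log T}, \qquad \beta_\psi^-(p) = \liminf_{T\to\infty} \frac{\log \langle\langle |X|_\psi^p\rangle\rangle(T)}{p\log T}.$$ For compactly supported $\psi$,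 it is known that $\beta_\psi^\pm(p)$ are non-decreasing functions of $p$ with values in $[0,1]$; $\beta_\psi^\pm(\infty) = \lim_{p\uparrow\infty}\beta_\psi^\pm(p)$. The statement is asserted for both $\beta^+$ and $\beta^-$. *)

theory Defs
  imports "HOL-Analysis.Analysis"
begin

section \<open>The complex Hilbert space of square-summable functions\<close>

text \<open>The norm, the metric and the real inner product (the real part of the complex one) are given
  by type class instances; scalar multiplication by complex numbers and the complex inner product
  are separate constants, since the library has no classes for them.\<close>

typedef 'a ell2 = "{f :: 'a \<Rightarrow> complex. (\<lambda>x. (cmod (f x))\<^sup>2) summable_on UNIV}"
  morphisms ell2_apply Abs_ell2
  by (rule exI[of _ "\<lambda>_. 0"]) simp

setup_lifting type_definition_ell2

lemma ell2_eqI: "(\<And>x. ell2_apply f x = ell2_apply g x) \<Longrightarrow> f = g"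
  by (metis ell2_apply_inject ext)

lemma ell2_summable: "(\<lambda>x. (cmod (ell2_apply f x))\<^sup>2) summable_on UNIV"
  using ell2_apply[of f] by simp

lemma cmod_add_sq: "(cmod (a + b))\<^sup>2 \<le> 2 * (cmod a)\<^sup>2 + 2 * (cmod b)\<^sup>2"
proof -
  have "(cmod (a + b))\<^sup>2 \<le> (cmod a + cmod b)\<^sup>2"
    by (intro power_mono norm_triangle_ineq) simp
  also have "\<dots> \<le> 2 * (cmod a)\<^sup>2 + 2 * (cmod b)\<^sup>2"
    using sum_squares_bound[of "cmod a" "cmod b"] by (simp add: power2_sum)
  finally show ?thesis .
qed

lemma summable_sq_add:
  fixes f g :: "'a \<Rightarrow> complex"
  assumes "(\<lambda>x. (cmod (f x))\<^sup>2) summable_on UNIV" "(\<lambda>x. (cmod (g x))\<^sup>2) summable_on UNIV"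
  shows "(\<lambda>x. (cmod (f x + g x))\<^sup>2) summable_on UNIV"
proof (rule summable_on_comparison_test)
  show "(\<lambda>x. 2 * (cmod (f x))\<^sup>2 + 2 * (cmod (g x))\<^sup>2) summable_on UNIV"
    by (intro summable_on_add summable_on_cmult_right assms)
qed (auto simp: cmod_add_sq)

lemma summable_sq_bounded_mult:
  fixes f g :: "'a \<Rightarrow> complex"
  assumes "(\<lambda>x. (cmod (f x))\<^sup>2) summable_on UNIV" "\<And>x. cmod (g x) \<le> C"
  shows "(\<lambda>x. (cmod (g x * f x))\<^sup>2) summable_on UNIV"
proof (rule summable_on_comparison_test)
  show "(\<lambda>x. C\<^sup>2 * (cmod (f x))\<^sup>2) summable_on UNIV"
    by (intro summable_on_cmult_right assms)
  show "(cmod (g x * f x))\<^sup>2 \<le> C\<^sup>2 * (cmod (f x))\<^sup>2" for x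
    by (simp add: norm_mult power_mult_distrib mult_right_mono power_mono assms(2))
qed auto

lift_definition ell2_scale :: "complex \<Rightarrow> 'a ell2 \<Rightarrow> 'a ell2" is "\<lambda>c f x. c * f x"
  by (rule summable_sq_bounded_mult[where C = "cmod _"]) auto

instantiation ell2 :: (type) real_vector
begin
lift_definition zero_ell2 :: "'a ell2" is "\<lambda>_. 0" by simp
lift_definition uminus_ell2 :: "'a ell2 \<Rightarrow> 'a ell2" is "\<lambda>f x. - f x" by simp
lift_definition plus_ell2 :: "'a ell2 \<Rightarrow> 'a ell2 \<Rightarrow> 'a ell2" is "\<lambda>f g x. f x + g x"
  by (rule summable_sq_add)
lift_definition minus_ell2 :: "'a ell2 \<Rightarrow> 'a ell2 \<Rightarrow> 'a ell2" is "\<lambda>f g x. f x - g x"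
proof -
  fix f g :: "'a \<Rightarrow> complex"
  assume "(\<lambda>x. (cmod (f x))\<^sup>2) summable_on UNIV" "(\<lambda>x. (cmod (g x))\<^sup>2) summable_on UNIV"
  then show "(\<lambda>x. (cmod (f x - g x))\<^sup>2) summable_on UNIV"
    using summable_sq_add[of f "\<lambda>x. - g x"] by simp
qed
lift_definition scaleR_ell2 :: "real \<Rightarrow> 'a ell2 \<Rightarrow> 'a ell2" is "\<lambda>r f x. r *\<^sub>R f x"
  by (simp add: power_mult_distrib summable_on_cmult_right)
instance
  by standard (transfer; simp add: fun_eq_iff algebra_simps scaleR_add_right scaleR_add_left)+
end

lemma ell2_apply_simps [simp]:
  "ell2_apply 0 x = 0" "ell2_apply (- f) x = - ell2_apply f x"
  "ell2_apply (f + g) x = ell2_apply f x + ell2_apply g x"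
  "ell2_apply (f - g) x = ell2_apply f x - ell2_apply g x"
  "ell2_apply (r *\<^sub>R f) x = r *\<^sub>R ell2_apply f x"
  "ell2_apply (ell2_scale c f) x = c * ell2_apply f x"
  by (transfer; simp)+

lemma ell2_prod_abs_summable:
  "(\<lambda>x. norm (cnj (ell2_apply f x) * ell2_apply g x)) summable_on UNIV"
proof (rule summable_on_comparison_test)
  show "(\<lambda>x. (cmod (ell2_apply f x))\<^sup>2 + (cmod (ell2_apply g x))\<^sup>2) summable_on UNIV"
    by (intro summable_on_add ell2_summable)
  fix x
  have "2 * cmod (ell2_apply f x) * cmod (ell2_apply g x)
      \<le> (cmod (ell2_apply f x))\<^sup>2 + (cmod (ell2_apply g x))\<^sup>2"
    by (rule sum_squares_bound)
  moreover have "0 \<le> cmod (ell2_apply f x) * cmod (ell2_apply g x)" by simp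
  ultimately show "norm (cnj (ell2_apply f x) * ell2_apply g x)
      \<le> (cmod (ell2_apply f x))\<^sup>2 + (cmod (ell2_apply g x))\<^sup>2"
    unfolding norm_mult complex_mod_cnj by linarith
qed auto

definition ell2_cinner :: "'a ell2 \<Rightarrow> 'a ell2 \<Rightarrow> complex" where
  "ell2_cinner f g = (\<Sum>\<^sub>\<infinity>x. cnj (ell2_apply f x) * ell2_apply g x)"

lemma ell2_cinner_summable: "(\<lambda>x. cnj (ell2_apply f x) * ell2_apply g x) summable_on UNIV"
  using abs_summable_summable[OF ell2_prod_abs_summable] .

lemma ell2_cinner_self: "ell2_cinner f f = of_real (\<Sum>\<^sub>\<infinity>x. (cmod (ell2_apply f x))\<^sup>2)"
proof -
  have "((\<lambda>x. complex_of_real ((cmod (ell2_apply f x))\<^sup>2)) has_sum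
      of_real (\<Sum>\<^sub>\<infinity>x. (cmod (ell2_apply f x))\<^sup>2)) UNIV"
    by (intro has_sum_of_real has_sum_infsum ell2_summable)
  moreover have "cnj (ell2_apply f x) * ell2_apply f x = complex_of_real ((cmod (ell2_apply f x))\<^sup>2)" for x
    using complex_norm_square[of "ell2_apply f x"] by (simp add: mult.commute)
  ultimately show ?thesis
    unfolding ell2_cinner_def by (simp add: infsumI del: of_real_power)
qed

instantiation ell2 :: (type) real_inner
begin
definition inner_ell2 :: "'a ell2 \<Rightarrow> 'a ell2 \<Rightarrow> real" where
  "inner_ell2 f g = Re (ell2_cinner f g)"
definition norm_ell2 :: "'a ell2 \<Rightarrow> real" where
  "norm_ell2 f = sqrt (\<Sum>\<^sub>\<infinity>x. (cmod (ell2_apply f x))\<^sup>2)"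
definition dist_ell2 :: "'a ell2 \<Rightarrow> 'a ell2 \<Rightarrow> real" where
  "dist_ell2 f g = norm (f - g)"
definition sgn_ell2 :: "'a ell2 \<Rightarrow> 'a ell2" where
  "sgn_ell2 f = inverse (norm f) *\<^sub>R f"
definition uniformity_ell2 :: "('a ell2 \<times> 'a ell2) filter" where
  "uniformity_ell2 = (INF e\<in>{0<..}. principal {(x, y). dist x y < e})"
definition open_ell2 :: "'a ell2 set \<Rightarrow> bool" where
  "open_ell2 U \<longleftrightarrow> (\<forall>x\<in>U. eventually (\<lambda>(x', y). x' = x \<longrightarrow> y \<in> U) uniformity)"
instance
proof
  fix f g h :: "'a ell2" and r :: real
  show "dist f g = norm (f - g)" by (rule dist_ell2_def)
  show "sgn f = f /\<^sub>R norm f" by (rule sgn_ell2_def)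
  show "uniformity = (INF e\<in>{0<..}. principal {(x, y :: 'a ell2). dist x y < e})"
    by (rule uniformity_ell2_def)
  show "open U \<longleftrightarrow> (\<forall>x\<in>U. eventually (\<lambda>(x', y). x' = x \<longrightarrow> y \<in> U) uniformity)" for U :: "'a ell2 set"
    by (rule open_ell2_def)
  have "ell2_cinner f g = cnj (ell2_cinner g f)"
    unfolding ell2_cinner_def by (simp add: infsum_cnj[symmetric] mult.commute)
  then show "inner f g = inner g f" by (simp add: inner_ell2_def)
  have "ell2_cinner (f + g) h = ell2_cinner f h + ell2_cinner g h"
    unfolding ell2_cinner_def
    by (simp add: ring_distribs infsum_add ell2_cinner_summable)
  then show "inner (f + g) h = inner f h + inner g h" by (simp add: inner_ell2_def)
  have "ell2_cinner (r *\<^sub>R f) g = r *\<^sub>R ell2_cinner f g"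
    unfolding ell2_cinner_def
    by (simp add: scaleR_conv_of_real mult.assoc infsum_cmult_right')
  then show "inner (r *\<^sub>R f) g = r * inner f g" by (simp add: inner_ell2_def)
  show "0 \<le> inner f f" by (simp add: inner_ell2_def ell2_cinner_self infsum_nonneg)
  show "norm f = sqrt (inner f f)"
    by (simp add: inner_ell2_def norm_ell2_def ell2_cinner_self)
  show "inner f f = 0 \<longleftrightarrow> f = 0"
  proof
    assume "inner f f = 0"
    then have 0: "(\<Sum>\<^sub>\<infinity>x. (cmod (ell2_apply f x))\<^sup>2) = 0"
      by (simp add: inner_ell2_def ell2_cinner_self)
    have "(cmod (ell2_apply f x))\<^sup>2 = 0" for x
      by (rule nonneg_infsum_le_0D[OF _ ell2_summable]) (use 0 in auto)
    then show "f = 0" by (auto intro: ell2_eqI)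
  qed (simp add: inner_ell2_def ell2_cinner_def)
qed
end

lemma norm_ell2_sq: "(norm f)\<^sup>2 = (\<Sum>\<^sub>\<infinity>x. (cmod (ell2_apply f x))\<^sup>2)"
  by (simp add: norm_ell2_def infsum_nonneg)

lemma sum_sq_le_norm_ell2: "finite A \<Longrightarrow> (\<Sum>x\<in>A. (cmod (ell2_apply f x))\<^sup>2) \<le> (norm f)\<^sup>2"
  unfolding norm_ell2_sq by (rule finite_sum_le_infsum[OF ell2_summable]) auto

lemma cmod_ell2_apply_le: "cmod (ell2_apply f x) \<le> norm f"
  using sum_sq_le_norm_ell2[of "{x}" f] by (simp add: power2_le_iff_abs_le)

instance ell2 :: (type) banach
proof
  fix X :: "nat \<Rightarrow> 'a ell2"
  assume X: "Cauchy X"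
  have "Cauchy (\<lambda>n. ell2_apply (X n) x)" for x
  proof (rule metric_CauchyI)
    fix e :: real assume "e > 0"
    then obtain M where "\<forall>m\<ge>M. \<forall>n\<ge>M. dist (X m) (X n) < e"
      using X by (metis metric_CauchyD)
    moreover have "dist (ell2_apply (X m) x) (ell2_apply (X n) x) \<le> dist (X m) (X n)" for m n
      using cmod_ell2_apply_le[of "X m - X n" x] by (simp add: dist_norm)
    ultimately show "\<exists>M. \<forall>m\<ge>M. \<forall>n\<ge>M. dist (ell2_apply (X m) x) (ell2_apply (X n) x) < e"
      by (meson le_less_trans)
  qed
  then have "\<forall>x. \<exists>l. (\<lambda>n. ell2_apply (X n) x) \<longlonglongrightarrow> l"
    by (simp add: Cauchy_convergent_iff convergent_def)
  then obtain l where l: "\<And>x. (\<lambda>n. ell2_apply (X n) x) \<longlonglongrightarrow> l x" by metis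
  have fin: "(\<Sum>x\<in>A. (cmod (ell2_apply (X n) x - l x))\<^sup>2) \<le> e\<^sup>2"
    if M: "\<forall>m\<ge>M. \<forall>n\<ge>M. dist (X m) (X n) < e" and n: "n \<ge> M" and A: "finite A" for M n A and e :: real
  proof (rule LIMSEQ_le_const2)
    show "(\<lambda>m. \<Sum>x\<in>A. (cmod (ell2_apply (X n) x - ell2_apply (X m) x))\<^sup>2)
        \<longlonglongrightarrow> (\<Sum>x\<in>A. (cmod (ell2_apply (X n) x - l x))\<^sup>2)"
      by (intro tendsto_intros l)
    have "(\<Sum>x\<in>A. (cmod (ell2_apply (X n) x - ell2_apply (X m) x))\<^sup>2) \<le> e\<^sup>2" if "m \<ge> M" for m
    proof -
      have "(\<Sum>x\<in>A. (cmod (ell2_apply (X n) x - ell2_apply (X m) x))\<^sup>2) \<le> (norm (X n - X m))\<^sup>2"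
        using sum_sq_le_norm_ell2[OF A, of "X n - X m"] by simp
      also have "\<dots> \<le> e\<^sup>2"
        using M n that by (intro power_mono) (auto simp: dist_norm less_imp_le)
      finally show ?thesis .
    qed
    then show "\<exists>N. \<forall>m\<ge>N. (\<Sum>x\<in>A. (cmod (ell2_apply (X n) x - ell2_apply (X m) x))\<^sup>2) \<le> e\<^sup>2"
      by blast
  qed
  have summ: "(\<lambda>x. (cmod (ell2_apply (X n) x - l x))\<^sup>2) summable_on UNIV"
    if "\<forall>m\<ge>M. \<forall>n\<ge>M. dist (X m) (X n) < e" and "n \<ge> M" for M n and e :: real
    by (rule nonneg_bounded_partial_sums_imp_summable_on[where C = "e\<^sup>2"])
      (use fin[OF that] in \<open>auto intro!: eventually_finite_subsets_at_top_weakI\<close>)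
  have "l \<in> {f. (\<lambda>x. (cmod (f x))\<^sup>2) summable_on UNIV}"
  proof -
    obtain M where M: "\<forall>m\<ge>M. \<forall>n\<ge>M. dist (X m) (X n) < 1"
      using X by (metis metric_CauchyD zero_less_one)
    have "(\<lambda>x. (cmod (l x - ell2_apply (X M) x))\<^sup>2) summable_on UNIV"
      using summ[OF M order_refl] by (simp add: norm_minus_commute)
    from summable_sq_add[OF this ell2_summable[of "X M"]] show ?thesis by simp
  qed
  then have L: "ell2_apply (Abs_ell2 l) = l" by (rule Abs_ell2_inverse)
  have "X \<longlonglongrightarrow> Abs_ell2 l"
  proof (rule metric_LIMSEQ_I)
    fix e :: real assume "e > 0"
    then obtain M where M: "\<forall>m\<ge>M. \<forall>n\<ge>M. dist (X m) (X n) < e / 2"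
      using X by (metis metric_CauchyD half_gt_zero)
    have "dist (X n) (Abs_ell2 l) < e" if "n \<ge> M" for n
    proof -
      have "(norm (X n - Abs_ell2 l))\<^sup>2 \<le> (e / 2)\<^sup>2"
        unfolding norm_ell2_sq using summ[OF M that] fin[OF M that]
        by (intro infsum_le_finite_sums) (auto simp: L)
      then have "norm (X n - Abs_ell2 l) \<le> e / 2"
        using \<open>e > 0\<close> by (simp add: power2_le_iff_abs_le)
      then show ?thesis using \<open>e > 0\<close> by (simp add: dist_norm)
    qed
    then show "\<exists>M. \<forall>n\<ge>M. dist (X n) (Abs_ell2 l) < e" by blast
  qed
  then show "convergent X" by (auto simp: convergent_def)
qed

lift_definition ell2_delta :: "'a \<Rightarrow> 'a ell2" is "\<lambda>a x. if x = a then 1 else 0"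
  by (rule finite_nonzero_values_imp_summable_on) (simp add: if_distrib)

lemma ell2_cinner_delta: "ell2_cinner (ell2_delta n) f = ell2_apply f n"
proof -
  have "ell2_cinner (ell2_delta n) f = (\<Sum>\<^sub>\<infinity>x\<in>{n}. ell2_apply f x)"
    unfolding ell2_cinner_def by (rule infsum_cong_neutral) (auto simp: ell2_delta.rep_eq)
  then show ?thesis by simp
qed

lemma norm_ell2_scale: "norm (ell2_scale c f) = cmod c * norm f"
  by (simp add: norm_ell2_def norm_mult power_mult_distrib infsum_cmult_right' real_sqrt_mult)

lift_definition ell2_mult :: "complex \<Rightarrow> 'a ell2 \<Rightarrow>\<^sub>L 'a ell2" is ell2_scale
proof (rule bounded_linear_intro)
  fix c :: complex and f g :: "'a ell2" and r :: real
  show "ell2_scale c (f + g) = ell2_scale c f + ell2_scale c g"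
    by (rule ell2_eqI) (simp add: algebra_simps)
  show "ell2_scale c (r *\<^sub>R f) = r *\<^sub>R ell2_scale c f"
    by (rule ell2_eqI) simp
  show "norm (ell2_scale c f) \<le> norm f * cmod c"
    by (simp add: norm_ell2_scale)
qed

section \<open>The exponential of a bounded operator\<close>

definition blinfun_exp :: "('b::banach \<Rightarrow>\<^sub>L 'b) \<Rightarrow> ('b \<Rightarrow>\<^sub>L 'b)" where
  "blinfun_exp A = (\<Sum>k. (((\<lambda>B. A o\<^sub>L B) ^^ k) id_blinfun) /\<^sub>R fact k)"

lemma blinfun_exp_sums:
  fixes A :: "'b::banach \<Rightarrow>\<^sub>L 'b"
  shows "(\<lambda>k. (((\<lambda>B. A o\<^sub>L B) ^^ k) id_blinfun) /\<^sub>R fact k) sums blinfun_exp A"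
proof -
  have pow: "norm (((\<lambda>B. A o\<^sub>L B) ^^ k) id_blinfun) \<le> norm A ^ k" for k
  proof (induction k)
    case 0
    show ?case using norm_blinfun_id_le by simp
  next
    case (Suc k)
    have "norm (((\<lambda>B. A o\<^sub>L B) ^^ Suc k) id_blinfun)
        \<le> norm A * norm (((\<lambda>B. A o\<^sub>L B) ^^ k) id_blinfun)"
      by (simp add: norm_blinfun_compose)
    also have "\<dots> \<le> norm A * norm A ^ k" by (intro mult_left_mono Suc) simp
    finally show ?case by simp
  qed
  have "summable (\<lambda>k. (((\<lambda>B. A o\<^sub>L B) ^^ k) id_blinfun) /\<^sub>R fact k)"
  proof (rule summable_comparison_test')
    show "summable (\<lambda>k. norm A ^ k /\<^sub>R fact k)"
      using summable_exp_generic[of "norm A"] by simp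
    show "norm ((((\<lambda>B. A o\<^sub>L B) ^^ k) id_blinfun) /\<^sub>R fact k) \<le> norm A ^ k /\<^sub>R fact k" for k
      using pow[of k] by (simp add: mult_left_mono)
  qed
  then show ?thesis unfolding blinfun_exp_def by (rule summable_sums)
qed

section \<open>The Fibonacci Hamiltonian\<close>

definition fib_alpha :: real where "fib_alpha = (sqrt 5 - 1) / 2"

text \<open>A point of the circle is given by any real representative.\<close>

definition fib_potential :: "real \<Rightarrow> real \<Rightarrow> int \<Rightarrow> real" where
  "fib_potential V \<omega> n = V * indicator {1 - fib_alpha..<1} (frac (of_int n * fib_alpha + \<omega>))"

lemma fib_potential_bound: "\<bar>fib_potential V \<omega> n\<bar> \<le> \<bar>V\<bar>"
  by (simp add: fib_potential_def indicator_def)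

lemma bij_shift: "bij (\<lambda>n::int. n + k)"
  by (rule bij_plus_right)

lift_definition ell2_shift :: "int \<Rightarrow> int ell2 \<Rightarrow> int ell2" is "\<lambda>k f n. f (n + k)"
proof -
  fix k :: int and f :: "int \<Rightarrow> complex"
  assume "(\<lambda>n. (cmod (f n))\<^sup>2) summable_on UNIV"
  then show "(\<lambda>n. (cmod (f (n + k)))\<^sup>2) summable_on UNIV"
    using summable_on_reindex_bij_betw[OF bij_shift, of "\<lambda>n. (cmod (f n))\<^sup>2" k] by simp
qed

lemma norm_ell2_shift: "norm (ell2_shift k f) = norm f"
  unfolding norm_ell2_def ell2_shift.rep_eq
  using infsum_reindex_bij_betw[OF bij_shift, of "\<lambda>n. (cmod (ell2_apply f n))\<^sup>2" k] by simp

lift_definition ell2_pot :: "real \<Rightarrow> real \<Rightarrow> int ell2 \<Rightarrow> int ell2" is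
  "\<lambda>V \<omega> f n. complex_of_real (fib_potential V \<omega> n) * f n"
proof -
  fix V \<omega> :: real and f :: "int \<Rightarrow> complex"
  assume "(\<lambda>n. (cmod (f n))\<^sup>2) summable_on UNIV"
  then show "(\<lambda>n. (cmod (complex_of_real (fib_potential V \<omega> n) * f n))\<^sup>2) summable_on UNIV"
    by (rule summable_sq_bounded_mult[where C = "\<bar>V\<bar>"]) (simp add: fib_potential_bound)
qed

lemma norm_ell2_pot: "norm (ell2_pot V \<omega> f) \<le> \<bar>V\<bar> * norm f"
proof -
  have "(norm (ell2_pot V \<omega> f))\<^sup>2 \<le> (\<Sum>\<^sub>\<infinity>n. V\<^sup>2 * (cmod (ell2_apply f n))\<^sup>2)"
    unfolding norm_ell2_sq
  proof (rule infsum_mono[OF ell2_summable])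
    show "(\<lambda>n. V\<^sup>2 * (cmod (ell2_apply f n))\<^sup>2) summable_on UNIV"
      by (intro summable_on_cmult_right ell2_summable)
    show "(cmod (ell2_apply (ell2_pot V \<omega> f) n))\<^sup>2 \<le> V\<^sup>2 * (cmod (ell2_apply f n))\<^sup>2" for n
      using fib_potential_bound[of V \<omega> n]
      by (simp add: ell2_pot.rep_eq norm_mult power_mult_distrib mult_right_mono abs_le_square_iff)
  qed
  also have "\<dots> = (\<bar>V\<bar> * norm f)\<^sup>2"
    by (simp add: infsum_cmult_right' norm_ell2_sq power_mult_distrib)
  finally show ?thesis by (rule power2_le_imp_le) simp
qed

lift_definition fib_hamiltonian_fun :: "real \<Rightarrow> real \<Rightarrow> int ell2 \<Rightarrow> int ell2" is
  "\<lambda>V \<omega> \<psi> n. \<psi> (n + 1) + \<psi> (n - 1) + complex_of_real (fib_potential V \<omega> n) * \<psi> n"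
proof -
  fix V \<omega> :: real and f :: "int \<Rightarrow> complex"
  assume f: "(\<lambda>n. (cmod (f n))\<^sup>2) summable_on UNIV"
  have "(\<lambda>n. (cmod (f (n + k)))\<^sup>2) summable_on UNIV" for k
    using f summable_on_reindex_bij_betw[OF bij_shift, of "\<lambda>n. (cmod (f n))\<^sup>2" k] by simp
  from this[of 1] this[of "-1"]
  show "(\<lambda>n. (cmod (f (n + 1) + f (n - 1) + complex_of_real (fib_potential V \<omega> n) * f n))\<^sup>2)
      summable_on UNIV"
    by (intro summable_sq_add summable_sq_bounded_mult[OF f, where C = "\<bar>V\<bar>"])
      (auto simp: fib_potential_bound)
qed

lemma fib_hamiltonian_fun_eq:
  "fib_hamiltonian_fun V \<omega> \<psi> = ell2_shift 1 \<psi> + ell2_shift (-1) \<psi> + ell2_pot V \<omega> \<psi>"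
  by (rule ell2_eqI) (simp add: fib_hamiltonian_fun.rep_eq ell2_shift.rep_eq ell2_pot.rep_eq)

lift_definition fib_hamiltonian :: "real \<Rightarrow> real \<Rightarrow> int ell2 \<Rightarrow>\<^sub>L int ell2" is fib_hamiltonian_fun
proof (rule bounded_linear_intro)
  fix V \<omega> r :: real and f g :: "int ell2"
  show "fib_hamiltonian_fun V \<omega> (f + g) = fib_hamiltonian_fun V \<omega> f + fib_hamiltonian_fun V \<omega> g"
    by (rule ell2_eqI) (simp add: fib_hamiltonian_fun.rep_eq algebra_simps)
  show "fib_hamiltonian_fun V \<omega> (r *\<^sub>R f) = r *\<^sub>R fib_hamiltonian_fun V \<omega> f"
    by (rule ell2_eqI) (simp add: fib_hamiltonian_fun.rep_eq algebra_simps)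
  have "norm (fib_hamiltonian_fun V \<omega> f) \<le> norm f + norm f + \<bar>V\<bar> * norm f"
    unfolding fib_hamiltonian_fun_eq
    by (intro norm_triangle_mono norm_ell2_pot) (simp_all add: norm_ell2_shift)
  then show "norm (fib_hamiltonian_fun V \<omega> f) \<le> norm f * (2 + \<bar>V\<bar>)"
    by (simp add: algebra_simps)
qed

lemma fib_hamiltonian_apply:
  "ell2_apply (fib_hamiltonian V \<omega> \<psi>) n = ell2_apply \<psi> (n + 1) + ell2_apply \<psi> (n - 1) +
    complex_of_real (V * indicator {1 - fib_alpha..<1} (frac (of_int n * fib_alpha + \<omega>))) * ell2_apply \<psi> n"
  by (simp add: fib_hamiltonian.rep_eq fib_hamiltonian_fun.rep_eq fib_potential_def
      indicator_def)

definition fib_propagator :: "real \<Rightarrow> real \<Rightarrow> real \<Rightarrow> int ell2 \<Rightarrow>\<^sub>L int ell2" where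
  "fib_propagator V \<omega> t = blinfun_exp (ell2_mult (- \<i> * of_real t) o\<^sub>L fib_hamiltonian V \<omega>)"

section \<open>Transport exponents\<close>

text \<open>Moments and time averages are taken in \<^typ>\<open>ennreal\<close> and their logarithms in
  \<^typ>\<open>ereal\<close>, so that a divergent sum or integral has the value infinity.\<close>

definition moment :: "real \<Rightarrow> real \<Rightarrow> int ell2 \<Rightarrow> real \<Rightarrow> real \<Rightarrow> ennreal" where
  "moment V \<omega> \<psi> p t =
    (\<Sum>\<^sub>\<infinity>n. ennreal (\<bar>of_int n\<bar> powr p *
      (cmod (ell2_cinner (ell2_delta n) (fib_propagator V \<omega> t \<psi>)))\<^sup>2))"

definition time_average :: "(real \<Rightarrow> ennreal) \<Rightarrow> real \<Rightarrow> ennreal" where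
  "time_average f T = ennreal (2 / T) * (\<integral>\<^sup>+t\<in>{0..}. ennreal (exp (- 2 * t / T)) * f t \<partial>lborel)"

definition ln_ennreal :: "ennreal \<Rightarrow> ereal" where
  "ln_ennreal x = (if x = 0 then - \<infinity> else if x = \<infinity> then \<infinity> else ereal (ln (enn2real x)))"

definition transport_ratio :: "real \<Rightarrow> real \<Rightarrow> int ell2 \<Rightarrow> real \<Rightarrow> real \<Rightarrow> ereal" where
  "transport_ratio V \<omega> \<psi> p T = ln_ennreal (time_average (moment V \<omega> \<psi> p) T) / ereal (p * ln T)"

definition beta_plus :: "real \<Rightarrow> real \<Rightarrow> int ell2 \<Rightarrow> real \<Rightarrow> ereal" where
  "beta_plus V \<omega> \<psi> p = Limsup at_top (transport_ratio V \<omega> \<psi> p)"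

definition beta_minus :: "real \<Rightarrow> real \<Rightarrow> int ell2 \<Rightarrow> real \<Rightarrow> ereal" where
  "beta_minus V \<omega> \<psi> p = Liminf at_top (transport_ratio V \<omega> \<psi> p)"

definition beta_plus_inf :: "real \<Rightarrow> real \<Rightarrow> int ell2 \<Rightarrow> ereal" where
  "beta_plus_inf V \<omega> \<psi> = Lim at_top (beta_plus V \<omega> \<psi>)"

definition beta_minus_inf :: "real \<Rightarrow> real \<Rightarrow> int ell2 \<Rightarrow> ereal" where
  "beta_minus_inf V \<omega> \<psi> = Lim at_top (beta_minus V \<omega> \<psi>)"

end

theory Submission
  imports Defs
begin

text \<open>At most ballistic growth follows from the decay $|\langle \delta_n, e^{-itH} \delta_0 \rangle| \le
  e^{c t - |n|}$, and monotonicity in \<open>p\<close> from Young's inequality, the squared amplitudes having total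
  mass at most 1.

  For the lower bound a single energy suffices: by the Cauchy--Schwarz inequality the time average of
  $|\langle \delta_n, e^{-itH} \delta_0 \rangle|^2$ is at least $\kappa^2 |G(n)|^2$, where $\kappa = 2/T$ and
  $G = (H - E - i \kappa)^{-1} \delta_0$. As $p \to \infty$ a polynomially small lower bound on $G$ at distance
  $T^{1-\epsilon}$ is enough, and it follows once the transfer matrices at the real energy \<open>E\<close> over
  windows of length $N$ are bounded by $N^{\gamma}$ with $\gamma \to 0$ as $V \to 0$.

  At $V = 0$, $E = 0$ all transfer matrices are rotations and the trace map orbit has period six. This
  orbit is hyperbolic, so for small $V$ a nested interval argument gives, for any given length, an
  energy in $[0, V]$ whose trace orbit stays close to it, with summable deviation. Then the transfer matrices of
  the canonical Fibonacci blocks have norm at most $1 + O(V)$. Every window of length $N$ is a product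
  of $O(\log N)$ such blocks, whatever the phase, which gives $\gamma = O(V)$.\<close>

section \<open>The trace map near a period-six orbit\<close>

text \<open>As the order \<open>p\<close> of the moment grows, any fixed power of \<open>T\<close>
  costs only a term of order \<open>1 / p\<close> in the exponent. This is why one energy and one
  site suffice, and why the energy may be chosen anew for every \<open>T\<close>, so that only
  finite orbits have to be tracked.

  The obstacle is accumulation: deviations of size O(V) at each of O(log N) levels would let the
  block matrices drift arbitrarily far from rotations. Their sum must be O(V) whatever the number of
  levels. It is, because an orbit passing a hyperbolic fixed point is away from it only near its two
  ends: the contracted coordinate decays from the start, the expanded one decays backwards from the
  end.

  The block bounds do not involve the phase, which only decides how a window is cut into blocks;
  hence the uniformity in \<omega>. Passing from energy E to E + i \<kappa> costs a relative error
  \<kappa> D^2 N, where D bounds the windows. It is small for N = T^(1-\<epsilon>) once D^2 is at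
  most T^(\<epsilon>/2).\<close>

text \<open>The traces $t_{n+1} = t_n t_{n-1} - t_{n-2}$ of the Fibonacci transfer matrices start from
  $(E, E - V, E (E - V) - 2)$. Three steps at a time and up to alternating signs, they are iterated
  here as $(u, v, g) = (t_{3j+1}, \pm t_{3j}, \pm t_{3j+2})$; the points $(0, 0, g)$ are fixed.\<close>

fun trace_orbit :: "real \<Rightarrow> real \<Rightarrow> nat \<Rightarrow> real \<times> real \<times> real" where
  "trace_orbit V E 0 = (E - V, - E, 2 - E * (E - V))"
| "trace_orbit V E (Suc j) = (case trace_orbit V E j of (u, v, g) \<Rightarrow>
     (- u - g * (v - g * u), v - g * u, g + (- u - g * (v - g * u)) * (v - g * u)))"

definition orbit_u :: "real \<Rightarrow> real \<Rightarrow> nat \<Rightarrow> real" where "orbit_u V E j = fst (trace_orbit V E j)"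
definition orbit_v :: "real \<Rightarrow> real \<Rightarrow> nat \<Rightarrow> real" where "orbit_v V E j = fst (snd (trace_orbit V E j))"
definition orbit_g :: "real \<Rightarrow> real \<Rightarrow> nat \<Rightarrow> real" where "orbit_g V E j = snd (snd (trace_orbit V E j))"

lemma trace_orbit_0 [simp]: "orbit_u V E 0 = E - V" "orbit_v V E 0 = - E" "orbit_g V E 0 = 2 - E * (E - V)"
  by (simp_all add: orbit_u_def orbit_v_def orbit_g_def)

lemma trace_orbit_Suc:
  "orbit_v V E (Suc j) = orbit_v V E j - orbit_g V E j * orbit_u V E j"
  "orbit_u V E (Suc j) = - orbit_u V E j - orbit_g V E j * orbit_v V E (Suc j)"
  "orbit_g V E (Suc j) = orbit_g V E j + orbit_u V E (Suc j) * orbit_v V E (Suc j)"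
  by (simp_all add: orbit_u_def orbit_v_def orbit_g_def split: prod.splits)

text \<open>The Fricke-Vogt invariant of the trace map. It confines \<open>g\<close> near 2 or -2 as
  soon as \<open>u\<close> and \<open>v\<close> are small.\<close>

lemma trace_orbit_invariant:
  "(orbit_u V E j)\<^sup>2 + (orbit_v V E j)\<^sup>2 + (orbit_g V E j)\<^sup>2 - orbit_u V E j * orbit_v V E j * orbit_g V E j = 4 + V\<^sup>2"
proof (induction j)
  case (Suc j)
  then show ?case unfolding trace_orbit_Suc by algebra
qed (simp add: algebra_simps power2_eq_square)

lemma trace_orbit_continuous:
  "continuous_on S (\<lambda>E. orbit_u V E j) \<and> continuous_on S (\<lambda>E. orbit_v V E j) \<and> continuous_on S (\<lambda>E. orbit_g V E j)"
  by (induction j) (auto simp: trace_orbit_Suc intro!: continuous_intros)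

text \<open>At $g = 2$ the map acts on $p = u - v$ and $q = u + v$ by $p' = 4 p + q$, $q' = p$: the
  direction $p$ is expanded, the other one contracted.\<close>

definition orbit_diff :: "real \<Rightarrow> real \<Rightarrow> nat \<Rightarrow> real" where "orbit_diff V E j = orbit_u V E j - orbit_v V E j"
definition orbit_sum :: "real \<Rightarrow> real \<Rightarrow> nat \<Rightarrow> real" where "orbit_sum V E j = orbit_u V E j + orbit_v V E j"

text \<open>A box around (0, 0, 2). The width \<open>2 * V\<close> in the contracted direction is
  large enough to be preserved, and small enough that the expansion \<open>4 V - 2 V\<close> at the
  faces \<open>\<bar>orbit_diff\<bar> = V\<close> still leads out of the box.\<close>

definition in_block :: "real \<Rightarrow> real \<Rightarrow> nat \<Rightarrow> bool" where
  "in_block V E j \<longleftrightarrow> \<bar>orbit_diff V E j\<bar> \<le> V \<and> \<bar>orbit_sum V E j\<bar> \<le> 2 * V \<and> \<bar>orbit_g V E j - 2\<bar> \<le> 5 * V\<^sup>2"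

lemma abs_orbit_uv_le: "\<bar>orbit_u V E j\<bar> + \<bar>orbit_v V E j\<bar> \<le> \<bar>orbit_diff V E j\<bar> + \<bar>orbit_sum V E j\<bar>"
  by (simp add: orbit_diff_def orbit_sum_def)

text \<open>Linearization at \<open>g = 2\<close>: with \<open>g = 2 + h\<close> the remainder is
  linear in \<open>u\<close> and \<open>v\<close>, with coefficients of order \<open>h\<close>. The
  error is thus relative to the deviation itself rather than just O(V), which is what makes
  \<open>tracking_sum\<close> close.\<close>

lemma orbit_diff_sum_Suc:
  assumes "in_block V E j" "0 < V" "V \<le> 1/100"
  shows "\<bar>orbit_diff V E (Suc j) - (4 * orbit_diff V E j + orbit_sum V E j)\<bar> \<le> (\<bar>orbit_diff V E j\<bar> + \<bar>orbit_sum V E j\<bar>) / 100"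
    and "\<bar>orbit_sum V E (Suc j) - orbit_diff V E j\<bar> \<le> (\<bar>orbit_diff V E j\<bar> + \<bar>orbit_sum V E j\<bar>) / 100"
proof -
  let ?u = "orbit_u V E j" and ?v = "orbit_v V E j"
  define h where "h = orbit_g V E j - 2"
  have g: "orbit_g V E j = 2 + h" by (simp add: h_def)
  have "V\<^sup>2 \<le> (1/100)\<^sup>2" using assms by (intro power_mono) auto
  then have "V\<^sup>2 \<le> 1/10000" by (simp add: power2_eq_square)
  then have h: "\<bar>h\<bar> \<le> 1/1000"
    using assms(1) unfolding in_block_def h_def by linarith
  have hh: "\<bar>h * h\<bar> \<le> 1/1000" using mult_mono[OF h h] by (simp add: abs_mult)
  have e1: "orbit_diff V E (Suc j) - (4 * orbit_diff V E j + orbit_sum V E j) = (5 * h + h * h) * ?u - h * ?v"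
    unfolding orbit_diff_def orbit_sum_def trace_orbit_Suc g by (simp add: algebra_simps)
  have e2: "orbit_sum V E (Suc j) - orbit_diff V E j = (3 * h + h * h) * ?u - h * ?v"
    unfolding orbit_diff_def orbit_sum_def trace_orbit_Suc g by (simp add: algebra_simps)
  have b1: "\<bar>(5 * h + h * h) * ?u\<bar> \<le> 1/100 * \<bar>?u\<bar>" "\<bar>(3 * h + h * h) * ?u\<bar> \<le> 1/100 * \<bar>?u\<bar>"
    "\<bar>h * ?v\<bar> \<le> 1/100 * \<bar>?v\<bar>"
    unfolding abs_mult using h hh by (intro mult_right_mono; linarith)+
  show "\<bar>orbit_diff V E (Suc j) - (4 * orbit_diff V E j + orbit_sum V E j)\<bar> \<le> (\<bar>orbit_diff V E j\<bar> + \<bar>orbit_sum V E j\<bar>) / 100"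
    unfolding e1 using b1 abs_orbit_uv_le[of V E j] by argo
  show "\<bar>orbit_sum V E (Suc j) - orbit_diff V E j\<bar> \<le> (\<bar>orbit_diff V E j\<bar> + \<bar>orbit_sum V E j\<bar>) / 100"
    unfolding e2 using b1 abs_orbit_uv_le[of V E j] by argo
qed

text \<open>The invariant expresses \<open>g^2 - 4\<close> by terms of order \<open>V^2\<close>. The
  crude range for \<open>g\<close> excludes the root -2 and makes the factor \<open>g + 2\<close> at
  least 3.\<close>

lemma orbit_g_bound:
  assumes "\<bar>orbit_diff V E j\<bar> \<le> V" "\<bar>orbit_sum V E j\<bar> \<le> 2 * V" "1 \<le> orbit_g V E j" "orbit_g V E j \<le> 3"
  shows "\<bar>orbit_g V E j - 2\<bar> \<le> 5 * V\<^sup>2"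
proof -
  let ?u = "orbit_u V E j" and ?v = "orbit_v V E j" and ?g = "orbit_g V E j" and ?p = "orbit_diff V E j" and ?q = "orbit_sum V E j"
  have V: "V \<ge> 0" using assms by linarith
  have p2: "?p\<^sup>2 \<le> V\<^sup>2" "?q\<^sup>2 \<le> 4 * V\<^sup>2"
    using power_mono[OF assms(1), of 2] power_mono[OF assms(2), of 2] by (auto simp: power_mult_distrib)
  have uv: "?u * ?v = (?q\<^sup>2 - ?p\<^sup>2) / 4" "?u\<^sup>2 + ?v\<^sup>2 = (?p\<^sup>2 + ?q\<^sup>2) / 2"
    unfolding orbit_diff_def orbit_sum_def by (simp_all add: power2_eq_square algebra_simps)
  have uvb: "\<bar>?u * ?v\<bar> \<le> V\<^sup>2"
    unfolding uv using p2 zero_le_power2[of ?p] zero_le_power2[of ?q] by argo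
  have "\<bar>?u * ?v * ?g\<bar> \<le> V\<^sup>2 * 3"
    unfolding abs_mult[of "?u * ?v"] using uvb assms by (intro mult_mono) auto
  moreover have "(?g - 2) * (?g + 2) = V\<^sup>2 - (?u\<^sup>2 + ?v\<^sup>2) + ?u * ?v * ?g"
    using trace_orbit_invariant[of V E j] by (simp add: algebra_simps power2_eq_square)
  ultimately have "\<bar>(?g - 2) * (?g + 2)\<bar> \<le> 13/2 * V\<^sup>2"
    using p2 uv(2) zero_le_power2[of ?p] zero_le_power2[of ?q] by argo
  moreover have "\<bar>(?g - 2) * (?g + 2)\<bar> \<ge> \<bar>?g - 2\<bar> * 3"
    unfolding abs_mult using assms by (intro mult_left_mono) auto
  ultimately show ?thesis using zero_le_power2[of V] by argo
qed

text \<open>Only the expanded coordinate can leave the box. In one step \<open>g\<close> moves by at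
  most \<open>4 * V^2\<close>, hence stays in the crude range, and the invariant restores the sharp
  bound; errors in \<open>g\<close> therefore do not accumulate.\<close>

lemma in_block_Suc:
  assumes "in_block V E j" "0 < V" "V \<le> 1/100" "\<bar>orbit_diff V E (Suc j)\<bar> \<le> V"
  shows "in_block V E (Suc j)"
proof -
  have q: "\<bar>orbit_sum V E (Suc j)\<bar> \<le> 2 * V"
    using orbit_diff_sum_Suc(2)[OF assms(1-3)] assms(1,2) unfolding in_block_def by argo
  let ?u = "orbit_u V E (Suc j)" and ?v = "orbit_v V E (Suc j)"
  have V2: "V\<^sup>2 \<le> 1/10000" using power_mono[of V "1/100" 2] assms by (simp add: power2_eq_square)
  have "\<bar>?u\<bar> \<le> 2 * V" "\<bar>?v\<bar> \<le> 2 * V"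
    using q assms(2,4) unfolding orbit_diff_def orbit_sum_def by linarith+
  from mult_mono[OF this] have "\<bar>?u * ?v\<bar> \<le> 4 * V\<^sup>2"
    using assms by (simp add: abs_mult power2_eq_square)
  then have "\<bar>orbit_g V E (Suc j) - orbit_g V E j\<bar> \<le> 4 * V\<^sup>2" by (simp add: trace_orbit_Suc(3))
  then have "1 \<le> orbit_g V E (Suc j)" "orbit_g V E (Suc j) \<le> 3"
    using V2 assms(1) unfolding in_block_def by argo+
  from orbit_g_bound[OF assms(4) q this] q assms(4) show ?thesis by (simp add: in_block_def)
qed

text \<open>Take for \<open>b'\<close> the first point where \<open>c\<close> is attained, and for
  \<open>a'\<close> the last point before it where \<open>- c\<close> is attained; by the
  intermediate value theorem \<open>f\<close> cannot leave the strip in between.\<close>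

lemma crossing_subinterval:
  fixes f :: "real \<Rightarrow> real"
  assumes f: "continuous_on {a..b} f" and ab: "a \<le> b" "f a \<le> - c" "c \<le> f b" and c: "0 < c"
  obtains a' b' where "a \<le> a'" "a' \<le> b'" "b' \<le> b" "f a' = - c" "f b' = c"
    "\<And>x. a' \<le> x \<Longrightarrow> x \<le> b' \<Longrightarrow> \<bar>f x\<bar> \<le> c"
proof -
  have ac: "f a \<le> c" "- c \<le> f b" using ab c by linarith+
  define S where "S = {x \<in> {a..b}. f x = c}"
  have "closed S" unfolding S_def
    by (rule continuous_closed_preimage_constant[OF f]) auto
  then have cS: "compact S" unfolding S_def
    by (metis (no_types, lifting) bounded_closed_interval bounded_subset compact_eq_bounded_closed mem_Collect_eq subsetI)
  obtain x0 where "a \<le> x0" "x0 \<le> b" "f x0 = c"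
    using IVT'[of f a c b] assms by auto
  then have "S \<noteq> {}" by (auto simp: S_def)
  from compact_attains_inf[OF cS this] obtain b' where b': "b' \<in> S" "\<And>x. x \<in> S \<Longrightarrow> b' \<le> x" by auto
  have fb: "f b' = c" "a \<le> b'" "b' \<le> b" using b' by (auto simp: S_def)
  have below: "f x \<le> c" if "a \<le> x" "x \<le> b'" for x
  proof (rule ccontr)
    assume "\<not> f x \<le> c"
    have "continuous_on {a..x} f" using that fb by (intro continuous_on_subset[OF f]) auto
    then have "\<exists>y\<ge>a. y \<le> x \<and> f y = c"
      using ac \<open>\<not> f x \<le> c\<close> that by (intro IVT') auto
    then obtain y where "a \<le> y" "y \<le> x" "f y = c" by auto
    moreover from this have "b' \<le> y" using b'(2) that fb by (auto simp: S_def)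
    ultimately have "x = b'" using that by linarith
    with fb \<open>\<not> f x \<le> c\<close> show False by simp
  qed
  define R where "R = {x \<in> {a..b'}. f x = - c}"
  have fc: "continuous_on {a..b'} f" using fb by (intro continuous_on_subset[OF f]) auto
  have "closed R" unfolding R_def
    by (rule continuous_closed_preimage_constant[OF fc]) auto
  then have cR: "compact R" unfolding R_def
    by (metis (no_types, lifting) bounded_closed_interval bounded_subset compact_eq_bounded_closed mem_Collect_eq subsetI)
  obtain x1 where "a \<le> x1" "x1 \<le> b'" "f x1 = - c"
    using IVT'[of f a "- c" b'] assms fc fb by auto
  then have "R \<noteq> {}" by (auto simp: R_def)
  from compact_attains_sup[OF cR this] obtain a' where a': "a' \<in> R" "\<And>x. x \<in> R \<Longrightarrow> x \<le> a'" by auto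
  have fa: "f a' = - c" "a \<le> a'" "a' \<le> b'" using a' by (auto simp: R_def)
  have above: "- c \<le> f x" if "a' \<le> x" "x \<le> b'" for x
  proof (rule ccontr)
    assume "\<not> - c \<le> f x"
    have "continuous_on {x..b'} f" using that fa by (intro continuous_on_subset[OF fc]) auto
    then have "\<exists>y\<ge>x. y \<le> b' \<and> f y = - c"
      using c fb \<open>\<not> - c \<le> f x\<close> that by (intro IVT') auto
    then obtain y where "x \<le> y" "y \<le> b'" "f y = - c" by auto
    moreover from this have "y \<le> a'" using a'(2) that fa by (auto simp: R_def)
    ultimately have "x = a'" using that by linarith
    with fa \<open>\<not> - c \<le> f x\<close> show False by simp
  qed
  have "\<bar>f x\<bar> \<le> c" if "a' \<le> x" "x \<le> b'" for x
    using below[of x] above[of x] that fa(2) by (auto simp: abs_le_iff)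
  then show ?thesis
    using that[of a' b'] fa fb by blast
qed

text \<open>Nested intervals: the energies in \<open>[a, b]\<close> cross the box completely in the
  expanded direction. The next step stretches this crossing beyond both faces, and a subinterval is
  cut out that crosses the box again.\<close>

lemma exists_tracking_interval:
  assumes V: "0 < V" "V \<le> 1/100"
  shows "\<exists>a b. 0 \<le> a \<and> a \<le> b \<and> b \<le> V \<and> orbit_diff V a J = - V \<and> orbit_diff V b J = V \<and>
    (\<forall>E. a \<le> E \<longrightarrow> E \<le> b \<longrightarrow> (\<forall>j\<le>J. in_block V E j))"
proof (induction J)
  case 0
  have "in_block V E 0" if "0 \<le> E" "E \<le> V" for E
  proof -
    have "E * (V - E) \<le> V * V" using that V by (intro mult_mono) auto
    moreover have "0 \<le> E * (V - E)" using that by simp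
    moreover have "\<bar>2 - E * (E - V) - 2\<bar> = E * (V - E)"
      using \<open>0 \<le> E * (V - E)\<close> by (simp add: algebra_simps)
    ultimately show ?thesis using that V
      by (auto simp: in_block_def orbit_diff_def orbit_sum_def power2_eq_square)
  qed
  \<comment> \<open>Initially \<open>orbit_diff\<close> is \<open>2 * E - V\<close>, so the energies
    in \<open>[0, V]\<close> form exactly one crossing.\<close>
  then show ?case using V by (intro exI[of _ 0] exI[of _ V]) (auto simp: orbit_diff_def)
next
  case (Suc J)
  then obtain a b where ab: "0 \<le> a" "a \<le> b" "b \<le> V" "orbit_diff V a J = - V" "orbit_diff V b J = V"
    and blk: "\<And>E j. a \<le> E \<Longrightarrow> E \<le> b \<Longrightarrow> j \<le> J \<Longrightarrow> in_block V E j" by blast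
  have Ba: "in_block V a J" and Bb: "in_block V b J" using blk ab by auto
  have "orbit_diff V a (Suc J) \<le> - V"
    using orbit_diff_sum_Suc(1)[OF Ba V] Ba ab V unfolding in_block_def by argo
  moreover have "V \<le> orbit_diff V b (Suc J)"
    using orbit_diff_sum_Suc(1)[OF Bb V] Bb ab V unfolding in_block_def by argo
  moreover have "continuous_on {a..b} (\<lambda>E. orbit_diff V E (Suc J))"
    unfolding orbit_diff_def using trace_orbit_continuous by (intro continuous_intros) auto
  ultimately obtain a' b' where a'b': "a \<le> a'" "a' \<le> b'" "b' \<le> b" "orbit_diff V a' (Suc J) = - V" "orbit_diff V b' (Suc J) = V"
    and tpb: "\<And>E. a' \<le> E \<Longrightarrow> E \<le> b' \<Longrightarrow> \<bar>orbit_diff V E (Suc J)\<bar> \<le> V"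
    using crossing_subinterval[of a b "\<lambda>E. orbit_diff V E (Suc J)" V] ab V by metis
  have "in_block V E j" if "a' \<le> E" "E \<le> b'" "j \<le> Suc J" for E j
  proof (cases "j = Suc J")
    case True
    then show ?thesis using in_block_Suc[OF blk V tpb] that a'b' by auto
  qed (use that a'b' blk in auto)
  then show ?case using a'b' ab by (intro exI[of _ a'] exI[of _ b']) auto
qed

text \<open>The expanded coordinate is bounded backwards from its last value, the contracted one
  forwards from its first. Summed over \<open>j\<close>, this gives two linear inequalities for the
  totals \<open>P\<close> and \<open>Q\<close>, which can be solved independently of
  \<open>J\<close>. The initial \<open>orbit_sum\<close> is \<open>- V\<close> at every
  energy.\<close>

lemma tracking_sum:
  assumes V: "0 < V" "V \<le> 1/100" and B: "\<And>j. j \<le> J \<Longrightarrow> in_block V E j"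
    and "\<bar>orbit_sum V E 0\<bar> = V"
  shows "(\<Sum>j\<le>J. \<bar>orbit_u V E j\<bar> + \<bar>orbit_v V E j\<bar>) \<le> 10 * V"
proof -
  define P where "P = (\<Sum>j\<le>J. \<bar>orbit_diff V E j\<bar>)"
  define Q where "Q = (\<Sum>j\<le>J. \<bar>orbit_sum V E j\<bar>)"
  have nn: "P \<ge> 0" "Q \<ge> 0" by (auto simp: P_def Q_def sum_nonneg)
  have s1: "4 * P \<le> 4 * V + P + Q + (P + Q) / 100"
  proof -
    have "4 * (\<Sum>j<J. \<bar>orbit_diff V E j\<bar>) \<le> (\<Sum>j<J. \<bar>orbit_diff V E (Suc j)\<bar>) + (\<Sum>j<J. \<bar>orbit_sum V E j\<bar>) + ((\<Sum>j<J. \<bar>orbit_diff V E j\<bar>) + (\<Sum>j<J. \<bar>orbit_sum V E j\<bar>)) / 100"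
      unfolding sum_distrib_left sum.distrib[symmetric] sum_divide_distrib
    proof (rule sum_mono)
      fix j assume "j \<in> {..<J}"
      then show "4 * \<bar>orbit_diff V E j\<bar> \<le> \<bar>orbit_diff V E (Suc j)\<bar> + \<bar>orbit_sum V E j\<bar> + (\<bar>orbit_diff V E j\<bar> + \<bar>orbit_sum V E j\<bar>) / 100"
        using orbit_diff_sum_Suc(1)[OF B[of j] V] by auto argo
    qed
    moreover have "P = (\<Sum>j<J. \<bar>orbit_diff V E j\<bar>) + \<bar>orbit_diff V E J\<bar>" "Q = (\<Sum>j<J. \<bar>orbit_sum V E j\<bar>) + \<bar>orbit_sum V E J\<bar>"
      by (simp_all add: P_def Q_def lessThan_Suc_atMost[symmetric])
    moreover have "P = \<bar>orbit_diff V E 0\<bar> + (\<Sum>j<J. \<bar>orbit_diff V E (Suc j)\<bar>)"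
      by (simp add: P_def sum.atMost_shift)
    ultimately show ?thesis using B[OF order_refl, unfolded in_block_def] by argo
  qed
  have s2: "Q \<le> V + P + (P + Q) / 100"
  proof -
    have "(\<Sum>j<J. \<bar>orbit_sum V E (Suc j)\<bar>) \<le> (\<Sum>j<J. \<bar>orbit_diff V E j\<bar>) + ((\<Sum>j<J. \<bar>orbit_diff V E j\<bar>) + (\<Sum>j<J. \<bar>orbit_sum V E j\<bar>)) / 100"
      unfolding sum.distrib[symmetric] sum_divide_distrib
    proof (rule sum_mono)
      fix j assume "j \<in> {..<J}"
      then show "\<bar>orbit_sum V E (Suc j)\<bar> \<le> \<bar>orbit_diff V E j\<bar> + (\<bar>orbit_diff V E j\<bar> + \<bar>orbit_sum V E j\<bar>) / 100"
        using orbit_diff_sum_Suc(2)[OF B[of j] V] by auto argo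
    qed
    moreover have "P = (\<Sum>j<J. \<bar>orbit_diff V E j\<bar>) + \<bar>orbit_diff V E J\<bar>" "Q = (\<Sum>j<J. \<bar>orbit_sum V E j\<bar>) + \<bar>orbit_sum V E J\<bar>"
      by (simp_all add: P_def Q_def lessThan_Suc_atMost[symmetric])
    moreover have "Q = \<bar>orbit_sum V E 0\<bar> + (\<Sum>j<J. \<bar>orbit_sum V E (Suc j)\<bar>)"
      by (simp add: Q_def sum.atMost_shift)
    ultimately show ?thesis using assms(4) by argo
  qed
  have "P + Q \<le> 10 * V" using s1 s2 V nn by argo
  moreover have "(\<Sum>j\<le>J. \<bar>orbit_u V E j\<bar> + \<bar>orbit_v V E j\<bar>) \<le> P + Q"
    unfolding P_def Q_def sum.distrib[symmetric] by (intro sum_mono) (rule abs_orbit_uv_le)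
  ultimately show ?thesis by linarith
qed

lemma exists_tracking_energy:
  assumes V: "0 < V" "V \<le> 1/100"
  obtains E where "0 \<le> E" "E \<le> V" "(\<Sum>j\<le>J. \<bar>orbit_u V E j\<bar> + \<bar>orbit_v V E j\<bar>) \<le> 10 * V"
proof -
  obtain a b where "0 \<le> a" "a \<le> b" "b \<le> V" "\<forall>E. a \<le> E \<longrightarrow> E \<le> b \<longrightarrow> (\<forall>j\<le>J. in_block V E j)"
    using exists_tracking_interval[OF V] by blast
  then show ?thesis using that[of a] tracking_sum[OF V, of J a] V by (auto simp: orbit_sum_def)
qed

section \<open>Transfer matrices of the Fibonacci blocks\<close>

text \<open>\<open>SU p q\<close> stands for the real $2 \times 2$ matrix whose action on $\mathbb{R}^2 = \mathbb{C}$ is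
  $z \mapsto p z + q \bar z$. Its operator norm is $|p| + |q|$, so a rotation has norm exactly 1.\<close>

datatype su = SU (su_p: complex) (su_q: complex)

instantiation su :: ring_1
begin
definition zero_su :: su where "0 = SU 0 0"
definition one_su :: su where "1 = SU 1 0"
definition plus_su :: "su \<Rightarrow> su \<Rightarrow> su" where "M + N = SU (su_p M + su_p N) (su_q M + su_q N)"
definition minus_su :: "su \<Rightarrow> su \<Rightarrow> su" where "M - N = SU (su_p M - su_p N) (su_q M - su_q N)"
definition uminus_su :: "su \<Rightarrow> su" where "- M = SU (- su_p M) (- su_q M)"
definition times_su :: "su \<Rightarrow> su \<Rightarrow> su" where
  "M * N = SU (su_p M * su_p N + su_q M * cnj (su_q N)) (su_p M * su_q N + su_q M * cnj (su_p N))"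
instance
  by standard (simp_all add: zero_su_def one_su_def plus_su_def minus_su_def uminus_su_def
      times_su_def algebra_simps)
end

lemma su_sel [simp]:
  "su_p 0 = 0" "su_q 0 = 0" "su_p 1 = 1" "su_q 1 = 0"
  "su_p (M + N) = su_p M + su_p N" "su_q (M + N) = su_q M + su_q N"
  "su_p (M - N) = su_p M - su_p N" "su_q (M - N) = su_q M - su_q N"
  "su_p (- M) = - su_p M" "su_q (- M) = - su_q M"
  "su_p (M * N) = su_p M * su_p N + su_q M * cnj (su_q N)"
  "su_q (M * N) = su_p M * su_q N + su_q M * cnj (su_p N)"
  by (simp_all add: zero_su_def one_su_def plus_su_def minus_su_def uminus_su_def times_su_def)

definition su_scalar :: "real \<Rightarrow> su" where "su_scalar a = SU (of_real a) 0"
definition su_tr :: "su \<Rightarrow> real" where "su_tr M = 2 * Re (su_p M)"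
definition su_det :: "su \<Rightarrow> real" where "su_det M = (cmod (su_p M))\<^sup>2 - (cmod (su_q M))\<^sup>2"
text \<open>The adjugate matrix: for determinant 1 it is the inverse, and it has the same
  norm.\<close>

definition su_adj :: "su \<Rightarrow> su" where "su_adj M = SU (cnj (su_p M)) (- su_q M)"
definition su_norm :: "su \<Rightarrow> real" where "su_norm M = cmod (su_p M) + cmod (su_q M)"

lemma su_eq_iff: "M = N \<longleftrightarrow> su_p M = su_p N \<and> su_q M = su_q N"
  by (cases M; cases N) auto

section \<open>Norm, inverse and trace identities for the matrices\<close>

lemma su_norm_ge_0 [simp]: "0 \<le> su_norm M" by (simp add: su_norm_def)

lemma su_norm_one [simp]: "su_norm 1 = 1" by (simp add: su_norm_def)

lemma su_norm_add: "su_norm (M + N) \<le> su_norm M + su_norm N"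
  unfolding su_norm_def su_sel by (smt (verit) norm_triangle_ineq)

lemma su_norm_diff: "su_norm (M - N) \<le> su_norm M + su_norm N"
  unfolding su_norm_def su_sel by (smt (verit) norm_triangle_ineq4)

lemma su_norm_mult: "su_norm (M * N) \<le> su_norm M * su_norm N"
proof -
  let ?a = "cmod (su_p M)" and ?b = "cmod (su_q M)" and ?c = "cmod (su_p N)" and ?d = "cmod (su_q N)"
  have "cmod (su_p (M * N)) \<le> ?a * ?c + ?b * ?d"
    using norm_triangle_ineq[of "su_p M * su_p N" "su_q M * cnj (su_q N)"] by (simp add: norm_mult)
  moreover have "cmod (su_q (M * N)) \<le> ?a * ?d + ?b * ?c"
    using norm_triangle_ineq[of "su_p M * su_q N" "su_q M * cnj (su_p N)"] by (simp add: norm_mult)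
  ultimately show ?thesis by (simp add: su_norm_def algebra_simps)
qed

lemma su_norm_mult_le:
  "su_norm M \<le> a \<Longrightarrow> su_norm N \<le> b \<Longrightarrow> su_norm (M * N) \<le> a * b"
  by (rule order_trans[OF su_norm_mult mult_mono]) (auto intro: order_trans[OF su_norm_ge_0])

lemma su_norm_scalar [simp]: "su_norm (su_scalar a) = \<bar>a\<bar>" by (simp add: su_norm_def su_scalar_def)

lemma su_norm_adj [simp]: "su_norm (su_adj M) = su_norm M"
  by (simp add: su_norm_def su_adj_def)

lemma su_adj_mult: "su_adj (M * N) = su_adj N * su_adj M"
  by (simp add: su_eq_iff su_adj_def algebra_simps)

lemma su_adj_mult_self: "su_adj M * M = su_scalar (su_det M)"
  by (simp add: su_eq_iff su_adj_def su_scalar_def su_det_def complex_norm_square[symmetric] mult.commute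
      flip: of_real_power)

lemma su_mult_adj_self: "M * su_adj M = su_scalar (su_det M)"
  by (simp add: su_eq_iff su_adj_def su_scalar_def su_det_def complex_norm_square[symmetric] mult.commute
      flip: of_real_power)

lemma su_scalar_one [simp]: "su_scalar 1 = 1" by (simp add: su_eq_iff su_scalar_def)

lemma su_scalar_comm: "M * su_scalar a = su_scalar a * M"
  by (simp add: su_eq_iff su_scalar_def)

lemma su_det_mult: "su_det (M * N) = su_det M * su_det N"
proof -
  have c: "complex_of_real (su_det K) = su_p K * cnj (su_p K) - su_q K * cnj (su_q K)" for K
    unfolding su_det_def of_real_diff complex_norm_square ..
  have "complex_of_real (su_det (M * N)) = of_real (su_det M * su_det N)"
    unfolding c of_real_mult by (simp add: algebra_simps)
  then show ?thesis using of_real_eq_iff by blast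
qed

text \<open>Cayley-Hamilton, since \<open>M + su_adj M\<close> is the scalar matrix of the
  trace.\<close>

lemma su_square: "su_det M = 1 \<Longrightarrow> M * M = su_scalar (su_tr M) * M - 1"
proof -
  assume "su_det M = 1"
  then have "M * M + su_adj M * M = M * M + 1" by (simp add: su_adj_mult_self)
  moreover have "(M + su_adj M) = su_scalar (su_tr M)"
    by (simp add: su_eq_iff su_adj_def su_scalar_def su_tr_def complex_add_cnj)
  ultimately show ?thesis by (metis add_diff_cancel_right' distrib_right)
qed

lemma su_tr_mult_commute: "su_tr (M * N) = su_tr (N * M)"
  by (simp add: su_tr_def algebra_simps)

lemma su_tr_simps [simp]:
  "su_tr (M + N) = su_tr M + su_tr N" "su_tr (M - N) = su_tr M - su_tr N"
  "su_tr (su_scalar a * M) = a * su_tr M" "su_tr 1 = 2"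
  by (simp_all add: su_tr_def su_scalar_def)

lemma su_tr_square_mult:
  "su_det M = 1 \<Longrightarrow> su_tr (M * (M * N)) = su_tr M * su_tr (M * N) - su_tr N"
  unfolding mult.assoc[symmetric] su_square by (simp add: algebra_simps)

text \<open>The matrix $(\phi(n), \phi(n-1)) \mapsto (e\, \phi(n) - \phi(n-1), \phi(n))$ in the complex
  coordinate $\phi(n) + i\, \phi(n-1)$.\<close>

definition transfer_mat :: "real \<Rightarrow> su" where "transfer_mat e = SU (\<i> + of_real (e / 2)) (of_real (e / 2))"

text \<open>The matrices of the words obtained from the letters 0 and 1 by iterating the
  substitution 0 to 01, 1 to 011. The matrix of a later site stands further left.\<close>

fun blockA :: "real \<Rightarrow> real \<Rightarrow> nat \<Rightarrow> su" and blockB :: "real \<Rightarrow> real \<Rightarrow> nat \<Rightarrow> su" where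
  "blockA V E 0 = transfer_mat E"
| "blockB V E 0 = transfer_mat (E - V)"
| "blockA V E (Suc k) = blockB V E k * blockA V E k"
| "blockB V E (Suc k) = blockB V E k * (blockB V E k * blockA V E k)"

lemma su_det_transfer_mat [simp]: "su_det (transfer_mat e) = 1"
  by (simp add: su_det_def transfer_mat_def cmod_power2 power_divide)

lemma su_tr_transfer_mat [simp]: "su_tr (transfer_mat e) = e"
  by (simp add: su_tr_def transfer_mat_def)

lemma su_det_block [simp]: "su_det (blockA V E k) = 1 \<and> su_det (blockB V E k) = 1"
  by (induction k) (auto simp: su_det_mult)

text \<open>One level of the substitution is two steps of the trace map;
  \<open>su_tr_square_mult\<close> is the source of its recursion.\<close>

lemma su_tr_block_Suc:
  "su_tr (blockA V E (Suc k)) = su_tr (blockB V E k * blockA V E k)"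
  "su_tr (blockB V E (Suc k)) =
    su_tr (blockB V E k) * su_tr (blockB V E k * blockA V E k) - su_tr (blockA V E k)"
  "su_tr (blockB V E (Suc k) * blockA V E (Suc k)) =
    su_tr (blockA V E (Suc k)) * su_tr (blockB V E (Suc k)) - su_tr (blockB V E k)"
proof -
  let ?A = "blockA V E k" and ?B = "blockB V E k"
  show "su_tr (blockA V E (Suc k)) = su_tr (?B * ?A)" by simp
  show "su_tr (blockB V E (Suc k)) = su_tr ?B * su_tr (?B * ?A) - su_tr ?A"
    by (simp add: su_tr_square_mult)
  \<comment> \<open>A cyclic permutation puts the square of \<open>?B * ?A\<close> in front, where
    the trace identity applies.\<close>
  have "su_tr (blockB V E (Suc k) * blockA V E (Suc k)) = su_tr ((?B * ?A) * ((?B * ?A) * ?B))"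
    using su_tr_mult_commute[of ?B "(?B * ?A) * (?B * ?A)"] by (simp add: mult.assoc)
  also have "\<dots> = su_tr (?B * ?A) * su_tr ((?B * ?A) * ?B) - su_tr ?B"
    by (rule su_tr_square_mult) (simp add: su_det_mult)
  also have "su_tr ((?B * ?A) * ?B) = su_tr (?B * (?B * ?A))"
    by (rule su_tr_mult_commute)
  finally show "su_tr (blockB V E (Suc k) * blockA V E (Suc k)) =
    su_tr (blockA V E (Suc k)) * su_tr (blockB V E (Suc k)) - su_tr ?B" by simp
qed

text \<open>Level \<open>k\<close> carries the traces t(2k) and t(2k+1). Three levels are therefore
  six trace steps, or two steps of \<open>trace_orbit\<close>, after which the alternating signs are
  restored.\<close>

lemma su_tr_block_orbit:
  "su_tr (blockA V E (3 * j)) = - orbit_v V E (2 * j) \<and> su_tr (blockB V E (3 * j)) = orbit_u V E (2 * j) \<and>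
   su_tr (blockB V E (3 * j) * blockA V E (3 * j)) = - orbit_g V E (2 * j)"
proof (induction j)
  case 0
  have "su_tr (transfer_mat (E - V) * transfer_mat E) = E * (E - V) - 2"
    by (simp add: su_tr_def transfer_mat_def algebra_simps)
  then show ?case by simp
next
  case (Suc j)
  have 3: "3 * Suc j = Suc (Suc (Suc (3 * j)))" and 2: "2 * Suc j = Suc (Suc (2 * j))" by simp_all
  show ?case using Suc unfolding 3 2 su_tr_block_Suc trace_orbit_Suc by algebra
qed

lemma su_tr_block_orbit':
  "su_tr (blockB V E (Suc (3 * j))) = orbit_v V E (Suc (2 * j))"
  "su_tr (blockA V E (Suc (Suc (3 * j)))) = orbit_u V E (Suc (2 * j))"
  using su_tr_block_orbit[of V E j] unfolding su_tr_block_Suc trace_orbit_Suc by algebra+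

text \<open>If \<open>A\<close> and \<open>B\<close> have trace 0, then $A^2 = B^2 = -1$ and three substitution steps reproduce the
  pair \<open>(A, B)\<close> exactly; hence the change is controlled by the traces.\<close>

lemma block_drift:
  fixes A B :: su
  assumes det: "su_det A = 1" "su_det B = 1" and nrm: "su_norm A \<le> 2" "su_norm B \<le> 2"
  defines "A1 \<equiv> B * A" and "B1 \<equiv> B * (B * A)"
  defines "A2 \<equiv> B1 * A1" and "B2 \<equiv> B1 * (B1 * A1)"
  defines "A3 \<equiv> B2 * A2" and "B3 \<equiv> B2 * (B2 * A2)"
  defines "s \<equiv> \<bar>su_tr A\<bar> + \<bar>su_tr B\<bar> + \<bar>su_tr B1\<bar> + \<bar>su_tr A2\<bar>"
  shows "su_norm (A3 - A) \<le> 65536 * s" "su_norm (B3 - B) \<le> 65536 * s"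
proof -
  have dets: "su_det B1 = 1" "su_det A2 = 1"
    by (simp_all add: B1_def A1_def A2_def su_det_mult det)
  have sq: "A * A = su_scalar (su_tr A) * A - 1" "B * B = su_scalar (su_tr B) * B - 1"
    "B1 * B1 = su_scalar (su_tr B1) * B1 - 1" "A2 * A2 = su_scalar (su_tr A2) * A2 - 1"
    by (simp_all add: su_square det dets)
  have B1: "B1 = su_scalar (su_tr B) * (B * A) - A"
    unfolding B1_def mult.assoc[symmetric] sq by (simp add: algebra_simps)
  have B2': "B2 = su_scalar (su_tr B1) * A2 - A1"
    unfolding B2_def A2_def mult.assoc[symmetric] sq by (simp add: algebra_simps)
  \<comment> \<open>When the traces vanish, \<open>A2 * A2\<close> is -1 and \<open>B1\<close> is
    \<open>- A\<close>, so that \<open>A3\<close> returns to \<open>A\<close>.\<close>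
  have "A3 = B1 * (A2 * A2)" by (simp add: A3_def B2_def A2_def mult.assoc)
  also have "\<dots> = su_scalar (su_tr A2) * (B1 * A2) - B1"
    unfolding sq by (simp add: algebra_simps) (simp add: mult.assoc[symmetric] su_scalar_comm)
  also have "B1 * A2 = B2" by (simp add: B2_def A2_def)
  finally have A3: "A3 = su_scalar (su_tr A2) * B2 - su_scalar (su_tr B) * (B * A) + A"
    unfolding B1 by simp
  \<comment> \<open>When the traces vanish, \<open>B2\<close> is \<open>- (B * A)\<close>, hence
    \<open>B2 * A\<close> is \<open>B\<close>; this is the main term of
    \<open>B3 = B2 * A3\<close>.\<close>
  have "B2 * A = su_scalar (su_tr B1) * (A2 * A) - B * (A * A)"
    unfolding B2' A1_def by (simp add: algebra_simps)
  also have "B * (A * A) = su_scalar (su_tr A) * (B * A) - B"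
    unfolding sq by (simp add: algebra_simps) (simp add: mult.assoc[symmetric] su_scalar_comm)
  finally have B2A: "B2 * A = su_scalar (su_tr B1) * (A2 * A) - su_scalar (su_tr A) * (B * A) + B" by simp
  have "B3 = B2 * A3" by (simp add: B3_def A3_def)
  also have "\<dots> = su_scalar (su_tr A2) * (B2 * B2) - su_scalar (su_tr B) * (B2 * (B * A)) + B2 * A"
    unfolding A3 by (simp add: algebra_simps) (simp add: mult.assoc[symmetric] su_scalar_comm)
  finally have B3: "B3 = su_scalar (su_tr A2) * (B2 * B2) - su_scalar (su_tr B) * (B2 * (B * A)) +
      (su_scalar (su_tr B1) * (A2 * A) - su_scalar (su_tr A) * (B * A) + B)" unfolding B2A .
  \<comment> \<open>Each letter contributes a factor at most 2. The longest word,
    \<open>B2 * B2\<close>, has 16 letters, which gives the constant \<open>65536\<close>.\<close>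
  have nBA: "su_norm (B * A) \<le> 4" using su_norm_mult_le[OF nrm(2,1)] by simp
  have nB1: "su_norm B1 \<le> 8" using su_norm_mult_le[OF nrm(2) nBA] by (simp add: B1_def)
  have nA2: "su_norm A2 \<le> 32" using su_norm_mult_le[OF nB1 nBA] by (simp add: A2_def A1_def)
  have nB2: "su_norm B2 \<le> 256" using su_norm_mult_le[OF nB1 nA2] by (simp add: A2_def B2_def)
  have nB22: "su_norm (B2 * B2) \<le> 65536" using su_norm_mult_le[OF nB2 nB2] by simp
  have nB2BA: "su_norm (B2 * (B * A)) \<le> 1024" using su_norm_mult_le[OF nB2 nBA] by simp
  have nA2A: "su_norm (A2 * A) \<le> 64" using su_norm_mult_le[OF nA2 nrm(1)] by simp
  have scl: "su_norm (su_scalar a * M) \<le> 65536 * \<bar>a\<bar>" if "su_norm M \<le> 65536" for a M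
    using su_norm_mult_le[OF order_refl that, of "su_scalar a"] by (simp add: mult.commute)
  have s0: "0 \<le> \<bar>su_tr A\<bar>" "0 \<le> \<bar>su_tr B\<bar>" "0 \<le> \<bar>su_tr B1\<bar>" "0 \<le> \<bar>su_tr A2\<bar>" by simp_all
  have "A3 - A = su_scalar (su_tr A2) * B2 - su_scalar (su_tr B) * (B * A)" unfolding A3 by simp
  then have "su_norm (A3 - A) \<le> 65536 * \<bar>su_tr A2\<bar> + 65536 * \<bar>su_tr B\<bar>"
    using su_norm_diff[of "su_scalar (su_tr A2) * B2" "su_scalar (su_tr B) * (B * A)"]
      scl[of B2 "su_tr A2"] scl[of "B * A" "su_tr B"] nB2 nBA by simp
  then show "su_norm (A3 - A) \<le> 65536 * s" unfolding s_def using s0 by argo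
  have "B3 - B = (su_scalar (su_tr A2) * (B2 * B2) - su_scalar (su_tr B) * (B2 * (B * A))) +
      (su_scalar (su_tr B1) * (A2 * A) - su_scalar (su_tr A) * (B * A))" unfolding B3 by simp
  then have "su_norm (B3 - B) \<le> 65536 * \<bar>su_tr A2\<bar> + 65536 * \<bar>su_tr B\<bar> +
      (65536 * \<bar>su_tr B1\<bar> + 65536 * \<bar>su_tr A\<bar>)"
    using su_norm_add[of "su_scalar (su_tr A2) * (B2 * B2) - su_scalar (su_tr B) * (B2 * (B * A))"
        "su_scalar (su_tr B1) * (A2 * A) - su_scalar (su_tr A) * (B * A)"]
      su_norm_diff[of "su_scalar (su_tr A2) * (B2 * B2)" "su_scalar (su_tr B) * (B2 * (B * A))"]
      su_norm_diff[of "su_scalar (su_tr B1) * (A2 * A)" "su_scalar (su_tr A) * (B * A)"]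
      scl[OF nB22, of "su_tr A2"] scl[of "B2 * (B * A)" "su_tr B"]
      scl[of "A2 * A" "su_tr B1"] scl[of "B * A" "su_tr A"] nB2BA nBA nA2A by simp
  then show "su_norm (B3 - B) \<le> 65536 * s" unfolding s_def using s0 by argo
qed

text \<open>\<open>SU \<i> 0\<close> is the transfer matrix at \<open>E = V = 0\<close>. The drifts
  from \<open>block_drift\<close> are added up; the norm bound 2 that each of them requires persists
  because \<open>V + 655360 * V\<close> is at most 1, whence the threshold on
  \<open>V\<close>.\<close>

lemma block_near_rotation:
  assumes V: "0 < V" "V \<le> 1 / 1000000" and E: "0 \<le> E" "E \<le> V"
    and S: "(\<Sum>i<2 * J. \<bar>orbit_u V E i\<bar> + \<bar>orbit_v V E i\<bar>) \<le> 10 * V" and j: "j \<le> J"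
  shows "su_norm (blockA V E (3 * j) - SU \<i> 0) \<le> V + 65536 * (\<Sum>i<2 * j. \<bar>orbit_u V E i\<bar> + \<bar>orbit_v V E i\<bar>) \<and>
    su_norm (blockB V E (3 * j) - SU \<i> 0) \<le> V + 65536 * (\<Sum>i<2 * j. \<bar>orbit_u V E i\<bar> + \<bar>orbit_v V E i\<bar>)"
  using j
proof (induction j)
  case 0
  have "su_norm (transfer_mat e - SU \<i> 0) = \<bar>e\<bar>" for e
    by (simp add: su_norm_def transfer_mat_def)
  then show ?case using V E by simp
next
  case (Suc j)
  define F where "F = (\<lambda>n. \<Sum>i<n. \<bar>orbit_u V E i\<bar> + \<bar>orbit_v V E i\<bar>)"
  let ?A = "blockA V E (3 * j)" and ?B = "blockB V E (3 * j)"
  let ?R = "SU \<i> 0"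
  have IH: "su_norm (?A - ?R) \<le> V + 65536 * F (2 * j)" "su_norm (?B - ?R) \<le> V + 65536 * F (2 * j)"
    using Suc by (auto simp: F_def)
  have "F (2 * j) \<le> F (2 * J)" unfolding F_def using Suc.prems by (intro sum_mono2) auto
  then have small: "V + 65536 * F (2 * j) \<le> 1" using S V by (simp add: F_def)
  have nR: "su_norm ?R = 1" by (simp add: su_norm_def)
  have nrm: "su_norm ?A \<le> 2" "su_norm ?B \<le> 2"
    using su_norm_add[of "?A - ?R" ?R] su_norm_add[of "?B - ?R" ?R] IH small nR by simp_all
  have 3: "3 * Suc j = Suc (Suc (Suc (3 * j)))" and 2: "2 * Suc j = Suc (Suc (2 * j))" by simp_all
  have F: "F (2 * Suc j) = F (2 * j) + (\<bar>orbit_u V E (2*j)\<bar> + \<bar>orbit_v V E (2*j)\<bar> + (\<bar>orbit_u V E (Suc (2*j))\<bar> + \<bar>orbit_v V E (Suc (2*j))\<bar>))"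
    unfolding 2 by (simp add: F_def)
  have tr: "su_tr ?A = - orbit_v V E (2 * j)" "su_tr ?B = orbit_u V E (2 * j)"
    "su_tr (?B * (?B * ?A)) = orbit_v V E (Suc (2 * j))"
    "su_tr ((?B * (?B * ?A)) * (?B * ?A)) = orbit_u V E (Suc (2 * j))"
    using su_tr_block_orbit[of V E j] su_tr_block_orbit'[of V E j] by simp_all
  have D: "su_norm (blockA V E (3 * Suc j) - ?A) \<le> 65536 * (F (2 * Suc j) - F (2 * j))"
    "su_norm (blockB V E (3 * Suc j) - ?B) \<le> 65536 * (F (2 * Suc j) - F (2 * j))"
    using block_drift[of ?A ?B] nrm unfolding tr F 3 by (simp_all add: algebra_simps)
  have Fs: "(\<Sum>i<n. \<bar>orbit_u V E i\<bar> + \<bar>orbit_v V E i\<bar>) = F n" for n by (simp add: F_def)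
  have "su_norm (blockA V E (3 * Suc j) - ?R) \<le> su_norm (blockA V E (3 * Suc j) - ?A) + su_norm (?A - ?R)"
    "su_norm (blockB V E (3 * Suc j) - ?R) \<le> su_norm (blockB V E (3 * Suc j) - ?B) + su_norm (?B - ?R)"
    using su_norm_add[of "blockA V E (3 * Suc j) - ?A" "?A - ?R"]
      su_norm_add[of "blockB V E (3 * Suc j) - ?B" "?B - ?R"] by simp_all
  then show ?case using D IH unfolding Fs by argo
qed

text \<open>The rotation estimate holds at levels divisible by 3. The two levels in between are
  words of at most 8 letters in those blocks, hence the eighth power.\<close>

lemma exists_energy_block_bound:
  assumes V: "0 < V" "V \<le> 1 / 1000000"
  obtains E where "0 \<le> E" "E \<le> V"
    "\<And>k. k \<le> K \<Longrightarrow> su_norm (blockA V E k) \<le> (1 + 1000000 * V) ^ 8"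
    "\<And>k. k \<le> K \<Longrightarrow> su_norm (blockB V E k) \<le> (1 + 1000000 * V) ^ 8"
proof -
  obtain E where E: "0 \<le> E" "E \<le> V" "(\<Sum>j\<le>2 * K. \<bar>orbit_u V E j\<bar> + \<bar>orbit_v V E j\<bar>) \<le> 10 * V"
    using exists_tracking_energy[of V "2 * K"] V by auto
  define c where "c = 1 + 1000000 * V"
  have c1: "c \<ge> 1" using V by (simp add: c_def)
  have S: "(\<Sum>i<2 * K. \<bar>orbit_u V E i\<bar> + \<bar>orbit_v V E i\<bar>) \<le> 10 * V"
    using E(3) by (simp add: lessThan_Suc_atMost[symmetric])
  have base: "su_norm (blockA V E (3 * j)) \<le> c" "su_norm (blockB V E (3 * j)) \<le> c" if "j \<le> K" for j
  proof -
    have "(\<Sum>i<2 * j. \<bar>orbit_u V E i\<bar> + \<bar>orbit_v V E i\<bar>) \<le> (\<Sum>i<2 * K. \<bar>orbit_u V E i\<bar> + \<bar>orbit_v V E i\<bar>)"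
      using that by (intro sum_mono2) auto
    then have "su_norm (blockA V E (3 * j) - SU \<i> 0) \<le> c - 1" "su_norm (blockB V E (3 * j) - SU \<i> 0) \<le> c - 1"
      using block_near_rotation[OF V E(1,2) S that] S V unfolding c_def by linarith+
    then show "su_norm (blockA V E (3 * j)) \<le> c" "su_norm (blockB V E (3 * j)) \<le> c"
      using su_norm_add[of "blockA V E (3 * j) - SU \<i> 0" "SU \<i> 0"]
        su_norm_add[of "blockB V E (3 * j) - SU \<i> 0" "SU \<i> 0"] by (simp_all add: su_norm_def)
  qed
  have stepA: "su_norm (blockA V E (Suc k)) \<le> c ^ (a + b)"
    if "su_norm (blockA V E k) \<le> c ^ a" "su_norm (blockB V E k) \<le> c ^ b" for k a b
    using su_norm_mult_le[OF that(2,1)] by (simp add: power_add mult.commute)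
  have stepB: "su_norm (blockB V E (Suc k)) \<le> c ^ (b + (b + a))"
    if "su_norm (blockA V E k) \<le> c ^ a" "su_norm (blockB V E k) \<le> c ^ b" for k a b
    unfolding blockB.simps power_add by (intro su_norm_mult_le that)
  have "su_norm (blockA V E k) \<le> c ^ 8 \<and> su_norm (blockB V E k) \<le> c ^ 8" if k: "k \<le> K" for k
  proof -
    define j where "j = k div 3"
    have jK: "j \<le> K" using k by (simp add: j_def)
    have 0: "su_norm (blockA V E (3 * j)) \<le> c ^ 1" "su_norm (blockB V E (3 * j)) \<le> c ^ 1"
      using base[OF jK] by simp_all
    note 1 = stepA[OF 0] stepB[OF 0]
    note 2 = stepA[OF 1] stepB[OF 1]
    have up: "x \<le> c ^ 8" if "x \<le> c ^ n" "n \<le> 8" for x n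
      using power_increasing[OF that(2) c1] that(1) by linarith
    have "k = 3 * j \<or> k = Suc (3 * j) \<or> k = Suc (Suc (3 * j))" unfolding j_def by presburger
    then show ?thesis
      using up[OF 0(1)] up[OF 0(2)] up[OF 1(1)] up[OF 1(2)] up[OF 2(1)] up[OF 2(2)] by fastforce
  qed
  then show ?thesis using that[of E] E by (simp add: c_def)
qed

section \<open>Renormalization of the rotation\<close>

lemma fib_alpha_sq: "fib_alpha * fib_alpha = 1 - fib_alpha"
  by (simp add: fib_alpha_def field_simps)

lemma fib_alpha_bounds: "0 < fib_alpha" "fib_alpha < 1"
proof -
  have "1 < sqrt 5" by simp
  moreover have "sqrt 5 < 3" by (rule real_less_lsqrt) auto
  ultimately show "0 < fib_alpha" "fib_alpha < 1" by (auto simp: fib_alpha_def)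
qed

definition rot :: "real \<Rightarrow> real" where
  "rot x = (if x < 1 - fib_alpha then x + fib_alpha else x + fib_alpha - 1)"

definition site_mat :: "real \<Rightarrow> real \<Rightarrow> real \<Rightarrow> su" where
  "site_mat V E x = transfer_mat (if x < 1 - fib_alpha then E else E - V)"

fun window :: "real \<Rightarrow> real \<Rightarrow> real \<Rightarrow> nat \<Rightarrow> su" where
  "window V E x 0 = 1"
| "window V E x (Suc n) = site_mat V E ((rot ^^ n) x) * window V E x n"

lemma window_add: "window V E x (m + n) = window V E ((rot ^^ m) x) n * window V E x m"
  by (induction n) (simp_all add: mult.assoc funpow_add[symmetric] add.commute flip: comp_apply[of "rot ^^ _"])

lemma su_det_window [simp]: "su_det (window V E x n) = 1"
  by (induction n) (simp_all add: su_det_mult site_mat_def, simp add: su_det_def)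

fun lenA :: "nat \<Rightarrow> nat" and lenB :: "nat \<Rightarrow> nat" where
  "lenA 0 = 1" | "lenB 0 = 1"
| "lenA (Suc k) = lenA k + lenB k"
| "lenB (Suc k) = lenA k + lenB k + lenB k"

lemma len_ge: "2 ^ k \<le> lenA k \<and> lenA k \<le> lenB k"
  by (induction k) auto

abbreviation "level k \<equiv> fib_alpha ^ (2 * k)"

text \<open>Together with \<open>alpha_level_Suc\<close> this makes every comparison of interval
  ends linear in \<open>level k\<close> and \<open>fib_alpha * level k\<close>.\<close>

lemma level_Suc: "level (Suc k) = level k - fib_alpha * level k"
proof -
  have "level (Suc k) = (fib_alpha * fib_alpha) * level k" by simp
  then show ?thesis unfolding fib_alpha_sq by (simp add: algebra_simps)
qed

lemma alpha_level_Suc: "fib_alpha * level (Suc k) = 2 * (fib_alpha * level k) - level k"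
proof -
  have "fib_alpha * level (Suc k) = fib_alpha * level k - (fib_alpha * fib_alpha) * level k"
    unfolding level_Suc by (simp add: algebra_simps)
  then show ?thesis unfolding fib_alpha_sq by (simp add: algebra_simps)
qed

lemma level_pos: "0 < level k" "0 < fib_alpha * level k"
  using fib_alpha_bounds by simp_all

text \<open>The coding is self-similar under $0 \mapsto 01$, $1 \mapsto 011$: the first return map to
  $[0, \alpha^{2k})$ is the original rotation scaled by $\alpha^{2k}$, and the words read between
  two returns are the images of the two letters.\<close>

lemma block_return:
  assumes "0 \<le> x" "x < level k"
  shows "x < level (Suc k) \<Longrightarrow> (rot ^^ lenA k) x = x + fib_alpha * level k \<and> window V E x (lenA k) = blockA V E k"
    and "level (Suc k) \<le> x \<Longrightarrow> (rot ^^ lenB k) x = x - level (Suc k) \<and> window V E x (lenB k) = blockB V E k"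
proof -
  have "(x < level (Suc k) \<longrightarrow> (rot ^^ lenA k) x = x + fib_alpha * level k \<and> window V E x (lenA k) = blockA V E k) \<and>
    (level (Suc k) \<le> x \<longrightarrow> (rot ^^ lenB k) x = x - level (Suc k) \<and> window V E x (lenB k) = blockB V E k)"
    using assms
  proof (induction k arbitrary: x)
    case 0
    have "level (Suc 0) = 1 - fib_alpha" using fib_alpha_sq by (simp add: power2_eq_square)
    then show ?case
      by (auto simp: rot_def site_mat_def)
  next
    case (Suc k)
    note IH1 = Suc.IH[THEN conjunct1, THEN mp] and IH2 = Suc.IH[THEN conjunct2, THEN mp]
    note l = level_Suc[of k] level_Suc[of "Suc k"] alpha_level_Suc[of k] level_pos[of k] level_pos[of "Suc k"] level_pos[of "Suc (Suc k)"]
    define x1 where "x1 = x + fib_alpha * level k"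
    define x2 where "x2 = x1 - level (Suc k)"
    have s1: "(rot ^^ lenA k) x = x1 \<and> window V E x (lenA k) = blockA V E k"
      unfolding x1_def using Suc.prems l by (intro IH1) linarith+
    \<comment> \<open>Since 1 - \<alpha> < \<alpha>, a return of the first kind always lands in the
      right part: in the coding, 0 is always followed by 1.\<close>
    have x1: "level (Suc k) \<le> x1" "0 \<le> x1" "x1 < level k" using Suc.prems l unfolding x1_def by linarith+
    have s2: "(rot ^^ lenB k) x1 = x2 \<and> window V E x1 (lenB k) = blockB V E k"
      unfolding x2_def using x1 by (intro IH2)
    have x2: "x2 = x + fib_alpha * level (Suc k)" unfolding x2_def x1_def using l by linarith
    have rotAB: "(rot ^^ (lenA k + lenB k)) x = x2"
      using s1 s2 by (metis add.commute comp_apply funpow_add)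
    have winAB: "window V E x (lenA k + lenB k) = blockB V E k * blockA V E k"
      unfolding window_add using s1 s2 by simp
    have "(rot ^^ lenA (Suc k)) x = x + fib_alpha * level (Suc k) \<and> window V E x (lenA (Suc k)) = blockA V E (Suc k)"
      using rotAB winAB x2 by simp
    moreover have "(rot ^^ lenB (Suc k)) x = x - level (Suc (Suc k)) \<and> window V E x (lenB (Suc k)) = blockB V E (Suc k)"
      if x: "level (Suc (Suc k)) \<le> x"
    proof -
      have s3: "(rot ^^ lenB k) x2 = x2 - level (Suc k) \<and> window V E x2 (lenB k) = blockB V E k"
        using x Suc.prems l unfolding x2 by (intro IH2) linarith+
      have "(rot ^^ (lenA k + lenB k + lenB k)) x = x2 - level (Suc k)"
        using rotAB s3 by (metis add.commute comp_apply funpow_add)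
      moreover have "window V E x (lenA k + lenB k + lenB k) = blockB V E k * (blockB V E k * blockA V E k)"
        unfolding window_add[of V E x "lenA k + lenB k"] winAB using rotAB s3 by simp
      moreover have "x2 - level (Suc k) = x - level (Suc (Suc k))" unfolding x2 using l by linarith
      ultimately show ?thesis by simp
    qed
    ultimately show ?case by blast
  qed
  then show "x < level (Suc k) \<Longrightarrow> (rot ^^ lenA k) x = x + fib_alpha * level k \<and> window V E x (lenA k) = blockA V E k"
    "level (Suc k) \<le> x \<Longrightarrow> (rot ^^ lenB k) x = x - level (Suc k) \<and> window V E x (lenB k) = blockB V E k" by blast+
qed

section \<open>Cutting a window into logarithmically many blocks\<close>

context
  fixes V E b :: real and K :: nat
  assumes b: "1 \<le> b"
    and bA: "\<And>k. k \<le> K \<Longrightarrow> su_norm (blockA V E k) \<le> b"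
    and bB: "\<And>k. k \<le> K \<Longrightarrow> su_norm (blockB V E k) \<le> b"
begin

lemma pow_b_mono: "x \<le> b ^ m \<Longrightarrow> m \<le> n \<Longrightarrow> x \<le> b ^ n"
  using power_increasing[OF _ b] by (metis order_trans)

lemma window_add_le:
  assumes "su_norm (window V E ((rot ^^ m) x) n) \<le> b ^ i" "su_norm (window V E x m) \<le> b ^ j"
  shows "su_norm (window V E x (m + n)) \<le> b ^ (i + j)"
  unfolding window_add power_add by (rule su_norm_mult_le[OF assms])

text \<open>A prefix of a block of level k + 1 consists of at most two whole blocks of level k and a
  prefix of a third. Each level thus costs two factors \<open>b\<close>; the extra one is the single
  site at level 0.\<close>

lemma block_prefix_bound:
  assumes "k \<le> K" "0 \<le> x" "x < level k"
  shows "x < level (Suc k) \<Longrightarrow> n \<le> lenA k \<Longrightarrow> su_norm (window V E x n) \<le> b ^ (2 * k + 1)"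
    and "level (Suc k) \<le> x \<Longrightarrow> n \<le> lenB k \<Longrightarrow> su_norm (window V E x n) \<le> b ^ (2 * k + 1)"
proof -
  have "(x < level (Suc k) \<longrightarrow> n \<le> lenA k \<longrightarrow> su_norm (window V E x n) \<le> b ^ (2 * k + 1)) \<and>
    (level (Suc k) \<le> x \<longrightarrow> n \<le> lenB k \<longrightarrow> su_norm (window V E x n) \<le> b ^ (2 * k + 1))"
    using assms
  proof (induction k arbitrary: x n)
    case 0
    have "su_norm (site_mat V E x) \<le> b" using bA[of 0] bB[of 0] by (simp add: site_mat_def)
    moreover have "n = 0 \<or> n = 1" if "n \<le> 1" for n :: nat using that by auto
    ultimately show ?case using b by fastforce
  next
    case (Suc k)
    note IH1 = Suc.IH[THEN conjunct1, THEN mp, THEN mp] and IH2 = Suc.IH[THEN conjunct2, THEN mp, THEN mp]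
    note l = level_Suc[of k] level_Suc[of "Suc k"] alpha_level_Suc[of k] level_pos[of k] level_pos[of "Suc k"] level_pos[of "Suc (Suc k)"]
    have k: "k \<le> K" using Suc.prems by simp
    have x: "0 \<le> x" "x < level k" "x < level (Suc k)" using Suc.prems l by linarith+
    define x1 where "x1 = x + fib_alpha * level k"
    have x1: "level (Suc k) \<le> x1" "0 \<le> x1" "x1 < level k" using x l unfolding x1_def by linarith+
    have s1: "(rot ^^ lenA k) x = x1" "window V E x (lenA k) = blockA V E k"
      using block_return(1)[OF x(1,2,3)] by (auto simp: x1_def)
    have s2: "(rot ^^ lenB k) x1 = x1 - level (Suc k)" "window V E x1 (lenB k) = blockB V E k"
      using block_return(2)[OF x1(2,3,1)] by auto
    have AB: "su_norm (window V E x n) \<le> b ^ (2 * Suc k)" if n: "n \<le> lenA k + lenB k" for n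
    proof (cases "n \<le> lenA k")
      case True
      then show ?thesis using pow_b_mono[OF IH1[OF k x], of n "2 * Suc k"] by simp
    next
      case False
      then obtain m where m: "n = lenA k + m" "m \<le> lenB k" using n by (metis add_le_cancel_left le_Suc_ex nat_le_linear)
      show ?thesis unfolding m(1)
        using window_add_le[of "lenA k" x m "2 * k + 1" 1] s1 bA[OF k] IH2[OF k x1(2,3,1) m(2)] by simp
    qed
    have "su_norm (window V E x n) \<le> b ^ (2 * Suc k + 1)" if "n \<le> lenA (Suc k)"
      using pow_b_mono[OF AB[of n], of "2 * Suc k + 1"] that by simp
    moreover have "su_norm (window V E x n) \<le> b ^ (2 * Suc k + 1)" if n: "level (Suc (Suc k)) \<le> x" "n \<le> lenB (Suc k)"
    proof (cases "n \<le> lenA k + lenB k")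
      case True
      then show ?thesis using pow_b_mono[OF AB[of n], of "2 * Suc k + 1"] by simp
    next
      case False
      then obtain m where m: "n = lenA k + lenB k + m" "m \<le> lenB k"
        using n(2) by (metis add_le_cancel_left le_Suc_ex lenB.simps(2) nat_le_linear)
      define x2 where "x2 = x1 - level (Suc k)"
      have x2: "level (Suc k) \<le> x2" "0 \<le> x2" "x2 < level k" using n(1) x l unfolding x2_def x1_def by linarith+
      have rotAB: "(rot ^^ (lenA k + lenB k)) x = x2"
        using s1 s2 unfolding x2_def by (metis add.commute comp_apply funpow_add)
      have "su_norm (window V E x (lenA k + lenB k)) \<le> b ^ 2"
        using window_add_le[of "lenA k" x "lenB k" 1 1] s1 s2 bA[OF k] bB[OF k] by (simp add: numeral_2_eq_2)
      then show ?thesis unfolding m(1)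
        using window_add_le[of "lenA k + lenB k" x m "2 * k + 1" 2] rotAB IH2[OF k x2(2,3,1) m(2)] by simp
    qed
    ultimately show ?case by blast
  qed
  then show "x < level (Suc k) \<Longrightarrow> n \<le> lenA k \<Longrightarrow> su_norm (window V E x n) \<le> b ^ (2 * k + 1)"
    "level (Suc k) \<le> x \<Longrightarrow> n \<le> lenB k \<Longrightarrow> su_norm (window V E x n) \<le> b ^ (2 * k + 1)" by blast+
qed

text \<open>An arbitrary phase is moved down level by level. A point of \<open>[0, level k)\<close>
  to the right of \<open>level (Suc k)\<close> is shifted left by \<open>level (Suc k)\<close> along
  a block of type \<open>B\<close>; two such jumps suffice because
  \<open>level k < 3 * level (Suc k)\<close>. Windows ending during the descent are bounded as
  well.\<close>

lemma enter_level:
  assumes "k \<le> K" "0 \<le> x" "x < 1"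
  shows "\<exists>r. 0 \<le> (rot ^^ r) x \<and> (rot ^^ r) x < level k \<and> su_norm (window V E x r) \<le> b ^ (2 * k) \<and>
    (\<forall>n\<le>r. su_norm (window V E x n) \<le> b ^ (4 * k + 1))"
  using assms(1)
proof (induction k)
  case 0
  then show ?case using assms b by (intro exI[of _ 0]) auto
next
  case (Suc k)
  note l = level_Suc[of k] level_Suc[of "Suc k"] alpha_level_Suc[of k] level_pos[of k] level_pos[of "Suc k"] level_pos[of "Suc (Suc k)"]
  have k: "k \<le> K" using Suc.prems by simp
  \<comment> \<open>\<open>j\<close> is slack: with 4 at the first jump and 3 at the second, both
    prefix bounds have the exponent \<open>4 * Suc k + 1\<close>.\<close>
  have jump: "0 \<le> (rot ^^ (r + lenB k)) x \<and> (rot ^^ (r + lenB k)) x = (rot ^^ r) x - level (Suc k) \<and>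
      su_norm (window V E x (r + lenB k)) \<le> b ^ Suc i \<and>
      (\<forall>n\<le>r + lenB k. su_norm (window V E x n) \<le> b ^ (2 * k + 1 + i + j))"
    if y: "level (Suc k) \<le> (rot ^^ r) x" "(rot ^^ r) x < level k" and w: "su_norm (window V E x r) \<le> b ^ i"
      and pre: "\<forall>n\<le>r. su_norm (window V E x n) \<le> b ^ (2 * k + 1 + i + j)" for r i j
  proof (intro conjI allI impI)
    have y0: "0 \<le> (rot ^^ r) x" using y l by linarith
    note ret = block_return(2)[OF y0 y(2,1), of V E]
    show rr: "(rot ^^ (r + lenB k)) x = (rot ^^ r) x - level (Suc k)"
      using ret by (metis add.commute comp_apply funpow_add)
    show "0 \<le> (rot ^^ (r + lenB k)) x" unfolding rr using y by linarith
    show "su_norm (window V E x (r + lenB k)) \<le> b ^ Suc i"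
      using window_add_le[of r x "lenB k" 1 i] ret bB[OF k] w by simp
    fix n assume n: "n \<le> r + lenB k"
    show "su_norm (window V E x n) \<le> b ^ (2 * k + 1 + i + j)"
    proof (cases "n \<le> r")
      case False
      then obtain m where m: "n = r + m" "m \<le> lenB k" using n by (metis add_le_cancel_left le_Suc_ex nat_le_linear)
      show ?thesis unfolding m(1)
        by (rule pow_b_mono[OF window_add_le[OF block_prefix_bound(2)[OF k y0 y(2,1) m(2)] w]]) simp
    qed (use pre in auto)
  qed
  obtain r where r: "0 \<le> (rot ^^ r) x" "(rot ^^ r) x < level k" "su_norm (window V E x r) \<le> b ^ (2 * k)"
    "\<forall>n\<le>r. su_norm (window V E x n) \<le> b ^ (4 * k + 1)"
    using Suc by auto
  have r4: "\<forall>n\<le>r. su_norm (window V E x n) \<le> b ^ (4 * Suc k + 1)"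
    using r(4) pow_b_mono[of _ "4 * k + 1" "4 * Suc k + 1"] by simp
  show ?case
  proof (cases "(rot ^^ r) x < level (Suc k)")
    case True
    then show ?thesis using r r4 pow_b_mono[of _ "2 * k" "2 * Suc k"] by (intro exI[of _ r]) auto
  next
    case False
    then have y: "level (Suc k) \<le> (rot ^^ r) x" by simp
    have e1: "2 * k + 1 + 2 * k + 4 = 4 * Suc k + 1" by simp
    note j1 = jump[OF y r(2,3), of 4, unfolded e1, OF r4]
    show ?thesis
    proof (cases "(rot ^^ (r + lenB k)) x < level (Suc k)")
      case True
      then show ?thesis using j1 pow_b_mono[of _ "Suc (2 * k)" "2 * Suc k"] by (intro exI[of _ "r + lenB k"]) auto
    next
      case False
      have e2: "2 * k + 1 + Suc (2 * k) + 3 = 4 * Suc k + 1" by simp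
      have y1: "level (Suc k) \<le> (rot ^^ (r + lenB k)) x" using False by simp
      have y1': "(rot ^^ (r + lenB k)) x < level k" using j1 r l by linarith
      have j2: "0 \<le> (rot ^^ (r + lenB k + lenB k)) x \<and>
        (rot ^^ (r + lenB k + lenB k)) x = (rot ^^ (r + lenB k)) x - level (Suc k) \<and>
        su_norm (window V E x (r + lenB k + lenB k)) \<le> b ^ Suc (Suc (2 * k)) \<and>
        (\<forall>n\<le>r + lenB k + lenB k. su_norm (window V E x n) \<le> b ^ (4 * Suc k + 1))"
        using jump[OF y1 y1', of "Suc (2 * k)" 3] j1 unfolding e2 by blast
      have "(rot ^^ (r + lenB k + lenB k)) x < level (Suc k)" using j1 j2 r l by linarith
      with j2 show ?thesis by (intro exI[of _ "r + lenB k + lenB k"]) simp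
    qed
  qed
qed

text \<open>After the entry into \<open>[0, level k)\<close> at most a prefix of one block remains,
  as both block lengths are at least \<open>2 ^ k\<close>.\<close>

lemma window_bound:
  assumes "k \<le> K" "0 \<le> x" "x < 1" "n \<le> 2 ^ k"
  shows "su_norm (window V E x n) \<le> b ^ (4 * k + 1)"
proof -
  obtain r where r: "0 \<le> (rot ^^ r) x" "(rot ^^ r) x < level k" "su_norm (window V E x r) \<le> b ^ (2 * k)"
    "\<forall>n\<le>r. su_norm (window V E x n) \<le> b ^ (4 * k + 1)"
    using enter_level[OF assms(1-3)] by auto
  show ?thesis
  proof (cases "n \<le> r")
    case False
    then obtain m where m: "n = r + m" "m \<le> 2 ^ k" using assms by (metis le_Suc_ex nat_le_linear add_leD2)
    have "m \<le> lenA k" "m \<le> lenB k" using m len_ge[of k] by linarith+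
    then have "su_norm (window V E ((rot ^^ r) x) m) \<le> b ^ (2 * k + 1)"
      using block_prefix_bound[OF assms(1) r(1,2)] by (cases "(rot ^^ r) x < level (Suc k)") auto
    from window_add_le[OF this r(3)] show ?thesis by (simp add: m)
  qed (use r in auto)
qed

end

lemma frac_rot: "frac (x + fib_alpha) = rot (frac x)"
proof -
  have "frac fib_alpha = fib_alpha" using fib_alpha_bounds by (simp add: frac_eq)
  then show ?thesis unfolding frac_add rot_def by auto
qed

lemma frac_funpow_rot: "frac (of_int (m + int n) * fib_alpha + \<omega>) = (rot ^^ n) (frac (of_int m * fib_alpha + \<omega>))"
proof (induction n)
  case (Suc n)
  have eq: "of_int (m + int (Suc n)) * fib_alpha + \<omega> = (of_int (m + int n) * fib_alpha + \<omega>) + fib_alpha"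
    by (simp add: algebra_simps)
  show ?case unfolding eq frac_rot Suc.IH by simp
qed simp

lemma fib_potential_site:
  "transfer_mat (E - fib_potential V \<omega> (m + int n)) = site_mat V E ((rot ^^ n) (frac (of_int m * fib_alpha + \<omega>)))"
  using frac_lt_1 unfolding site_mat_def frac_funpow_rot[symmetric]
  by (auto simp: fib_potential_def indicator_def)

section \<open>Solutions at complex energies\<close>

text \<open>For complex solutions, $\xi = \phi(n) + i\,\phi(n-1)$ and $\eta = \phi(n) - i\,\phi(n-1)$ are no
  longer conjugate to each other and both are kept.\<close>

definition su_act :: "su \<Rightarrow> complex \<times> complex \<Rightarrow> complex \<times> complex" where
  "su_act M x = (su_p M * fst x + su_q M * snd x, cnj (su_q M) * fst x + cnj (su_p M) * snd x)"

text \<open>For the maximum norm, \<open>su_norm\<close> still bounds the action when the two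
  components are not conjugate: both rows have absolute sum \<open>su_norm\<close>.\<close>

definition vnorm :: "complex \<times> complex \<Rightarrow> real" where
  "vnorm x = max (cmod (fst x)) (cmod (snd x))"

lemma su_act_mult: "su_act (M * N) x = su_act M (su_act N x)"
  by (simp add: su_act_def algebra_simps)

lemma su_act_one [simp]: "su_act 1 x = x"
  by (simp add: su_act_def)

lemma su_act_add: "su_act M (x + y) = su_act M x + su_act M y"
  by (simp add: su_act_def algebra_simps)

lemma vnorm_ge_0 [simp]: "0 \<le> vnorm x"
  by (simp add: vnorm_def le_max_iff_disj)

lemma vnorm_triangle: "vnorm (x + y) \<le> vnorm x + vnorm y"
  unfolding vnorm_def fst_add snd_add
  using norm_triangle_ineq[of "fst x" "fst y"] norm_triangle_ineq[of "snd x" "snd y"] by linarith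

lemma vnorm_act: "su_norm M \<le> D \<Longrightarrow> vnorm (su_act M x) \<le> D * vnorm x"
proof -
  assume D: "su_norm M \<le> D"
  have m: "cmod (fst x) \<le> vnorm x" "cmod (snd x) \<le> vnorm x" by (auto simp: vnorm_def)
  have "cmod (a * fst x + b * snd x) \<le> (cmod a + cmod b) * vnorm x" for a b
    using norm_triangle_ineq[of "a * fst x" "b * snd x"]
      mult_left_mono[OF m(1), of "cmod a"] mult_left_mono[OF m(2), of "cmod b"]
    by (simp add: norm_mult algebra_simps)
  from this[of "su_p M" "su_q M"] this[of "cnj (su_q M)" "cnj (su_p M)"]
  have "vnorm (su_act M x) \<le> su_norm M * vnorm x"
    by (simp add: vnorm_def su_act_def su_norm_def add.commute)
  also have "\<dots> \<le> D * vnorm x" using D by (intro mult_right_mono) auto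
  finally show ?thesis .
qed

text \<open>Variation of constants about the real energy. Conjugating with the windows costs a
  factor \<open>D\<close> twice, so each step makes a relative error at most
  \<open>\<kappa> * D^2\<close>; the smallness assumption keeps the total over \<open>N\<close>
  steps below 1/2.\<close>

context
  fixes V E \<omega> \<kappa> D :: real and \<phi> :: "int \<Rightarrow> complex" and m :: int and N :: nat
  assumes eq: "\<And>j. j < N \<Longrightarrow> \<phi> (m + int j + 1) + \<phi> (m + int j - 1) + fib_potential V \<omega> (m + int j) * \<phi> (m + int j)
      = Complex E \<kappa> * \<phi> (m + int j)"
    and bound: "\<And>n. n \<le> N \<Longrightarrow> su_norm (window V E (frac (of_int m * fib_alpha + \<omega>)) n) \<le> D"
    and \<kappa>: "0 < \<kappa>" and small: "\<kappa> * D\<^sup>2 * real N \<le> 1 / 2"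
begin

definition state :: "nat \<Rightarrow> complex \<times> complex" where
  "state j = (\<phi> (m + int j) + \<i> * \<phi> (m + int j - 1), \<phi> (m + int j) - \<i> * \<phi> (m + int j - 1))"

abbreviation "W \<equiv> window V E (frac (of_int m * fib_alpha + \<omega>))"

text \<open>Relative to the solution at the real energy \<open>E\<close>, only the imaginary part \<open>\<kappa>\<close> drives the motion.\<close>

definition interaction :: "nat \<Rightarrow> complex \<times> complex" where
  "interaction j = su_act (su_adj (W j)) (state j)"

lemma state_interaction: "state j = su_act (W j) (interaction j)"
  unfolding interaction_def su_act_mult[symmetric] su_mult_adj_self by simp

lemma state_Suc:
  assumes "j < N"
  shows "state (Suc j) = su_act (transfer_mat (E - fib_potential V \<omega> (m + int j))) (state j) +
    (\<i> * \<kappa> * \<phi> (m + int j), \<i> * \<kappa> * \<phi> (m + int j))"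
proof -
  have i: "m + int (Suc j) = m + int j + 1" "m + int (Suc j) - 1 = m + int j" by simp_all
  have C: "Complex E \<kappa> = E + \<i> * \<kappa>" by (simp add: complex_eq_iff)
  have e: "\<phi> (m + int j + 1) = (E + \<i> * \<kappa>) * \<phi> (m + int j) - \<phi> (m + int j - 1) -
      fib_potential V \<omega> (m + int j) * \<phi> (m + int j)"
    using eq[OF assms] unfolding C by (simp add: algebra_simps)
  show ?thesis
    unfolding state_def i e by (simp add: su_act_def transfer_mat_def field_simps)
qed

lemma D_ge_1: "1 \<le> D"
  using bound[of 0] by simp

lemma interaction_step:
  assumes j: "j < N"
  shows "interaction (Suc j) = interaction j + su_act (su_adj (W (Suc j))) (\<i> * \<kappa> * \<phi> (m + int j), \<i> * \<kappa> * \<phi> (m + int j))"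
    and "vnorm (su_act (su_adj (W (Suc j))) (\<i> * \<kappa> * \<phi> (m + int j), \<i> * \<kappa> * \<phi> (m + int j)))
      \<le> \<kappa> * D\<^sup>2 * vnorm (interaction j)"
proof -
  let ?e = "(\<i> * \<kappa> * \<phi> (m + int j), \<i> * \<kappa> * \<phi> (m + int j)) :: complex \<times> complex"
  let ?T = "transfer_mat (E - fib_potential V \<omega> (m + int j))"
  have W: "W (Suc j) = ?T * W j" unfolding fib_potential_site by simp
  have "su_adj (W (Suc j)) * ?T = su_adj (W j)"
    unfolding W su_adj_mult mult.assoc su_adj_mult_self by simp
  then show "interaction (Suc j) = interaction j + su_act (su_adj (W (Suc j))) ?e"
    unfolding interaction_def state_Suc[OF j] su_act_add su_act_mult[symmetric] by simp
  have "cmod (fst (state j) + snd (state j)) = 2 * cmod (\<phi> (m + int j))"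
  proof -
    have "fst (state j) + snd (state j) = 2 * \<phi> (m + int j)" by (simp add: state_def)
    then show ?thesis by (simp add: norm_mult)
  qed
  then have "cmod (\<phi> (m + int j)) \<le> (cmod (fst (state j)) + cmod (snd (state j))) / 2"
    using norm_triangle_ineq[of "fst (state j)" "snd (state j)"] by simp
  also have "\<dots> \<le> vnorm (state j)" unfolding vnorm_def by (simp add: max_def)
  finally have p: "cmod (\<phi> (m + int j)) \<le> vnorm (state j)" .
  have "vnorm (su_act (su_adj (W (Suc j))) ?e) \<le> D * vnorm ?e"
    using bound[of "Suc j"] j by (intro vnorm_act) (simp del: window.simps)
  also have "vnorm ?e = \<kappa> * cmod (\<phi> (m + int j))" using \<kappa> by (simp add: vnorm_def norm_mult)
  also have "\<dots> \<le> \<kappa> * vnorm (state j)" using p \<kappa> by (intro mult_left_mono) auto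
  also have "vnorm (state j) \<le> D * vnorm (interaction j)"
    unfolding state_interaction[of j] using bound[of j] j by (intro vnorm_act) simp
  finally show "vnorm (su_act (su_adj (W (Suc j))) ?e) \<le> \<kappa> * D\<^sup>2 * vnorm (interaction j)"
    using \<kappa> D_ge_1 by (simp add: power2_eq_square mult_ac)
qed

text \<open>Each step changes the norm by a factor between \<open>1 - ?r\<close> and
  \<open>1 + ?r\<close>; Bernoulli's inequality makes the lower product linear in
  \<open>j\<close>.\<close>

lemma interaction_growth:
  assumes "j \<le> N"
  shows "vnorm (interaction j) \<le> (1 + \<kappa> * D\<^sup>2) ^ j * vnorm (interaction 0)"
    and "(1 - \<kappa> * D\<^sup>2 * real j) * vnorm (interaction 0) \<le> vnorm (interaction j)"
proof -
  let ?r = "\<kappa> * D\<^sup>2"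
  have r0: "0 \<le> ?r" using \<kappa> by simp
  have "vnorm (interaction j) \<le> (1 + ?r) ^ j * vnorm (interaction 0) \<and> (1 - ?r) ^ j * vnorm (interaction 0) \<le> vnorm (interaction j)"
    using assms
  proof (induction j)
    case (Suc j)
    let ?d = "su_act (su_adj (W (Suc j))) (\<i> * \<kappa> * \<phi> (m + int j), \<i> * \<kappa> * \<phi> (m + int j))"
    have j: "j < N" using Suc by simp
    note s = interaction_step[OF j]
    have "real N \<ge> 1" using j by simp
    then have "?r \<le> ?r * real N" using r0 mult_left_mono[of 1 "real N" ?r] by simp
    then have r1: "?r \<le> 1 / 2" using small by simp
    have up: "vnorm (interaction (Suc j)) \<le> (1 + ?r) * vnorm (interaction j)"
      using vnorm_triangle[of "interaction j" ?d] s(2) unfolding s(1) by (simp add: algebra_simps)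
    have "interaction j = interaction (Suc j) + - ?d" unfolding s(1) by simp
    then have "vnorm (interaction j) \<le> vnorm (interaction (Suc j)) + vnorm (- ?d)"
      using vnorm_triangle by metis
    moreover have "vnorm (- ?d) = vnorm ?d" by (simp add: vnorm_def)
    ultimately have lo: "(1 - ?r) * vnorm (interaction j) \<le> vnorm (interaction (Suc j))"
      using s(2) by (simp add: algebra_simps)
    have "(1 + ?r) * vnorm (interaction j) \<le> (1 + ?r) * ((1 + ?r) ^ j * vnorm (interaction 0))"
      using Suc r0 by (intro mult_left_mono) auto
    moreover have "(1 - ?r) * ((1 - ?r) ^ j * vnorm (interaction 0)) \<le> (1 - ?r) * vnorm (interaction j)"
      using Suc r1 by (intro mult_left_mono) auto
    ultimately show ?case using up lo by (simp add: mult.assoc)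
  qed simp
  moreover have "1 - ?r * real j \<le> (1 - ?r) ^ j" if "?r \<le> 1"
    using Bernoulli_inequality[of "- ?r" j] that by (simp add: mult.commute)
  \<comment> \<open>For \<open>N = 0\<close> the smallness assumption does not bound
    \<open>?r\<close>, but then only \<open>j = 0\<close> occurs.\<close>
  moreover have "?r \<le> 1 \<or> j = 0"
  proof (cases "j = 0")
    case False
    then have "?r * 1 \<le> ?r * real N" using r0 assms by (intro mult_left_mono) auto
    then show ?thesis using small by simp
  qed simp
  ultimately show "vnorm (interaction j) \<le> (1 + ?r) ^ j * vnorm (interaction 0)"
    "(1 - ?r * real j) * vnorm (interaction 0) \<le> vnorm (interaction j)"
    by (auto intro: order_trans[OF mult_right_mono])
qed

lemma state_growth:
  "vnorm (state N) \<le> 2 * D * vnorm (state 0)" "vnorm (state 0) \<le> 2 * D * vnorm (state N)"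
proof -
  let ?r = "\<kappa> * D\<^sup>2"
  have i0: "interaction 0 = state 0" unfolding state_interaction[of 0] by simp
  have "(1 + ?r) ^ N \<le> exp (real N * ?r)"
    unfolding exp_of_nat_mult using \<kappa> by (intro power_mono) (auto simp: exp_ge_add_one_self add.commute)
  also have "\<dots> \<le> exp (1 / 2)" using small by (simp add: mult.commute mult.left_commute)
  also have "\<dots> \<le> 2"
    using exp_bound[of "1/2"] by (simp add: power2_eq_square)
  finally have "(1 + ?r) ^ N * vnorm (interaction 0) \<le> 2 * vnorm (interaction 0)"
    by (intro mult_right_mono) auto
  then have up: "vnorm (interaction N) \<le> 2 * vnorm (state 0)"
    using interaction_growth(1)[of N] i0 by simp
  have "vnorm (state N) \<le> D * vnorm (interaction N)"
    unfolding state_interaction[of N] using bound[of N] by (intro vnorm_act) simp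
  also have "\<dots> \<le> D * (2 * vnorm (state 0))" using D_ge_1 up by (intro mult_left_mono) auto
  finally show "vnorm (state N) \<le> 2 * D * vnorm (state 0)" by simp
  have "1 / 2 * vnorm (interaction 0) \<le> (1 - ?r * real N) * vnorm (interaction 0)"
    using small by (intro mult_right_mono) auto
  then have lo: "vnorm (state 0) \<le> 2 * vnorm (interaction N)"
    using interaction_growth(2)[of N] i0 by simp
  have "vnorm (interaction N) \<le> D * vnorm (state N)"
    unfolding interaction_def using bound[of N] by (intro vnorm_act) simp
  then show "vnorm (state 0) \<le> 2 * D * vnorm (state N)" using lo by simp
qed

lemma vnorm_state:
  "vnorm (state j) \<le> cmod (\<phi> (m + int j)) + cmod (\<phi> (m + int j - 1))"
  "cmod (\<phi> (m + int j)) \<le> vnorm (state j)" "cmod (\<phi> (m + int j - 1)) \<le> vnorm (state j)"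
proof -
  let ?a = "\<phi> (m + int j)" and ?b = "\<phi> (m + int j - 1)"
  show "vnorm (state j) \<le> cmod ?a + cmod ?b"
    using norm_triangle_ineq[of ?a "\<i> * ?b"] norm_triangle_ineq4[of ?a "\<i> * ?b"]
    by (simp add: vnorm_def state_def norm_mult)
  have "2 * ?a = fst (state j) + snd (state j)" "2 * (\<i> * ?b) = fst (state j) - snd (state j)"
    by (simp_all add: state_def)
  then have "cmod (2 * ?a) = cmod (fst (state j) + snd (state j))" "cmod (2 * (\<i> * ?b)) = cmod (fst (state j) - snd (state j))"
    by presburger+
  then have "2 * cmod ?a \<le> cmod (fst (state j)) + cmod (snd (state j))" "2 * cmod ?b \<le> cmod (fst (state j)) + cmod (snd (state j))"
    using norm_triangle_ineq[of "fst (state j)" "snd (state j)"] norm_triangle_ineq4[of "fst (state j)" "snd (state j)"]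
    by (simp_all add: norm_mult)
  then show "cmod ?a \<le> vnorm (state j)" "cmod ?b \<le> vnorm (state j)"
    unfolding vnorm_def by linarith+
qed

text \<open>Both directions are used to transport a lower bound away from the origin: the second
  estimate to the right, the first one to the left.\<close>

lemma solution_growth:
  "max (cmod (\<phi> (m + int N))) (cmod (\<phi> (m + int N - 1))) \<le> 2 * D * (cmod (\<phi> m) + cmod (\<phi> (m - 1)))"
  "max (cmod (\<phi> m)) (cmod (\<phi> (m - 1))) \<le> 2 * D * (cmod (\<phi> (m + int N)) + cmod (\<phi> (m + int N - 1)))"
proof -
  have "2 * D * vnorm (state 0) \<le> 2 * D * (cmod (\<phi> m) + cmod (\<phi> (m - 1)))"
    "2 * D * vnorm (state N) \<le> 2 * D * (cmod (\<phi> (m + int N)) + cmod (\<phi> (m + int N - 1)))"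
    using D_ge_1 vnorm_state(1)[of 0] vnorm_state(1)[of N] by (auto intro!: mult_left_mono)
  then show "max (cmod (\<phi> (m + int N))) (cmod (\<phi> (m + int N - 1))) \<le> 2 * D * (cmod (\<phi> m) + cmod (\<phi> (m - 1)))"
    "max (cmod (\<phi> m)) (cmod (\<phi> (m - 1))) \<le> 2 * D * (cmod (\<phi> (m + int N)) + cmod (\<phi> (m + int N - 1)))"
    using state_growth vnorm_state(2,3)[of N] vnorm_state(2,3)[of 0] by auto
qed

end

section \<open>The time evolution\<close>

text \<open>The value at \<open>n\<close> of the \<open>k\<close>-th power of -i H applied to
  \<delta>(0), as a nearest-neighbour recursion that shows the finite range.\<close>

fun amp_coeff :: "real \<Rightarrow> real \<Rightarrow> nat \<Rightarrow> int \<Rightarrow> complex" where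
  "amp_coeff V \<omega> 0 n = (if n = 0 then 1 else 0)"
| "amp_coeff V \<omega> (Suc k) n = - \<i> * (amp_coeff V \<omega> k (n + 1) + amp_coeff V \<omega> k (n - 1) + fib_potential V \<omega> n * amp_coeff V \<omega> k n)"

definition amp :: "real \<Rightarrow> real \<Rightarrow> real \<Rightarrow> int \<Rightarrow> complex" where
  "amp V \<omega> t n = ell2_apply (fib_propagator V \<omega> t (ell2_delta 0)) n"

lemma bounded_linear_ell2_apply: "bounded_linear (\<lambda>f. ell2_apply f n)"
  by (rule bounded_linear_intro[where K = 1]) (simp_all add: cmod_ell2_apply_le)

text \<open>Evaluation at a site is continuous, so the operator exponential is read off termwise;
  from here on the dynamics is a scalar power series in \<open>t\<close>.\<close>

lemma amp_sums:
  "(\<lambda>k. amp_coeff V \<omega> k n / fact k * of_real t ^ k) sums amp V \<omega> t n"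
proof -
  define H where "H = fib_hamiltonian V \<omega>"
  define B where "B = ell2_mult (- \<i>) o\<^sub>L H"
  define P :: "(int ell2 \<Rightarrow>\<^sub>L int ell2) \<Rightarrow> nat \<Rightarrow> int ell2 \<Rightarrow>\<^sub>L int ell2"
    where "P = (\<lambda>A k. ((\<lambda>C. A o\<^sub>L C) ^^ k) id_blinfun)"
  have tB: "ell2_mult (- \<i> * of_real t) o\<^sub>L H = t *\<^sub>R B"
    by (rule blinfun_eqI, rule ell2_eqI)
      (simp add: B_def ell2_mult.rep_eq scaleR_blinfun.rep_eq scaleR_conv_of_real)
  have PtB: "P (t *\<^sub>R B) k = t ^ k *\<^sub>R P B k" for k
    by (induction k) (simp_all add: P_def bounded_bilinear.scaleR_left[OF bounded_bilinear_blinfun_compose]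
        bounded_bilinear.scaleR_right[OF bounded_bilinear_blinfun_compose])
  have c: "ell2_apply (P B k (ell2_delta 0)) n = amp_coeff V \<omega> k n" for k n
  proof (induction k arbitrary: n)
    case 0
    show ?case by (simp add: P_def ell2_delta.rep_eq)
  next
    case (Suc k)
    have "P B (Suc k) (ell2_delta 0) = ell2_scale (- \<i>) (H (P B k (ell2_delta 0)))"
      by (simp add: P_def B_def ell2_mult.rep_eq)
    then show ?case
      by (simp add: Suc H_def fib_hamiltonian.rep_eq fib_hamiltonian_fun.rep_eq)
  qed
  have "(\<lambda>k. P (t *\<^sub>R B) k /\<^sub>R fact k) sums fib_propagator V \<omega> t"
    unfolding fib_propagator_def H_def[symmetric] tB P_def by (rule blinfun_exp_sums)
  from bounded_linear.sums[OF bounded_linear_ell2_apply[of n]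
      bounded_linear.sums[OF blinfun.bounded_linear_left[of "ell2_delta 0"] this]]
  have "(\<lambda>k. ell2_apply ((P (t *\<^sub>R B) k /\<^sub>R fact k) (ell2_delta 0)) n) sums amp V \<omega> t n"
    unfolding amp_def .
  moreover have "ell2_apply ((P (t *\<^sub>R B) k /\<^sub>R fact k) (ell2_delta 0)) n = amp_coeff V \<omega> k n / fact k * of_real t ^ k" for k
    unfolding PtB by (simp add: scaleR_blinfun.rep_eq c scaleR_conv_of_real field_simps)
  ultimately show ?thesis by simp
qed

lemma amp_coeff_bound: "cmod (amp_coeff V \<omega> k n) \<le> (2 + \<bar>V\<bar>) ^ k"
proof (induction k arbitrary: n)
  case (Suc k)
  let ?M = "(2 + \<bar>V\<bar>) ^ k"
  have "cmod (amp_coeff V \<omega> (Suc k) n) \<le> cmod (amp_coeff V \<omega> k (n + 1)) + cmod (amp_coeff V \<omega> k (n - 1)) + \<bar>fib_potential V \<omega> n\<bar> * cmod (amp_coeff V \<omega> k n)"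
    by (simp add: norm_mult) (intro norm_triangle_mono order_refl, simp add: norm_mult)
  also have "\<dots> \<le> ?M + ?M + \<bar>V\<bar> * ?M"
    using Suc fib_potential_bound by (intro add_mono mult_mono) auto
  finally show ?case by (simp add: algebra_simps)
qed simp

lemma amp_coeff_eq_0: "int k < \<bar>n\<bar> \<Longrightarrow> amp_coeff V \<omega> k n = 0"
  by (induction k arbitrary: n) auto

text \<open>The factor $e$ comes from $1 \le e^{k - |n|}$, valid for every nonzero term of the
  exponential series at site \<open>n\<close>.\<close>

definition lightspeed :: "real \<Rightarrow> real" where "lightspeed V = exp 1 * (2 + \<bar>V\<bar>)"

lemma lightspeed_pos: "0 < lightspeed V" by (simp add: lightspeed_def add_pos_nonneg)

lemma amp_decay:
  assumes t: "0 \<le> t"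
  shows "cmod (amp V \<omega> t n) \<le> exp (lightspeed V * t - \<bar>of_int n\<bar>)"
proof -
  let ?L = "lightspeed V * t"
  have s: "(\<lambda>k. exp (- \<bar>of_int n\<bar>) * (?L ^ k / fact k)) sums (exp (- \<bar>of_int n\<bar>) * exp ?L)"
    using exp_converges[of ?L] by (intro sums_mult) (simp add: field_simps)
  have "cmod (amp V \<omega> t n) \<le> (\<Sum>k. exp (- \<bar>of_int n\<bar>) * (?L ^ k / fact k))"
    unfolding sums_unique[OF amp_sums]
  proof (rule norm_suminf_le[OF _ sums_summable[OF s]])
    fix k
    show "cmod (amp_coeff V \<omega> k n / fact k * of_real t ^ k) \<le> exp (- \<bar>of_int n\<bar>) * (?L ^ k / fact k)"
    proof (cases "int k < \<bar>n\<bar>")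
      case False
      then have "\<bar>real_of_int n\<bar> \<le> real k" by linarith
      then have "1 \<le> exp (- \<bar>real_of_int n\<bar>) * exp 1 ^ k"
        by (simp add: exp_of_nat_mult[symmetric] exp_add[symmetric] mult.commute)
      moreover have "cmod (amp_coeff V \<omega> k n) * t ^ k \<le> (2 + \<bar>V\<bar>) ^ k * t ^ k"
        using amp_coeff_bound t by (intro mult_right_mono) auto
      ultimately have "1 * (cmod (amp_coeff V \<omega> k n) * t ^ k) \<le> (exp (- \<bar>real_of_int n\<bar>) * exp 1 ^ k) * ((2 + \<bar>V\<bar>) ^ k * t ^ k)"
        by (rule mult_mono) (use t in simp_all)
      then show ?thesis using t
        by (simp add: norm_mult norm_divide norm_power lightspeed_def power_mult_distrib divide_right_mono mult.assoc)
    qed (use t lightspeed_pos[of V] in \<open>simp add: amp_coeff_eq_0\<close>)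
  qed
  then show ?thesis using sums_unique[OF s] by (simp add: exp_diff exp_minus field_simps)
qed

section \<open>The Schroedinger equation and the total mass\<close>

lemma amp_0: "amp V \<omega> 0 n = (if n = 0 then 1 else 0)"
proof -
  have "(\<lambda>k. amp_coeff V \<omega> k n / fact k * of_real 0 ^ k) sums (amp_coeff V \<omega> 0 n / fact 0 * 1)"
    using powser_sums_zero[of "\<lambda>k. amp_coeff V \<omega> k n / fact k"] by simp
  from sums_unique2[OF this amp_sums[of V \<omega> n 0]] show ?thesis by (simp split: if_splits)
qed

lemma amp_has_derivative:
  "((\<lambda>t. amp V \<omega> t n) has_vector_derivative
    - \<i> * (amp V \<omega> t (n + 1) + amp V \<omega> t (n - 1) + fib_potential V \<omega> n * amp V \<omega> t n)) (at t)"
proof -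
  define c where "c = (\<lambda>k. amp_coeff V \<omega> k n / fact k)"
  have summ: "summable (\<lambda>k. c k * z ^ k)" for z
  proof (rule summable_comparison_test')
    show "summable (\<lambda>k. ((2 + \<bar>V\<bar>) * cmod z) ^ k / fact k)"
      using summable_exp[of "(2 + \<bar>V\<bar>) * cmod z"] by (simp add: field_simps)
    show "norm (c k * z ^ k) \<le> ((2 + \<bar>V\<bar>) * cmod z) ^ k / fact k" for k
      using mult_right_mono[OF amp_coeff_bound[of V \<omega> k n], of "cmod z ^ k"]
      by (simp add: c_def norm_mult norm_divide norm_power power_mult_distrib divide_right_mono)
  qed
  have d: "diffs c k = amp_coeff V \<omega> (Suc k) n / fact k" for k
    by (simp add: diffs_def c_def field_simps del: amp_coeff.simps of_nat_Suc)
  have "(\<lambda>k. - \<i> * (amp_coeff V \<omega> k (n + 1) / fact k * of_real t ^ k + amp_coeff V \<omega> k (n - 1) / fact k * of_real t ^ k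
      + fib_potential V \<omega> n * (amp_coeff V \<omega> k n / fact k * of_real t ^ k)))
    sums (- \<i> * (amp V \<omega> t (n + 1) + amp V \<omega> t (n - 1) + fib_potential V \<omega> n * amp V \<omega> t n))"
    by (intro sums_mult sums_add amp_sums)
  moreover have "- \<i> * (amp_coeff V \<omega> k (n + 1) / fact k * of_real t ^ k + amp_coeff V \<omega> k (n - 1) / fact k * of_real t ^ k
      + fib_potential V \<omega> n * (amp_coeff V \<omega> k n / fact k * of_real t ^ k)) = diffs c k * of_real t ^ k" for k
    unfolding d by (simp add: field_simps)
  ultimately have "(\<lambda>k. diffs c k * of_real t ^ k) sums
      (- \<i> * (amp V \<omega> t (n + 1) + amp V \<omega> t (n - 1) + fib_potential V \<omega> n * amp V \<omega> t n))" by simp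
  then have "((\<lambda>z. \<Sum>k. c k * z ^ k) has_field_derivative
      (- \<i> * (amp V \<omega> t (n + 1) + amp V \<omega> t (n - 1) + fib_potential V \<omega> n * amp V \<omega> t n))) (at (of_real t))"
    using termdiffs_strong_converges_everywhere[OF summ, of "complex_of_real t"] sums_unique by metis
  from has_vector_derivative_real_field[OF this]
  show ?thesis using sums_unique[OF amp_sums] by (simp add: c_def o_def)
qed

lemma amp_continuous: "continuous_on S (\<lambda>t. amp V \<omega> t n)"
  using amp_has_derivative by (intro continuous_at_imp_continuous_on ballI) (rule has_vector_derivative_continuous)

text \<open>The potential is real, so the derivative of the mass in the window telescopes to the two
  boundary currents \<open>j\<close>, which are exponentially small by
  \<open>amp_decay\<close>.\<close>

lemma amp_window_mass:
  assumes t: "0 \<le> t"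
  shows "(\<Sum>n\<in>{-int N..int N}. (cmod (amp V \<omega> t n))\<^sup>2) \<le> 1 + t * (4 * exp (2 * lightspeed V * t - 2 * N))"
proof -
  define S where "S = (\<lambda>t. \<Sum>n\<in>{-int N..int N}. (cmod (amp V \<omega> t n))\<^sup>2)"
  define j where "j = (\<lambda>t n. Im (cnj (amp V \<omega> t n) * amp V \<omega> t (n + 1)))"
  have der: "(S has_real_derivative 2 * (j s (int N) - j s (- int N - 1))) (at s)" for s
  proof -
    have one: "((\<lambda>t. (cmod (amp V \<omega> t n))\<^sup>2) has_real_derivative 2 * (j s n - j s (n - 1))) (at s)" for n
    proof -
      let ?d = "- \<i> * (amp V \<omega> s (n + 1) + amp V \<omega> s (n - 1) + fib_potential V \<omega> n * amp V \<omega> s n)"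
      have "((\<lambda>t. Re (amp V \<omega> t n)) has_real_derivative Re ?d) (at s)"
        "((\<lambda>t. Im (amp V \<omega> t n)) has_real_derivative Im ?d) (at s)"
        using amp_has_derivative[of V \<omega> n s]
        by (simp_all only: has_vector_derivative_complex_iff has_real_derivative_iff_has_vector_derivative)
      from DERIV_add[OF DERIV_power[OF this(1), of 2] DERIV_power[OF this(2), of 2]]
      have "((\<lambda>t. (Re (amp V \<omega> t n))\<^sup>2 + (Im (amp V \<omega> t n))\<^sup>2) has_real_derivative
        2 * Re (amp V \<omega> s n) * Re ?d + 2 * Im (amp V \<omega> s n) * Im ?d) (at s)"
        by (simp add: mult_ac)
      moreover have "2 * Re (amp V \<omega> s n) * Re ?d + 2 * Im (amp V \<omega> s n) * Im ?d = 2 * (j s n - j s (n - 1))"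
        by (simp add: j_def algebra_simps)
      ultimately show ?thesis by (simp add: cmod_power2)
    qed
    have "(S has_real_derivative (\<Sum>n\<in>{-int N..int N}. 2 * (j s n - j s (n - 1)))) (at s)"
      unfolding S_def by (intro DERIV_sum one)
    moreover have "(\<Sum>n\<in>{-int N..int N}. j s n - j s (n - 1)) = j s (int N) - j s (- int N - 1)"
    proof (induction N)
      case (Suc N)
      have "{-int (Suc N)..int (Suc N)} = insert (int N + 1) (insert (- int N - 1) {-int N..int N})" by auto
      then show ?case using Suc by (simp add: add.commute)
    qed simp
    ultimately show ?thesis unfolding sum_distrib_left[symmetric] by simp
  qed
  have bnd: "\<bar>j s n\<bar> \<le> exp (2 * lightspeed V * t - 2 * N)" if s: "0 \<le> s" "s \<le> t" and n: "n = int N \<or> n = - int N - 1" for s n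
  proof -
    have a: "cmod (amp V \<omega> s m) \<le> exp (lightspeed V * t - N)" if "int N \<le> \<bar>m\<bar>" for m
    proof -
      have "lightspeed V * s \<le> lightspeed V * t" using s lightspeed_pos[of V] by simp
      moreover have "real N \<le> \<bar>real_of_int m\<bar>" using that by linarith
      ultimately have "exp (lightspeed V * s - \<bar>real_of_int m\<bar>) \<le> exp (lightspeed V * t - N)" by simp
      then show ?thesis using amp_decay[OF s(1), of V \<omega> m] by linarith
    qed
    have "\<bar>j s n\<bar> \<le> cmod (amp V \<omega> s n) * cmod (amp V \<omega> s (n + 1))"
      unfolding j_def using abs_Im_le_cmod[of "cnj (amp V \<omega> s n) * amp V \<omega> s (n + 1)"] by (simp add: norm_mult)
    also have "\<dots> \<le> exp (lightspeed V * t - N) * exp (lightspeed V * t - N)"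
      using n by (intro mult_mono a) auto
    finally show ?thesis by (simp add: exp_add[symmetric] mult_ac)
  qed
  have "S t \<le> S 0 + t * (4 * exp (2 * lightspeed V * t - 2 * N))"
  proof (cases "t = 0")
    case False
    then have "0 < t" using t by simp
    from MVT2[OF this, of S "\<lambda>s. 2 * (j s (int N) - j s (- int N - 1))"] der
    obtain z where z: "0 < z" "z < t" "S t - S 0 = (t - 0) * (2 * (j z (int N) - j z (- int N - 1)))" by blast
    have "2 * (j z (int N) - j z (- int N - 1)) \<le> 4 * exp (2 * lightspeed V * t - 2 * N)"
      using bnd[of z "int N"] bnd[of z "- int N - 1"] z by argo
    then have "(t - 0) * (2 * (j z (int N) - j z (- int N - 1))) \<le> t * (4 * exp (2 * lightspeed V * t - 2 * N))"
      using t unfolding diff_zero by (intro mult_left_mono) auto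
    then show ?thesis using z(3) by linarith
  qed simp
  moreover have "S 0 = 1"
    unfolding S_def amp_0 by (simp add: if_distrib[of cmod] if_distrib[of "\<lambda>x. x\<^sup>2"] cong: if_cong)
  ultimately show ?thesis by (simp add: S_def)
qed

lemma finite_int_subset_interval:
  assumes "finite (A :: int set)"
  obtains M where "A \<subseteq> {- int M..int M}"
proof -
  have "\<exists>M. \<forall>n\<in>A. \<bar>n\<bar> \<le> int M" using assms
  proof (induction A)
    case (insert a A)
    then obtain M where "\<forall>n\<in>A. \<bar>n\<bar> \<le> int M" by auto
    then show ?case by (intro exI[of _ "M + nat \<bar>a\<bar>"]) auto
  qed auto
  then obtain M where "\<forall>n\<in>A. \<bar>n\<bar> \<le> int M" by blast
  then have "A \<subseteq> {- int M..int M}" by force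
  then show ?thesis by (rule that)
qed

lemma amp_mass:
  assumes t: "0 \<le> t" and A: "finite A"
  shows "(\<Sum>n\<in>A. (cmod (amp V \<omega> t n))\<^sup>2) \<le> 1"
proof (rule LIMSEQ_le_const)
  show "(\<lambda>N. 1 + t * (4 * exp (2 * lightspeed V * t - 2 * real N))) \<longlonglongrightarrow> 1"
  proof -
    have "(\<lambda>N. (exp (- 2) :: real) ^ N) \<longlonglongrightarrow> 0" by (intro LIMSEQ_power_zero) simp
    then have "(\<lambda>N. 1 + t * (4 * (exp (2 * lightspeed V * t) * exp (- 2) ^ N))) \<longlonglongrightarrow> 1 + t * (4 * (exp (2 * lightspeed V * t) * 0))"
      by (intro tendsto_add tendsto_mult tendsto_const)
    then show ?thesis by (simp add: exp_diff exp_of_nat_mult[symmetric] exp_minus field_simps)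
  qed
  obtain M where M: "A \<subseteq> {- int M..int M}" using finite_int_subset_interval[OF A] .
  show "\<exists>N. \<forall>n\<ge>N. (\<Sum>n\<in>A. (cmod (amp V \<omega> t n))\<^sup>2) \<le> 1 + t * (4 * exp (2 * lightspeed V * t - 2 * real n))"
  proof (intro exI[of _ M] allI impI)
    fix N assume "N \<ge> M"
    then have "A \<subseteq> {- int N..int N}" using M by force
    then have "(\<Sum>n\<in>A. (cmod (amp V \<omega> t n))\<^sup>2) \<le> (\<Sum>n\<in>{- int N..int N}. (cmod (amp V \<omega> t n))\<^sup>2)"
      by (intro sum_mono2) auto
    then show "(\<Sum>n\<in>A. (cmod (amp V \<omega> t n))\<^sup>2) \<le> 1 + t * (4 * exp (2 * lightspeed V * t - 2 * real N))"
      using amp_window_mass[OF t, of V \<omega> N] by simp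
  qed
qed

lemma amp_le_1: "0 \<le> t \<Longrightarrow> cmod (amp V \<omega> t n) \<le> 1"
  using amp_mass[of t "{n}" V \<omega>] by (simp add: power_le_one_iff)

section \<open>The Green function\<close>

definition damped_phase :: "real \<Rightarrow> real \<Rightarrow> real \<Rightarrow> complex" where
  "damped_phase E \<kappa> t = exp ((\<i> * of_real E - of_real \<kappa>) * of_real t)"

lemma cmod_damped_phase: "cmod (damped_phase E \<kappa> t) = exp (- \<kappa> * t)"
  by (simp add: damped_phase_def)

lemma damped_phase_has_derivative:
  "(damped_phase E \<kappa> has_vector_derivative (\<i> * of_real E - of_real \<kappa>) * damped_phase E \<kappa> t) (at t)"
proof -
  have "((\<lambda>z. exp ((\<i> * of_real E - of_real \<kappa>) * z)) has_field_derivative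
      (\<i> * of_real E - of_real \<kappa>) * damped_phase E \<kappa> t) (at (of_real t))"
    unfolding damped_phase_def by (auto intro!: derivative_eq_intros)
  from has_vector_derivative_real_field[OF this] show ?thesis
    by (simp add: damped_phase_def[abs_def] o_def)
qed

lemma damped_phase_continuous: "continuous_on S (damped_phase E \<kappa>)"
  unfolding damped_phase_def[abs_def] by (intro continuous_intros)

lemma amp_measurable [measurable]: "(\<lambda>t. amp V \<omega> t n) \<in> borel_measurable borel"
  by (rule borel_measurable_continuous_onI[OF amp_continuous])

lemma damped_phase_measurable [measurable]: "damped_phase E \<kappa> \<in> borel_measurable borel"
  by (rule borel_measurable_continuous_onI[OF damped_phase_continuous])

lemma nn_integral_exp_decay:
  assumes "0 < \<kappa>"
  shows "(\<integral>\<^sup>+t. ennreal (exp (- \<kappa> * t)) * indicator {0..} t \<partial>lborel) = ennreal (1 / \<kappa>)"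
proof -
  have "(\<integral>\<^sup>+t. ennreal (exp (- \<kappa> * t)) * indicator {0..} t \<partial>lborel) = 0 - (- exp (- \<kappa> * 0) / \<kappa>)"
  proof (rule nn_integral_FTC_atLeast)
    show "((\<lambda>t. - exp (- \<kappa> * t) / \<kappa>) has_real_derivative exp (- \<kappa> * t)) (at t)" for t
      using assms by (auto intro!: derivative_eq_intros)
    have "LIM t at_top. - \<kappa> * t :> at_bot"
      using assms by (intro filterlim_tendsto_neg_mult_at_bot[OF tendsto_const]) (auto simp: filterlim_ident)
    then have "((\<lambda>t. exp (- \<kappa> * t)) \<longlongrightarrow> 0) at_top" by (rule filterlim_compose[OF exp_at_bot])
    then have "((\<lambda>t. - exp (- \<kappa> * t) / \<kappa>) \<longlongrightarrow> - 0 / \<kappa>) at_top"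
      using assms by (intro tendsto_intros) auto
    then show "((\<lambda>t. - exp (- \<kappa> * t) / \<kappa>) \<longlongrightarrow> 0) at_top" by simp
  qed auto
  then show ?thesis by simp
qed

text \<open>Up to the factor $-i$, this is the matrix element $\langle \delta_n, (H - E - i \kappa)^{-1} \delta_0 \rangle$.\<close>

definition green :: "real \<Rightarrow> real \<Rightarrow> real \<Rightarrow> real \<Rightarrow> int \<Rightarrow> complex" where
  "green V \<omega> E \<kappa> n = (LBINT t=0..\<infinity>. damped_phase E \<kappa> t * amp V \<omega> t n)"

lemma green_integrable:
  assumes \<kappa>: "0 < \<kappa>"
  shows "interval_lebesgue_integrable lborel 0 \<infinity> (\<lambda>t. damped_phase E \<kappa> t * amp V \<omega> t n)"
  unfolding interval_lebesgue_integral_0_infty set_integrable_def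
proof (rule integrableI_bounded)
  have "(\<integral>\<^sup>+t. norm (indicator {0<..} t *\<^sub>R (damped_phase E \<kappa> t * amp V \<omega> t n)) \<partial>lborel)
      \<le> (\<integral>\<^sup>+t. ennreal (exp (- \<kappa> * t)) * indicator {0..} t \<partial>lborel)"
  proof (rule nn_integral_mono)
    fix t :: real
    show "ennreal (norm (indicator {0<..} t *\<^sub>R (damped_phase E \<kappa> t * amp V \<omega> t n))) \<le> ennreal (exp (- \<kappa> * t)) * indicator {0..} t"
    proof (cases "0 < t")
      case True
      then have "exp (- \<kappa> * t) * cmod (amp V \<omega> t n) \<le> exp (- \<kappa> * t) * 1"
        by (intro mult_left_mono amp_le_1) auto
      then show ?thesis using True by (simp add: norm_mult cmod_damped_phase ennreal_leI)
    qed simp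
  qed
  also have "\<dots> < \<infinity>" unfolding nn_integral_exp_decay[OF \<kappa>] by simp
  finally show "(\<integral>\<^sup>+t. norm (indicator {0<..} t *\<^sub>R (damped_phase E \<kappa> t * amp V \<omega> t n)) \<partial>lborel) < \<infinity>" .
qed measurable

text \<open>Integrate the derivative of the damped amplitude over the half line. The value at time 0
  becomes the source term at site 0, and the damping removes the one at infinity.\<close>

lemma green_equation:
  assumes \<kappa>: "0 < \<kappa>"
  shows "green V \<omega> E \<kappa> (n + 1) + green V \<omega> E \<kappa> (n - 1) + fib_potential V \<omega> n * green V \<omega> E \<kappa> n
    = Complex E \<kappa> * green V \<omega> E \<kappa> n - (if n = 0 then \<i> else 0)"
proof -
  define z where "z = \<i> * of_real E - complex_of_real \<kappa>"
  let ?v = "complex_of_real (fib_potential V \<omega> n)"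
  let ?f = "\<lambda>n t. damped_phase E \<kappa> t * amp V \<omega> t n"
  let ?F' = "\<lambda>t. z * ?f n t + - \<i> * (?f (n + 1) t + ?f (n - 1) t + ?v * ?f n t)"
  note i = green_integrable[OF \<kappa>, of E V \<omega>]
  have integ: "interval_lebesgue_integrable lborel 0 \<infinity> ?F'"
    by (intro interval_lebesgue_integral_add(1) interval_lebesgue_integrable_mult_right i)
  have "(LBINT t=0..\<infinity>. ?F' t) = 0 - ?f n 0"
  proof (rule interval_integral_FTC_integrable)
    show "(?f n has_vector_derivative ?F' t) (at t)" for t
    proof -
      have "(?f n has_vector_derivative damped_phase E \<kappa> t * (- \<i> * (amp V \<omega> t (n + 1) + amp V \<omega> t (n - 1) + ?v * amp V \<omega> t n))
        + z * damped_phase E \<kappa> t * amp V \<omega> t n) (at t)"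
        unfolding z_def by (intro has_vector_derivative_mult damped_phase_has_derivative amp_has_derivative)
      then show ?thesis by (simp add: algebra_simps)
    qed
    have "continuous_on UNIV ?F'"
      by (intro continuous_intros damped_phase_continuous amp_continuous)
    then show "isCont ?F' t" for t by (simp add: continuous_on_eq_continuous_at)
    show "set_integrable lborel (einterval 0 \<infinity>) ?F'"
      using integ by (simp add: interval_lebesgue_integrable_def)
    have "continuous_on UNIV (?f n)" by (intro continuous_intros damped_phase_continuous amp_continuous)
    then have "isCont (?f n) 0" by (simp add: continuous_on_eq_continuous_at)
    then have "(?f n \<longlongrightarrow> ?f n 0) (at_right 0)"
      by (simp add: isCont_def tendsto_within_subset filterlim_at_split)
    then show "((?f n \<circ> real_of_ereal) \<longlongrightarrow> ?f n 0) (at_right 0)"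
      unfolding zero_ereal_def ereal_tendsto_simps1 .
    have "LIM t at_top. - \<kappa> * t :> at_bot"
      using \<kappa> by (intro filterlim_tendsto_neg_mult_at_bot[OF tendsto_const]) (auto simp: filterlim_ident)
    then have e0: "((\<lambda>t. exp (- \<kappa> * t)) \<longlongrightarrow> 0) at_top" by (rule filterlim_compose[OF exp_at_bot])
    have "(?f n \<longlongrightarrow> 0) at_top"
    proof (rule Lim_null_comparison[OF _ e0])
      show "eventually (\<lambda>t. norm (?f n t) \<le> exp (- \<kappa> * t)) at_top"
        using eventually_ge_at_top[of 0]
      proof eventually_elim
        case (elim t)
        have "exp (- \<kappa> * t) * cmod (amp V \<omega> t n) \<le> exp (- \<kappa> * t) * 1"
          using elim by (intro mult_left_mono amp_le_1) auto
        then show ?case by (simp add: norm_mult cmod_damped_phase)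
      qed
    qed
    then show "((?f n \<circ> real_of_ereal) \<longlongrightarrow> 0) (at_left \<infinity>)"
      unfolding ereal_tendsto_simps1 .
  qed simp
  also have "?f n 0 = (if n = 0 then 1 else 0)"
    by (simp add: damped_phase_def amp_0)
  also have "(LBINT t=0..\<infinity>. ?F' t) = z * green V \<omega> E \<kappa> n +
      - \<i> * (green V \<omega> E \<kappa> (n + 1) + green V \<omega> E \<kappa> (n - 1) + ?v * green V \<omega> E \<kappa> n)"
    unfolding green_def
    by (simp only: interval_lebesgue_integral_add interval_lebesgue_integral_mult_right
        interval_lebesgue_integrable_mult_right i)
  finally have eq: "z * green V \<omega> E \<kappa> n +
      - \<i> * (green V \<omega> E \<kappa> (n + 1) + green V \<omega> E \<kappa> (n - 1) + ?v * green V \<omega> E \<kappa> n) = 0 - (if n = 0 then 1 else 0)" .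
  have "green V \<omega> E \<kappa> (n + 1) + green V \<omega> E \<kappa> (n - 1) + ?v * green V \<omega> E \<kappa> n =
    \<i> * (- \<i> * (green V \<omega> E \<kappa> (n + 1) + green V \<omega> E \<kappa> (n - 1) + ?v * green V \<omega> E \<kappa> n))"
    by simp
  also have "\<dots> = \<i> * (0 - (if n = 0 then 1 else 0) - z * green V \<omega> E \<kappa> n)"
    unfolding eq[symmetric] by simp
  also have "\<dots> = Complex E \<kappa> * green V \<omega> E \<kappa> n - (if n = 0 then \<i> else 0)"
    by (simp add: z_def complex_eq_iff algebra_simps)
  finally show ?thesis .
qed

text \<open>The damping is divided evenly between the two factors of Cauchy-Schwarz: one yields
  \<open>1 / \<kappa>\<close>, the other the weight \<open>exp (- \<kappa> * t)\<close>. For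
  \<open>\<kappa> = 2 / T\<close> this is the weight of the time average.\<close>

lemma green_sq_le:
  assumes \<kappa>: "0 < \<kappa>"
  shows "ennreal (\<kappa> * (cmod (green V \<omega> E \<kappa> n))\<^sup>2) \<le>
    (\<integral>\<^sup>+t\<in>{0..}. ennreal (exp (- \<kappa> * t)) * ennreal ((cmod (amp V \<omega> t n))\<^sup>2) \<partial>lborel)"
proof -
  let ?I = "\<integral>\<^sup>+t\<in>{0..}. ennreal (exp (- \<kappa> * t)) * ennreal ((cmod (amp V \<omega> t n))\<^sup>2) \<partial>lborel"
  let ?h = "\<lambda>t. ennreal (exp (- \<kappa> * t / 2)) * indicator {0..} t"
  let ?g = "\<lambda>t. ennreal (exp (- \<kappa> * t / 2) * cmod (amp V \<omega> t n)) * indicator {0..} t"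
  have ex: "exp (- \<kappa> * t / 2) * exp (- \<kappa> * t / 2) = exp (- \<kappa> * t)" for t
    by (simp add: exp_add[symmetric])
  then have ex': "exp (- (\<kappa> * t / 2)) * exp (- (\<kappa> * t / 2)) = exp (- (\<kappa> * t))" for t
    by simp
  have "integrable lborel (\<lambda>t. indicator {0<..} t *\<^sub>R (damped_phase E \<kappa> t * amp V \<omega> t n))"
    using green_integrable[OF \<kappa>, of E V \<omega> n]
    unfolding interval_lebesgue_integral_0_infty set_integrable_def .
  from integral_norm_bound_ennreal[OF this]
  have "ennreal (cmod (green V \<omega> E \<kappa> n)) \<le> (\<integral>\<^sup>+t. norm (indicator {0<..} t *\<^sub>R (damped_phase E \<kappa> t * amp V \<omega> t n)) \<partial>lborel)"
    unfolding green_def interval_lebesgue_integral_0_infty set_lebesgue_integral_def .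
  also have "\<dots> \<le> (\<integral>\<^sup>+t. ?h t * ?g t \<partial>lborel)"
  proof (intro nn_integral_mono)
    fix t :: real
    have "ennreal (exp (- \<kappa> * t / 2)) * ennreal (exp (- \<kappa> * t / 2) * cmod (amp V \<omega> t n)) =
        ennreal (exp (- \<kappa> * t) * cmod (amp V \<omega> t n))"
      unfolding ex[symmetric] by (simp add: ennreal_mult'[symmetric] mult.assoc)
    then show "ennreal (norm (indicator {0<..} t *\<^sub>R (damped_phase E \<kappa> t * amp V \<omega> t n))) \<le> ?h t * ?g t"
      by (simp add: norm_mult cmod_damped_phase split: split_indicator)
  qed
  finally have "(ennreal (cmod (green V \<omega> E \<kappa> n)))\<^sup>2 \<le> (\<integral>\<^sup>+t. ?h t * ?g t \<partial>lborel)\<^sup>2"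
    by (rule power_mono) simp
  also have "\<dots> \<le> (\<integral>\<^sup>+t. ?h t ^ 2 \<partial>lborel) * (\<integral>\<^sup>+t. ?g t ^ 2 \<partial>lborel)"
    by (rule Cauchy_Schwarz_nn_integral) measurable
  also have "(\<integral>\<^sup>+t. ?h t ^ 2 \<partial>lborel) = (\<integral>\<^sup>+t. ennreal (exp (- \<kappa> * t)) * indicator {0..} t \<partial>lborel)"
    by (intro nn_integral_cong)
      (auto simp: power2_eq_square ennreal_mult'[symmetric] ex' split: split_indicator)
  also have "\<dots> = ennreal (1 / \<kappa>)" by (rule nn_integral_exp_decay[OF \<kappa>])
  also have "(\<integral>\<^sup>+t. ?g t ^ 2 \<partial>lborel) = ?I"
  proof (intro nn_integral_cong)
    fix t :: real
    have "(exp (- \<kappa> * t / 2) * cmod (amp V \<omega> t n))\<^sup>2 = exp (- \<kappa> * t) * (cmod (amp V \<omega> t n))\<^sup>2"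
      unfolding ex[symmetric] by (simp add: power2_eq_square mult_ac)
    then show "?g t ^ 2 = ennreal (exp (- \<kappa> * t)) * ennreal ((cmod (amp V \<omega> t n))\<^sup>2) * indicator {0..} t"
      by (simp add: ennreal_power ennreal_mult'[symmetric] split: split_indicator)
  qed
  finally have *: "(ennreal (cmod (green V \<omega> E \<kappa> n)))\<^sup>2 \<le> ennreal (1 / \<kappa>) * ?I" .
  have "ennreal (\<kappa> * (cmod (green V \<omega> E \<kappa> n))\<^sup>2) = ennreal \<kappa> * (ennreal (cmod (green V \<omega> E \<kappa> n)))\<^sup>2"
    using \<kappa> by (simp add: ennreal_mult' ennreal_power)
  also have "\<dots> \<le> ennreal \<kappa> * (ennreal (1 / \<kappa>) * ?I)" by (intro mult_left_mono *) simp
  also have "\<dots> = ?I" using \<kappa> by (simp add: mult.assoc[symmetric] ennreal_mult'[symmetric])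
  finally show ?thesis .
qed

lemma moment_delta_eq:
  "moment V \<omega> (ell2_delta 0) p t = (\<Sum>\<^sub>\<infinity>n. ennreal (\<bar>of_int n\<bar> powr p * (cmod (amp V \<omega> t n))\<^sup>2))"
  by (simp add: moment_def ell2_cinner_delta amp_def)

lemma ennreal_term_le_infsum: "f n \<le> (\<Sum>\<^sub>\<infinity>n. f n)" for f :: "'a \<Rightarrow> ennreal"
  unfolding nonneg_infsum_complete[OF zero_le] by (rule SUP_upper2[of "{n}"]) auto

lemma time_average_lower:
  assumes T: "0 < T"
  shows "ennreal (4 / T\<^sup>2 * (\<bar>of_int n\<bar> powr p * (cmod (green V \<omega> E (2 / T) n))\<^sup>2)) \<le>
    time_average (moment V \<omega> (ell2_delta 0) p) T"
proof -
  let ?a = "ennreal (\<bar>of_int n\<bar> powr p)"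
  let ?I = "\<integral>\<^sup>+t\<in>{0..}. ennreal (exp (- (2 / T) * t)) * ennreal ((cmod (amp V \<omega> t n))\<^sup>2) \<partial>lborel"
  have "4 / T\<^sup>2 * (\<bar>of_int n\<bar> powr p * (cmod (green V \<omega> E (2 / T) n))\<^sup>2) =
     2 / T * (\<bar>of_int n\<bar> powr p * (2 / T * (cmod (green V \<omega> E (2 / T) n))\<^sup>2))"
    by (simp add: power2_eq_square)
  then have "ennreal (4 / T\<^sup>2 * (\<bar>of_int n\<bar> powr p * (cmod (green V \<omega> E (2 / T) n))\<^sup>2)) =
     ennreal (2 / T) * (?a * ennreal (2 / T * (cmod (green V \<omega> E (2 / T) n))\<^sup>2))"
    using T by (simp add: ennreal_mult'[symmetric])
  also have "\<dots> \<le> ennreal (2 / T) * (?a * ?I)"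
    using T by (intro mult_left_mono green_sq_le) auto
  also have "?a * ?I = (\<integral>\<^sup>+t. ?a * (ennreal (exp (- (2 / T) * t)) * ennreal ((cmod (amp V \<omega> t n))\<^sup>2) * indicator {0..} t) \<partial>lborel)"
    by (rule nn_integral_cmult[symmetric]) measurable
  also have "\<dots> \<le> (\<integral>\<^sup>+t\<in>{0..}. ennreal (exp (- 2 * t / T)) * moment V \<omega> (ell2_delta 0) p t \<partial>lborel)"
  proof (intro nn_integral_mono)
    fix t
    have "?a * ennreal ((cmod (amp V \<omega> t n))\<^sup>2) \<le> moment V \<omega> (ell2_delta 0) p t"
      unfolding moment_delta_eq ennreal_mult'[OF powr_ge_zero, symmetric]
      by (rule ennreal_term_le_infsum[of "\<lambda>n. ennreal (\<bar>of_int n\<bar> powr p * (cmod (amp V \<omega> t n))\<^sup>2)"])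
    then have "ennreal (exp (- 2 * t / T)) * (?a * ennreal ((cmod (amp V \<omega> t n))\<^sup>2)) * indicator {0..} t
      \<le> ennreal (exp (- 2 * t / T)) * moment V \<omega> (ell2_delta 0) p t * indicator {0..} t"
      by (intro mult_right_mono mult_left_mono) auto
    then show "?a * (ennreal (exp (- (2 / T) * t)) * ennreal ((cmod (amp V \<omega> t n))\<^sup>2) * indicator {0..} t)
      \<le> ennreal (exp (- 2 * t / T)) * moment V \<omega> (ell2_delta 0) p t * indicator {0..} t"
      by (simp add: mult_ac)
  qed
  finally show ?thesis unfolding time_average_def by (simp add: mult_left_mono)
qed

section \<open>Moments\<close>

lemma moment_measurable [measurable]: "moment V \<omega> (ell2_delta 0) p \<in> borel_measurable borel"
proof -
  have "countable {F. finite F \<and> F \<subseteq> (UNIV :: int set)}"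
    using countable_Collect_finite by simp
  then show ?thesis
    unfolding moment_delta_eq[abs_def] nonneg_infsum_complete[OF zero_le] by measurable
qed

text \<open>A pointwise comparison in \<open>n\<close> passes to the moments; the constant
  \<open>b\<close> is multiplied by the total mass, which is at most 1.\<close>

lemma moment_le:
  assumes t: "0 \<le> t" and ab: "0 \<le> a" "0 \<le> b" and dom: "\<And>n::int. \<bar>of_int n\<bar> powr p * (cmod (amp V \<omega> t n))\<^sup>2 \<le>
      a * (\<bar>of_int n\<bar> powr q * (cmod (amp V \<omega> t n))\<^sup>2) + b * (cmod (amp V \<omega> t n))\<^sup>2"
  shows "moment V \<omega> (ell2_delta 0) p t \<le> ennreal a * moment V \<omega> (ell2_delta 0) q t + ennreal b"
  unfolding moment_delta_eq[of V \<omega> p]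
proof (rule infsum_le_finite_sums)
  fix F :: "int set" assume F: "finite F" "F \<subseteq> UNIV"
  let ?w = "\<lambda>n. (cmod (amp V \<omega> t n))\<^sup>2"
  have "(\<Sum>n\<in>F. ennreal (\<bar>of_int n\<bar> powr p * ?w n))
      \<le> (\<Sum>n\<in>F. ennreal a * ennreal (\<bar>of_int n\<bar> powr q * ?w n) + ennreal (b * ?w n))"
    using dom ab by (intro sum_mono) (simp add: ennreal_mult'[symmetric] ennreal_plus[symmetric] ennreal_leI del: ennreal_plus)
  also have "\<dots> = ennreal a * (\<Sum>n\<in>F. ennreal (\<bar>of_int n\<bar> powr q * ?w n)) + ennreal (b * (\<Sum>n\<in>F. ?w n))"
  proof -
    have "(\<Sum>n\<in>F. ennreal (b * ?w n)) = ennreal (b * (\<Sum>n\<in>F. ?w n))"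
      using ab by (simp add: sum_ennreal sum_distrib_left)
    then show ?thesis unfolding sum.distrib sum_distrib_left[symmetric] by simp
  qed
  also have "\<dots> \<le> ennreal a * moment V \<omega> (ell2_delta 0) q t + ennreal (b * 1)"
  proof (intro add_mono mult_left_mono ennreal_leI amp_mass t F ab)
    show "(\<Sum>n\<in>F. ennreal (\<bar>of_int n\<bar> powr q * ?w n)) \<le> moment V \<omega> (ell2_delta 0) q t"
      unfolding moment_delta_eq nonneg_infsum_complete[OF zero_le] using F by (intro SUP_upper) auto
  qed simp
  finally show "(\<Sum>n\<in>F. ennreal (\<bar>of_int n\<bar> powr p * ?w n)) \<le> ennreal a * moment V \<omega> (ell2_delta 0) q t + ennreal b"
    by simp
qed (simp add: nonneg_summable_on_complete)

lemma time_average_affine: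
  assumes T: "0 < T" and [measurable]: "f \<in> borel_measurable borel"
  shows "time_average (\<lambda>t. a * f t + b) T = a * time_average f T + b"
proof -
  have "(\<integral>\<^sup>+t\<in>{0..}. ennreal (exp (- 2 * t / T)) * (a * f t + b) \<partial>lborel) =
    (\<integral>\<^sup>+t. a * (ennreal (exp (- 2 * t / T)) * f t * indicator {0..} t) + b * (ennreal (exp (- (2 / T) * t)) * indicator {0..} t) \<partial>lborel)"
    by (intro nn_integral_cong) (auto simp: algebra_simps split: split_indicator)
  also have "\<dots> = a * (\<integral>\<^sup>+t\<in>{0..}. ennreal (exp (- 2 * t / T)) * f t \<partial>lborel) + b * ennreal (1 / (2 / T))"
    unfolding nn_integral_exp_decay[of "2 / T", symmetric, OF divide_pos_pos[OF zero_less_numeral T]]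
    by (subst nn_integral_add) (auto simp: nn_integral_cmult)
  finally have "time_average (\<lambda>t. a * f t + b) T =
      ennreal (2 / T) * (a * (\<integral>\<^sup>+t\<in>{0..}. ennreal (exp (- 2 * t / T)) * f t \<partial>lborel) + b * ennreal (1 / (2 / T)))"
    unfolding time_average_def by simp
  also have "\<dots> = a * time_average f T + b * (ennreal (2 / T) * ennreal (1 / (2 / T)))"
    unfolding time_average_def by (simp add: algebra_simps)
  also have "ennreal (2 / T) * ennreal (1 / (2 / T)) = 1"
    using T by (simp add: ennreal_mult'[symmetric])
  finally show ?thesis by simp
qed

section \<open>Monotonicity of the normalized moments in the order\<close>

lemma time_average_mono:
  assumes "\<And>t. 0 \<le> t \<Longrightarrow> f t \<le> g t"
  shows "time_average f T \<le> time_average g T"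
  unfolding time_average_def
  by (intro mult_left_mono nn_integral_mono) (auto intro!: mult_left_mono assms split: split_indicator)

text \<open>The graph of the concave map y to y^(p/q) lies below its tangent at y = L^q. Equality at
  \<open>x = L\<close> is what makes the constants in \<open>time_average_moment_mono\<close>
  match.\<close>

lemma Young_powr:
  fixes x L :: real
  assumes "0 \<le> x" "0 < L" "0 < p" "p \<le> q"
  shows "x powr p \<le> p / q * L powr (p - q) * x powr q + (1 - p / q) * L powr p"
proof (cases "x = 0")
  case False
  define r where "r = p / q"
  have r: "0 \<le> r" "r \<le> 1" "r * q = p" using assms by (auto simp: r_def)
  have "(x / L) powr q > 0" using False assms by simp
  from Youngs_inequality_0[of r "1 - r" "(x / L) powr q" 1, OF _ _ _ this]
  have "(x / L) powr p \<le> r * (x / L) powr q + (1 - r)"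
    using r by (simp add: powr_powr mult.commute)
  then have "L powr p * (x / L) powr p \<le> L powr p * (r * (x / L) powr q + (1 - r))"
    by (intro mult_left_mono) auto
  then show ?thesis
    using assms False by (simp add: powr_divide powr_diff r_def field_simps)
qed (use assms in simp)

text \<open>Lyapunov's inequality between moments, expressed by a common length scale
  \<open>L\<close> instead of roots of extended reals.\<close>

lemma time_average_moment_mono:
  assumes T: "0 < T" and pq: "0 < p" "p \<le> q" and L: "0 < L"
    and le: "time_average (moment V \<omega> (ell2_delta 0) q) T \<le> ennreal (L powr q)"
  shows "time_average (moment V \<omega> (ell2_delta 0) p) T \<le> ennreal (L powr p)"
proof -
  define a where "a = p / q * L powr (p - q)"
  define b where "b = (1 - p / q) * L powr p"
  have ab: "0 \<le> a" "0 \<le> b" using pq L by (auto simp: a_def b_def)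
  have "time_average (moment V \<omega> (ell2_delta 0) p) T
      \<le> time_average (\<lambda>t. ennreal a * moment V \<omega> (ell2_delta 0) q t + ennreal b) T"
  proof (intro time_average_mono moment_le ab)
    fix t :: real and n :: int
    have "\<bar>of_int n\<bar> powr p \<le> a * \<bar>of_int n\<bar> powr q + b"
      unfolding a_def b_def by (rule Young_powr) (use pq L in auto)
    from mult_right_mono[OF this, of "(cmod (amp V \<omega> t n))\<^sup>2"]
    show "\<bar>of_int n\<bar> powr p * (cmod (amp V \<omega> t n))\<^sup>2 \<le>
      a * (\<bar>of_int n\<bar> powr q * (cmod (amp V \<omega> t n))\<^sup>2) + b * (cmod (amp V \<omega> t n))\<^sup>2"
      by (simp add: algebra_simps)
  qed
  also have "\<dots> = ennreal a * time_average (moment V \<omega> (ell2_delta 0) q) T + ennreal b"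
    by (rule time_average_affine[OF T]) measurable
  also have "\<dots> \<le> ennreal a * ennreal (L powr q) + ennreal b"
    by (intro add_mono mult_left_mono le) auto
  also have "\<dots> = ennreal (a * L powr q + b)" using ab by (simp add: ennreal_mult')
  also have "a * L powr q + b = L powr p"
    using L pq by (simp add: a_def b_def powr_diff field_simps)
  finally show ?thesis .
qed

section \<open>The ballistic upper bound\<close>

lemma sum_exp_half_le:
  assumes F: "finite (F :: int set)"
  shows "(\<Sum>n\<in>F. exp (- \<bar>of_int n\<bar> / 2)) \<le> (1 + exp (- (1/2))) / (1 - exp (- (1/2 :: real)))"
proof -
  define x where "x = exp (- (1/2 :: real))"
  have x: "0 < x" "x < 1" by (auto simp: x_def)
  have e: "exp (- \<bar>of_int n\<bar> / 2) = x ^ nat \<bar>n\<bar>" for n :: int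
    unfolding x_def exp_of_nat_mult[symmetric] by simp
  have S: "(\<Sum>n\<in>{-int M..int M}. x ^ nat \<bar>n\<bar>) = (1 + x - 2 * x ^ Suc M) / (1 - x)" for M
  proof (induction M)
    case 0
    then show ?case using x by simp
  next
    case (Suc M)
    have eq: "{-int (Suc M)..int (Suc M)} = insert (int M + 1) (insert (- int M - 1) {-int M..int M})" by auto
    have "nat \<bar>int M + 1\<bar> = Suc M" "nat \<bar>- int M - 1\<bar> = Suc M" by auto
    then have "(\<Sum>n\<in>{-int (Suc M)..int (Suc M)}. x ^ nat \<bar>n\<bar>) = 2 * x ^ Suc M + (1 + x - 2 * x ^ Suc M) / (1 - x)"
      unfolding eq by (simp add: Suc)
    also have "\<dots> = (1 + x - 2 * x ^ Suc (Suc M)) / (1 - x)"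
      using x by (simp add: field_simps)
    finally show ?case .
  qed
  obtain M where "F \<subseteq> {- int M..int M}" using finite_int_subset_interval[OF F] .
  then have "(\<Sum>n\<in>F. x ^ nat \<bar>n\<bar>) \<le> (\<Sum>n\<in>{- int M..int M}. x ^ nat \<bar>n\<bar>)"
    using x by (intro sum_mono2) auto
  also have "\<dots> \<le> (1 + x) / (1 - x)"
    unfolding S using x by (intro divide_right_mono) auto
  finally show ?thesis unfolding e x_def .
qed

lemma power_le_fact_exp:
  fixes x :: real
  assumes "0 \<le> x"
  shows "x ^ m \<le> fact m * exp x"
proof -
  have "x ^ m / fact m \<le> exp x"
  proof -
    have s: "(\<lambda>k. x ^ k / fact k) sums exp x" using exp_converges[of x] by (simp add: field_simps)
    have "(\<Sum>k\<in>{m}. x ^ k / fact k) \<le> (\<Sum>k. x ^ k / fact k)"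
      by (rule sum_le_suminf[OF sums_summable[OF s]]) (use assms in auto)
    then show ?thesis using sums_unique[OF s] by simp
  qed
  then show ?thesis by (simp add: field_simps)
qed

text \<open>Within distance \<open>2 * lightspeed V * t\<close> the weight is replaced by its
  maximum and the mass bound is used. Outside, the squared amplitude is at most
  \<open>exp (- \<bar>n\<bar>)\<close>: half of the exponent absorbs the power of \<open>n\<close>,
  the other half is summed.\<close>

lemma moment_ballistic:
  fixes m :: nat
  assumes m: "0 < m"
  shows "\<exists>C. \<forall>\<omega> t. 0 \<le> t \<longrightarrow> moment V \<omega> (ell2_delta 0) (real m) t \<le> ennreal ((2 * lightspeed V * t) ^ m + C)"
proof -
  define S where "S = (1 + exp (- (1/2))) / (1 - exp (- (1/2 :: real)))"
  have S: "0 \<le> S" by (simp add: S_def)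
  define C where "C = fact m * 2 ^ m * S"
  have "moment V \<omega> (ell2_delta 0) (real m) t \<le> ennreal ((2 * lightspeed V * t) ^ m + C)" if t: "0 \<le> t" for \<omega> t
    unfolding moment_delta_eq
  proof (rule infsum_le_finite_sums)
    fix F :: "int set" assume F: "finite F" "F \<subseteq> UNIV"
    let ?w = "\<lambda>n. (cmod (amp V \<omega> t n))\<^sup>2" and ?K = "2 * lightspeed V * t"
    have K: "0 \<le> ?K" using t lightspeed_pos[of V] by simp
    have pt: "\<bar>of_int n\<bar> powr real m * ?w n \<le> ?K ^ m * ?w n + fact m * 2 ^ m * exp (- \<bar>of_int n\<bar> / 2)" for n :: int
    proof -
      \<comment> \<open>At \<open>n = 0\<close> the two powers agree because \<open>m\<close> is
        positive: \<open>0 powr 0\<close> is 0, whereas \<open>0 ^ 0\<close> is 1.\<close>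
      have pw: "\<bar>real_of_int n\<bar> powr real m = \<bar>real_of_int n\<bar> ^ m"
        using m by (cases "n = 0") (simp_all add: powr_realpow)
      show ?thesis
      proof (cases "\<bar>real_of_int n\<bar> \<le> ?K")
        case True
        then have "\<bar>real_of_int n\<bar> ^ m * ?w n \<le> ?K ^ m * ?w n"
          by (intro mult_right_mono power_mono) auto
        then show ?thesis unfolding pw by (simp add: add_increasing2)
      next
        case False
        then have "lightspeed V * t - \<bar>real_of_int n\<bar> \<le> - \<bar>real_of_int n\<bar> / 2" by simp
        then have "cmod (amp V \<omega> t n) \<le> exp (- \<bar>real_of_int n\<bar> / 2)"
          using amp_decay[OF t, of V \<omega> n] by (meson exp_le_cancel_iff order_trans)
        then have "?w n \<le> (exp (- \<bar>real_of_int n\<bar> / 2))\<^sup>2" by (intro power_mono) auto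
        moreover have "\<bar>real_of_int n\<bar> ^ m \<le> fact m * 2 ^ m * exp (\<bar>real_of_int n\<bar> / 2)"
          using power_le_fact_exp[of "\<bar>real_of_int n\<bar> / 2" m] by (simp add: power_divide field_simps)
        ultimately have "\<bar>real_of_int n\<bar> ^ m * ?w n \<le> (fact m * 2 ^ m * exp (\<bar>real_of_int n\<bar> / 2)) * (exp (- \<bar>real_of_int n\<bar> / 2))\<^sup>2"
          by (intro mult_mono) auto
        also have "\<dots> = fact m * 2 ^ m * exp (- \<bar>real_of_int n\<bar> / 2)"
          by (simp add: power2_eq_square exp_minus field_simps)
        finally show ?thesis unfolding pw using K by (simp add: add_increasing)
      qed
    qed
    have "(\<Sum>n\<in>F. ennreal (\<bar>of_int n\<bar> powr real m * ?w n)) = ennreal (\<Sum>n\<in>F. \<bar>of_int n\<bar> powr real m * ?w n)"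
      by (rule sum_ennreal) simp
    also have "(\<Sum>n\<in>F. \<bar>of_int n\<bar> powr real m * ?w n) \<le> (\<Sum>n\<in>F. ?K ^ m * ?w n + fact m * 2 ^ m * exp (- \<bar>of_int n\<bar> / 2))"
      by (intro sum_mono pt)
    also have "\<dots> = ?K ^ m * (\<Sum>n\<in>F. ?w n) + fact m * 2 ^ m * (\<Sum>n\<in>F. exp (- \<bar>of_int n\<bar> / 2))"
      by (simp add: sum.distrib sum_distrib_left)
    also have "\<dots> \<le> ?K ^ m * 1 + fact m * 2 ^ m * S"
      unfolding S_def using K by (intro add_mono mult_left_mono amp_mass t F sum_exp_half_le) auto
    finally show "(\<Sum>n\<in>F. ennreal (\<bar>of_int n\<bar> powr real m * ?w n)) \<le> ennreal (?K ^ m + C)"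
      by (simp add: C_def ennreal_leI)
  qed (simp add: nonneg_summable_on_complete)
  then show ?thesis by blast
qed

text \<open>Bounding \<open>(t / T) ^ m\<close> by \<open>fact m * exp (t / T)\<close> reduces the
  average of a power of \<open>t\<close> to that of \<open>exp (t / T)\<close>, which is 2.\<close>

lemma time_average_ballistic:
  fixes m :: nat
  assumes m: "0 < m"
  shows "\<exists>C>0. \<forall>\<omega> T. 1 \<le> T \<longrightarrow> time_average (moment V \<omega> (ell2_delta 0) (real m)) T \<le> ennreal (C * T ^ m)"
proof -
  obtain C0 where C0: "\<And>\<omega> t. 0 \<le> t \<Longrightarrow> moment V \<omega> (ell2_delta 0) (real m) t \<le> ennreal ((2 * lightspeed V * t) ^ m + C0)"
    using moment_ballistic[OF m] by blast
  define K where "K = 2 * lightspeed V"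
  define C where "C = 2 * K ^ m * fact m + \<bar>C0\<bar> + 1"
  have K: "0 < K" using lightspeed_pos[of V] by (simp add: K_def)
  have "time_average (moment V \<omega> (ell2_delta 0) (real m)) T \<le> ennreal (C * T ^ m)" if T: "1 \<le> T" for \<omega> T
  proof -
    let ?a = "ennreal (K ^ m * fact m * T ^ m)" and ?b = "ennreal \<bar>C0\<bar>"
    have "time_average (moment V \<omega> (ell2_delta 0) (real m)) T \<le> time_average (\<lambda>t. ?a * ennreal (exp (t / T)) + ?b) T"
    proof (rule time_average_mono)
      fix t :: real assume t: "0 \<le> t"
      have "(t / T) ^ m \<le> fact m * exp (t / T)" using t T by (intro power_le_fact_exp) simp
      then have "t ^ m \<le> fact m * T ^ m * exp (t / T)" using T by (simp add: power_divide field_simps)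
      then have "K ^ m * t ^ m \<le> K ^ m * (fact m * T ^ m * exp (t / T))" using K by (intro mult_left_mono) auto
      moreover have "(2 * lightspeed V * t) ^ m = K ^ m * t ^ m" by (simp add: K_def power_mult_distrib)
      ultimately have "(2 * lightspeed V * t) ^ m + C0 \<le> (K ^ m * fact m * T ^ m) * exp (t / T) + \<bar>C0\<bar>"
        by (simp add: mult.assoc)
      then have "ennreal ((2 * lightspeed V * t) ^ m + C0) \<le> ennreal ((K ^ m * fact m * T ^ m) * exp (t / T) + \<bar>C0\<bar>)"
        by (rule ennreal_leI)
      also have "\<dots> = ?a * ennreal (exp (t / T)) + ?b"
        using K T by (simp add: ennreal_mult')
      finally show "moment V \<omega> (ell2_delta 0) (real m) t \<le> ?a * ennreal (exp (t / T)) + ?b"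
        using C0[OF t, of \<omega>] by (rule order_trans[rotated])
    qed
    also have "\<dots> = ?a * time_average (\<lambda>t. ennreal (exp (t / T))) T + ?b"
      by (rule time_average_affine) (use T in auto)
    also have "time_average (\<lambda>t. ennreal (exp (t / T))) T = 2"
    proof -
      have "(\<integral>\<^sup>+t\<in>{0..}. ennreal (exp (- 2 * t / T)) * ennreal (exp (t / T)) \<partial>lborel) =
        (\<integral>\<^sup>+t. ennreal (exp (- (1 / T) * t)) * indicator {0..} t \<partial>lborel)"
        by (intro nn_integral_cong arg_cong2[where f = "(*)"] refl)
          (simp add: ennreal_mult'[symmetric] exp_add[symmetric] diff_divide_distrib[symmetric] field_simps)
      also have "\<dots> = ennreal (1 / (1 / T))" using T by (intro nn_integral_exp_decay) simp
      finally show ?thesis unfolding time_average_def using T by (simp add: ennreal_mult'[symmetric])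
    qed
    also have "?a * 2 + ?b = ennreal (2 * K ^ m * fact m * T ^ m + \<bar>C0\<bar>)"
      using K T by (simp add: ennreal_plus ennreal_mult' mult_ac flip: ennreal_numeral)
    also have "\<dots> \<le> ennreal (C * T ^ m)"
    proof (rule ennreal_leI)
      have "\<bar>C0\<bar> * 1 \<le> \<bar>C0\<bar> * T ^ m" using T by (intro mult_left_mono) auto
      then show "2 * K ^ m * fact m * T ^ m + \<bar>C0\<bar> \<le> C * T ^ m" using T by (simp add: C_def algebra_simps add_increasing)
    qed
    finally show ?thesis .
  qed
  moreover have "0 < C" using K by (simp add: C_def add_pos_pos add_nonneg_pos)
  ultimately show ?thesis by blast
qed

section \<open>Lower bounds\<close>

text \<open>At site 0 the source has modulus 1 and the coefficient of \<open>f 0\<close> has modulus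
  at most 1, so one of the values at -1, 0, 1 is at least 1/3. It is carried \<open>N\<close> sites
  outward, to a side that is not known in advance. The 12 is 3 times the factor 2 of
  \<open>solution_growth\<close> times 2 for choosing one of two neighbours.\<close>

lemma green_site_lower:
  assumes V: "0 < V" "V \<le> 1 / 1000000" and E: "0 \<le> E" "E \<le> V" and T: "4 \<le> T"
    and bound: "\<And>x n. 0 \<le> x \<Longrightarrow> x < 1 \<Longrightarrow> n \<le> N \<Longrightarrow> su_norm (window V E x n) \<le> D"
    and small: "2 / T * D\<^sup>2 * real N \<le> 1 / 2"
  shows "\<exists>n. int N \<le> \<bar>n\<bar> \<and> 1 / (12 * D) \<le> cmod (green V \<omega> E (2 / T) n)"
proof -
  define f where "f = green V \<omega> E (2 / T)"
  have \<kappa>: "0 < 2 / T" "2 / T \<le> 1 / 2" using T by (auto simp: field_simps)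
  have eqn: "f (n + 1) + f (n - 1) + fib_potential V \<omega> n * f n = Complex E (2 / T) * f n - (if n = 0 then \<i> else 0)" for n
    unfolding f_def by (rule green_equation[OF \<kappa>(1)])
  have D: "1 \<le> D" using bound[of 0 0] by simp
  have b: "su_norm (window V E (frac (of_int m * fib_alpha + \<omega>)) n) \<le> D" if "n \<le> N" for m n
    by (rule bound[OF frac_ge_0 frac_lt_1 that])
  \<comment> \<open>The right window begins at site 1 and the left one ends at site -1, so both
    avoid the source.\<close>
  have right: "max (cmod (f 1)) (cmod (f (1 - 1))) \<le> 2 * D * (cmod (f (1 + int N)) + cmod (f (1 + int N - 1)))"
  proof (rule solution_growth(2)[OF _ b \<kappa>(1) small])
    fix j
    show "f (1 + int j + 1) + f (1 + int j - 1) + fib_potential V \<omega> (1 + int j) * f (1 + int j) = Complex E (2 / T) * f (1 + int j)"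
      using eqn[of "1 + int j"] by simp
  qed
  have left: "max (cmod (f (- int N + int N))) (cmod (f (- int N + int N - 1))) \<le> 2 * D * (cmod (f (- int N)) + cmod (f (- int N - 1)))"
  proof (rule solution_growth(1)[OF _ b \<kappa>(1) small])
    fix j assume "j < N"
    then show "f (- int N + int j + 1) + f (- int N + int j - 1) + fib_potential V \<omega> (- int N + int j) * f (- int N + int j)
        = Complex E (2 / T) * f (- int N + int j)"
      using eqn[of "- int N + int j"] by simp
  qed
  have big: "1 / 3 \<le> cmod (f 1) \<or> 1 / 3 \<le> cmod (f 0) \<or> 1 / 3 \<le> cmod (f (- 1))"
  proof (rule ccontr)
    assume "\<not> ?thesis"
    then have lt: "cmod (f 1) < 1 / 3" "cmod (f 0) < 1 / 3" "cmod (f (- 1)) < 1 / 3" by auto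
    let ?c = "Complex E (2 / T) - complex_of_real (fib_potential V \<omega> 0)"
    have "?c = Complex (E - fib_potential V \<omega> 0) (2 / T)" by (simp add: complex_eq_iff)
    then have "cmod ?c \<le> \<bar>E - fib_potential V \<omega> 0\<bar> + \<bar>2 / T\<bar>"
      using cmod_le[of ?c] by simp
    also have "\<dots> \<le> 1" using \<kappa> E V fib_potential_bound[of V \<omega> 0] by argo
    finally have c: "cmod ?c \<le> 1" .
    have "\<i> = ?c * f 0 - f 1 - f (- 1)" using eqn[of 0] by (simp add: algebra_simps)
    then have "cmod (?c * f 0 - f 1 - f (- 1)) = 1" by (metis norm_ii)
    then have "1 \<le> cmod (?c * f 0) + cmod (f 1) + cmod (f (- 1))"
      using norm_triangle_ineq4[of "?c * f 0 - f 1" "f (- 1)"] norm_triangle_ineq4[of "?c * f 0" "f 1"]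
      by linarith
    moreover have "cmod (?c * f 0) \<le> 1 * cmod (f 0)" unfolding norm_mult using c by (intro mult_right_mono) auto
    ultimately show False using lt by linarith
  qed
  have half: "1 / (12 * D) \<le> x \<or> 1 / (12 * D) \<le> y" if "1 / 3 \<le> 2 * D * (x + y)" for x y
  proof (rule ccontr)
    assume "\<not> ?thesis"
    then have "x + y < 2 * (1 / (12 * D))" by simp
    then have "2 * D * (x + y) < 2 * D * (2 * (1 / (12 * D)))" using D by (intro mult_strict_left_mono) auto
    then show False using that D by simp
  qed
  consider "1 / 3 \<le> 2 * D * (cmod (f (1 + int N)) + cmod (f (int N)))"
    | "1 / 3 \<le> 2 * D * (cmod (f (- int N)) + cmod (f (- int N - 1)))"
    using big left right by fastforce
  then show ?thesis
  proof cases
    case 1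
    with half have "1 / (12 * D) \<le> cmod (f (1 + int N)) \<or> 1 / (12 * D) \<le> cmod (f (int N))" by blast
    moreover have "int N \<le> \<bar>1 + int N\<bar>" "int N \<le> \<bar>int N\<bar>" by simp_all
    ultimately show ?thesis unfolding f_def by blast
  next
    case 2
    with half have "1 / (12 * D) \<le> cmod (f (- int N)) \<or> 1 / (12 * D) \<le> cmod (f (- int N - 1))" by blast
    moreover have "int N \<le> \<bar>- int N\<bar>" "int N \<le> \<bar>- int N - 1\<bar>" by simp_all
    ultimately show ?thesis unfolding f_def by blast
  qed
qed

text \<open>The energy depends on \<open>k\<close> and is eliminated here. The 36 is
  \<open>12^2 / 4\<close>, the 4 coming from \<kappa>^2.\<close>

lemma time_average_lower_scale:
  assumes V: "0 < V" "V \<le> 1 / 1000000" and k: "b = (1 + 1000000 * V) ^ 8"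
    and T: "4 \<le> T" and small: "2 / T * (b ^ (4 * k + 1))\<^sup>2 * 2 ^ k \<le> 1 / 2" and p: "0 < p"
  shows "ennreal ((2 ^ k) powr p / (36 * T\<^sup>2 * (b ^ (4 * k + 1))\<^sup>2)) \<le> time_average (moment V \<omega> (ell2_delta 0) p) T"
proof -
  define D where "D = b ^ (4 * k + 1)"
  obtain E where E: "0 \<le> E" "E \<le> V" "\<And>j. j \<le> k \<Longrightarrow> su_norm (blockA V E j) \<le> b" "\<And>j. j \<le> k \<Longrightarrow> su_norm (blockB V E j) \<le> b"
    using exists_energy_block_bound[OF V, of k] unfolding k by metis
  have b: "1 \<le> b" using V unfolding k by simp
  have D: "1 \<le> D" unfolding D_def using b by (rule one_le_power)
  have "su_norm (window V E x n) \<le> D" if "0 \<le> x" "x < 1" "n \<le> 2 ^ k" for x n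
    unfolding D_def by (rule window_bound[OF b E(3,4) order_refl that])
  moreover have "2 / T * D\<^sup>2 * real (2 ^ k) \<le> 1 / 2" using small by (simp add: D_def)
  ultimately obtain n where n: "int (2 ^ k) \<le> \<bar>n\<bar>" "1 / (12 * D) \<le> cmod (green V \<omega> E (2 / T) n)"
    using green_site_lower[OF V E(1,2) T, of "2 ^ k" D \<omega>] by blast
  have "real_of_int (int (2 ^ k)) \<le> real_of_int \<bar>n\<bar>" using n(1) by (rule of_int_le_iff[THEN iffD2])
  then have n': "2 ^ k \<le> \<bar>real_of_int n\<bar>" by simp
  have "(2 ^ k) powr p * (1 / (12 * D))\<^sup>2 \<le> \<bar>of_int n\<bar> powr p * (cmod (green V \<omega> E (2 / T) n))\<^sup>2"
    using n(2) n' p D by (intro mult_mono powr_mono2 power_mono) auto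
  then have "4 / T\<^sup>2 * ((2 ^ k) powr p * (1 / (12 * D))\<^sup>2) \<le> 4 / T\<^sup>2 * (\<bar>of_int n\<bar> powr p * (cmod (green V \<omega> E (2 / T) n))\<^sup>2)"
    by (intro mult_left_mono) auto
  moreover have "4 / T\<^sup>2 * ((2 ^ k) powr p * (1 / (12 * D))\<^sup>2) = (2 ^ k) powr p / (36 * T\<^sup>2 * D\<^sup>2)"
    by (simp add: power2_eq_square)
  ultimately have "ennreal ((2 ^ k) powr p / (36 * T\<^sup>2 * D\<^sup>2)) \<le> ennreal (4 / T\<^sup>2 * (\<bar>of_int n\<bar> powr p * (cmod (green V \<omega> E (2 / T) n))\<^sup>2))"
    by (intro ennreal_leI) simp
  also have "\<dots> \<le> time_average (moment V \<omega> (ell2_delta 0) p) T"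
    using T by (intro time_average_lower) simp
  finally show ?thesis by (simp add: D_def)
qed

text \<open>Chosen so that the block bound $(1 + 10^6 V)^8$ is at most $2^{e/20}$.\<close>

definition weak_coupling :: "real \<Rightarrow> real" where
  "weak_coupling e = min (1 / 1000000) (e * ln 2 / 160000000)"

lemma weak_coupling_pos: "0 < e \<Longrightarrow> 0 < weak_coupling e"
  by (simp add: weak_coupling_def)


text \<open>With \<open>2 ^ k\<close> about \<open>T powr (1 - e)\<close> and squared window bound
  at most \<open>T powr (e / 2)\<close>, the smallness condition becomes
  \<open>2 / T powr (e / 2) <= 1 / 2\<close>; this is the threshold \<open>4 powr (2 / e)\<close>.
  The remaining losses are estimated crudely by \<open>T ^ 4\<close>.\<close>

lemma time_average_lower_weak:
  assumes e: "0 < e" "e < 1" and V: "0 < V" "V \<le> weak_coupling e" and p: "0 < p"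
    and T: "4 powr (2 / e) \<le> T"
  shows "ennreal ((T powr (1 - e) / 2) powr p / (36 * T ^ 4)) \<le> time_average (moment V \<omega> (ell2_delta 0) p) T"
proof -
  define b where "b = (1 + 1000000 * V) ^ 8"
  have V': "V \<le> 1 / 1000000" "V \<le> e * ln 2 / 160000000" using V by (auto simp: weak_coupling_def)
  have b1: "1 \<le> b" unfolding b_def using V by simp
  have "b \<le> exp (1000000 * V) ^ 8"
    unfolding b_def using V by (intro power_mono exp_ge_add_one_self) simp
  also have "\<dots> = exp (8000000 * V)" by (simp add: exp_of_nat_mult[symmetric])
  also have "\<dots> \<le> exp (e / 20 * ln 2)" using V' by simp
  finally have b2: "b \<le> 2 powr (e / 20)" by (simp add: powr_def)
  have "(4 :: real) powr 2 \<le> 4 powr (2 / e)" using e by (intro powr_mono) (auto simp: field_simps)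
  moreover have "(4 :: real) powr 2 = 16" by simp
  ultimately have T16: "16 \<le> T" using T by linarith
  define k where "k = nat \<lfloor>(1 - e) * log 2 T\<rfloor>"
  have l4: "4 \<le> log 2 T" using T16 le_log_iff[of 2 T 4] by simp
  have y0: "0 \<le> (1 - e) * log 2 T" using e l4 by simp
  have rk: "real k = of_int \<lfloor>(1 - e) * log 2 T\<rfloor>" using y0 by (simp add: k_def)
  have k: "real k \<le> (1 - e) * log 2 T" "(1 - e) * log 2 T < real k + 1"
    unfolding rk by linarith+
  have Tpow: "2 powr (c * log 2 T) = T powr c" for c
    using T16 by (simp add: powr_def log_def)
  have k2: "2 ^ k = (2 :: real) powr real k" by (simp add: powr_realpow)
  have up: "2 ^ k \<le> T powr (1 - e)" unfolding k2 Tpow[symmetric] using k by simp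
  have "2 powr ((1 - e) * log 2 T) \<le> (2 :: real) powr (real k + 1)" using k by simp
  then have lo: "T powr (1 - e) / 2 \<le> 2 ^ k" unfolding Tpow by (simp add: powr_add k2)
  have "(b ^ (4 * k + 1))\<^sup>2 = b powr real (8 * k + 2)"
  proof -
    have "(4 * k + 1) * 2 = 8 * k + 2" by simp
    then have "(b ^ (4 * k + 1))\<^sup>2 = b ^ (8 * k + 2)" by (simp only: power_mult[symmetric])
    then show ?thesis using b1 powr_realpow[of b "8 * k + 2"] by linarith
  qed
  \<comment> \<open>The exponent \<open>8 * k + 2\<close> is at most \<open>10 * log 2 T\<close>, so
    that \<open>e / 20\<close> turns into \<open>e / 2\<close>.\<close>
  also have "\<dots> \<le> (2 powr (e / 20)) powr real (8 * k + 2)"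
    using b1 b2 by (intro powr_mono2) auto
  also have "\<dots> = 2 powr (e / 20 * real (8 * k + 2))" by (simp add: powr_powr)
  also have "\<dots> \<le> 2 powr (e / 2 * log 2 T)"
  proof -
    have "(1 - e) * log 2 T \<le> 1 * log 2 T" using e l4 by (intro mult_right_mono) auto
    then have "real k \<le> log 2 T" using k(1) by linarith
    then have "real (8 * k + 2) \<le> 10 * log 2 T" using l4 by simp
    then have "e / 20 * real (8 * k + 2) \<le> e / 20 * (10 * log 2 T)" using e by (intro mult_left_mono) auto
    then show ?thesis by simp
  qed
  also have "\<dots> = T powr (e / 2)" by (rule Tpow)
  finally have D: "(b ^ (4 * k + 1))\<^sup>2 \<le> T powr (e / 2)" .
  have "4 = (4 powr (2 / e)) powr (e / 2)" using e by (simp add: powr_powr)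
  also have "\<dots> \<le> T powr (e / 2)" using e T by (intro powr_mono2) auto
  finally have T4: "4 \<le> T powr (e / 2)" .
  have "2 / T * (b ^ (4 * k + 1))\<^sup>2 * 2 ^ k \<le> 2 / T * T powr (e / 2) * T powr (1 - e)"
    using D up T16 by (intro mult_mono) auto
  also have "\<dots> = 2 / T powr (e / 2)"
  proof -
    have "T powr (e / 2) * (T powr (e / 2) * T powr (1 - e)) = T powr 1"
      unfolding powr_add[symmetric] by (simp add: field_simps)
    then have "T powr (e / 2) * (T powr (e / 2) * T powr (1 - e)) = T" using T16 by simp
    then show ?thesis using T16 by (simp add: field_simps)
  qed
  also have "\<dots> \<le> 2 / 4" using T4 T16 by (intro divide_left_mono) auto
  also have "\<dots> = 1 / 2" by simp
  finally have small: "2 / T * (b ^ (4 * k + 1))\<^sup>2 * 2 ^ k \<le> 1 / 2" .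
  have "T powr (e / 2) \<le> T powr 2" using e T16 by (intro powr_mono) auto
  then have D2: "(b ^ (4 * k + 1))\<^sup>2 \<le> T\<^sup>2" using D T16 by simp
  have "(T powr (1 - e) / 2) powr p / (36 * T ^ 4) \<le> (2 ^ k) powr p / (36 * T\<^sup>2 * (b ^ (4 * k + 1))\<^sup>2)"
  proof (rule frac_le)
    show "(T powr (1 - e) / 2) powr p \<le> (2 ^ k) powr p" using lo p by (intro powr_mono2) auto
    have "36 * T\<^sup>2 * (b ^ (4 * k + 1))\<^sup>2 \<le> 36 * T\<^sup>2 * T\<^sup>2" using D2 by (intro mult_left_mono) auto
    then show "36 * T\<^sup>2 * (b ^ (4 * k + 1))\<^sup>2 \<le> 36 * T ^ 4" by (simp add: power2_eq_square eval_nat_numeral)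
  qed (use T16 b1 in auto)
  then have "ennreal ((T powr (1 - e) / 2) powr p / (36 * T ^ 4)) \<le> ennreal ((2 ^ k) powr p / (36 * T\<^sup>2 * (b ^ (4 * k + 1))\<^sup>2))"
    by (rule ennreal_leI)
  also have "\<dots> \<le> time_average (moment V \<omega> (ell2_delta 0) p) T"
    using T16 by (intro time_average_lower_scale V(1) V'(1) b_def small p) simp
  finally show ?thesis .
qed

section \<open>Transport exponents\<close>

lemma ln_ennreal_ennreal: "0 < r \<Longrightarrow> ln_ennreal (ennreal r) = ereal (ln r)"
  by (simp add: ln_ennreal_def)

lemma ln_ennreal_mono: "x \<le> y \<Longrightarrow> ln_ennreal x \<le> ln_ennreal y"
proof (cases "x = 0 \<or> y = \<infinity>")
  case False
  assume le: "x \<le> y"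
  obtain r where y: "y = ennreal r" "0 \<le> r" using False by (cases y) auto
  obtain s where x: "x = ennreal s" "0 \<le> s" using False le by (cases x) (auto simp: top_unique)
  have "0 < s" "s \<le> r" using False le x y by (auto simp: ennreal_le_iff)
  then show ?thesis unfolding x y by (simp add: ln_ennreal_ennreal)
qed (auto simp: ln_ennreal_def)

text \<open>\<open>time_average_moment_mono\<close> is applied with
  \<open>L = r powr (1 / q)\<close> if the \<open>q\<close>-th average is a positive real
  \<open>r\<close>, and with arbitrarily small \<open>L\<close> if it vanishes.\<close>

lemma transport_ratio_mono:
  assumes pq: "0 < p" "p \<le> q" and T: "1 < T"
  shows "transport_ratio V \<omega> (ell2_delta 0) p T \<le> transport_ratio V \<omega> (ell2_delta 0) q T"
proof -
  let ?A = "\<lambda>p. time_average (moment V \<omega> (ell2_delta 0) p) T"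
  have pos: "0 < p * ln T" "0 < q * ln T" using assms by auto
  have mono: "?A p \<le> ennreal (L powr p)" if "0 < L" "?A q \<le> ennreal (L powr q)" for L
    using time_average_moment_mono[OF _ pq that] T by simp
  consider "?A q = \<infinity>" | "?A q = 0" | r where "?A q = ennreal r" "0 < r"
    by (cases "?A q") (auto simp: less_le top_ennreal_def infinity_ennreal_def)
  then show ?thesis
  proof cases
    case 1
    then show ?thesis using pos unfolding transport_ratio_def by (simp add: ln_ennreal_def)
  next
    case 2
    have "?A p \<le> 0"
    proof (rule ennreal_le_epsilon)
      fix e :: real assume e: "0 < e"
      have "?A p \<le> ennreal ((e powr (1 / p)) powr p)" using e 2 by (intro mono) auto
      then show "?A p \<le> 0 + ennreal e" using e pq by (simp add: powr_powr)
    qed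
    then show ?thesis using pos 2 unfolding transport_ratio_def by (simp add: ln_ennreal_def)
  next
    case 3
    have "?A p \<le> ennreal ((r powr (1 / q)) powr p)" using 3 pq by (intro mono) (auto simp: powr_powr)
    then have "ln_ennreal (?A p) \<le> ereal (ln ((r powr (1 / q)) powr p))"
      using 3 ln_ennreal_mono ln_ennreal_ennreal by (metis powr_gt_zero less_irrefl)
    then have "transport_ratio V \<omega> (ell2_delta 0) p T \<le> ereal (ln ((r powr (1 / q)) powr p)) / ereal (p * ln T)"
      unfolding transport_ratio_def using pos by (intro ereal_divide_right_mono) auto
    also have "\<dots> = transport_ratio V \<omega> (ell2_delta 0) q T"
      unfolding transport_ratio_def using 3 pq T by (simp add: ln_ennreal_ennreal ln_powr field_simps)
    finally show ?thesis .
  qed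
qed

lemma beta_mono:
  assumes "0 < p" "p \<le> q"
  shows "beta_plus V \<omega> (ell2_delta 0) p \<le> beta_plus V \<omega> (ell2_delta 0) q"
    and "beta_minus V \<omega> (ell2_delta 0) p \<le> beta_minus V \<omega> (ell2_delta 0) q"
proof -
  have "eventually (\<lambda>T. transport_ratio V \<omega> (ell2_delta 0) p T \<le> transport_ratio V \<omega> (ell2_delta 0) q T) at_top"
    using eventually_gt_at_top[of 1] by eventually_elim (rule transport_ratio_mono[OF assms])
  then show "beta_plus V \<omega> (ell2_delta 0) p \<le> beta_plus V \<omega> (ell2_delta 0) q"
    "beta_minus V \<omega> (ell2_delta 0) p \<le> beta_minus V \<omega> (ell2_delta 0) q"
    unfolding beta_plus_def beta_minus_def by (auto intro: Limsup_mono Liminf_mono)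
qed

lemma beta_minus_le_plus: "beta_minus V \<omega> \<psi> p \<le> beta_plus V \<omega> \<psi> p"
  unfolding beta_plus_def beta_minus_def by (rule Liminf_le_Limsup) simp

lemma tendsto_SUP_at_top:
  fixes f :: "real \<Rightarrow> ereal"
  assumes mono: "\<And>p q. 0 < p \<Longrightarrow> p \<le> q \<Longrightarrow> f p \<le> f q"
  shows "(f \<longlongrightarrow> (SUP p\<in>{0<..}. f p)) at_top"
proof (rule order_tendstoI)
  fix a assume "a < (SUP p\<in>{0<..}. f p)"
  then obtain p where p: "0 < p" "a < f p" unfolding less_SUP_iff by auto
  show "eventually (\<lambda>q. a < f q) at_top"
    using eventually_ge_at_top[of p]
    by eventually_elim (use p mono in \<open>auto intro: less_le_trans\<close>)
next
  fix a assume a: "(SUP p\<in>{0<..}. f p) < a"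
  show "eventually (\<lambda>q. f q < a) at_top"
    using eventually_gt_at_top[of 0]
    by eventually_elim (use a in \<open>auto intro: le_less_trans[OF SUP_upper]\<close>)
qed

lemma beta_plus_inf_SUP: "beta_plus_inf V \<omega> (ell2_delta 0) = (SUP p\<in>{0<..}. beta_plus V \<omega> (ell2_delta 0) p)"
  unfolding beta_plus_inf_def by (intro tendsto_Lim tendsto_SUP_at_top beta_mono) auto

lemma beta_minus_inf_SUP: "beta_minus_inf V \<omega> (ell2_delta 0) = (SUP p\<in>{0<..}. beta_minus V \<omega> (ell2_delta 0) p)"
  unfolding beta_minus_inf_def by (intro tendsto_Lim tendsto_SUP_at_top beta_mono) auto

text \<open>Integer orders suffice, since by monotonicity any \<open>p\<close> is dominated by its
  ceiling.\<close>

lemma beta_plus_nat_le_1: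
  fixes m :: nat
  assumes m: "0 < m"
  shows "beta_plus V \<omega> (ell2_delta 0) (real m) \<le> 1"
proof -
  obtain C where C: "0 < C" "\<And>T. 1 \<le> T \<Longrightarrow> time_average (moment V \<omega> (ell2_delta 0) (real m)) T \<le> ennreal (C * T ^ m)"
    using time_average_ballistic[OF m, of V] by blast
  define g where "g = (\<lambda>T. ln C / real m / ln T + 1)"
  have "eventually (\<lambda>T. transport_ratio V \<omega> (ell2_delta 0) (real m) T \<le> ereal (g T)) at_top"
    using eventually_gt_at_top[of 1]
  proof eventually_elim
    case (elim T)
    have pos: "0 < real m * ln T" using elim m by simp
    have "ln_ennreal (time_average (moment V \<omega> (ell2_delta 0) (real m)) T) \<le> ereal (ln (C * T ^ m))"
      using ln_ennreal_mono[OF C(2)[of T]] ln_ennreal_ennreal[of "C * T ^ m"] C(1) elim by simp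
    then have "transport_ratio V \<omega> (ell2_delta 0) (real m) T \<le> ereal (ln (C * T ^ m)) / ereal (real m * ln T)"
      unfolding transport_ratio_def using pos by (intro ereal_divide_right_mono) auto
    also have "\<dots> = ereal (g T)"
      using C(1) elim m by (simp add: g_def ln_mult ln_realpow field_simps)
    finally show ?case .
  qed
  then have "beta_plus V \<omega> (ell2_delta 0) (real m) \<le> Limsup at_top (\<lambda>T. ereal (g T))"
    unfolding beta_plus_def by (rule Limsup_mono)
  also have "(g \<longlongrightarrow> 0 + 1) at_top"
    unfolding g_def by (intro tendsto_add tendsto_const real_tendsto_divide_at_top[OF tendsto_const ln_at_top])
  then have "Limsup at_top (\<lambda>T. ereal (g T)) = ereal (0 + 1)"
    by (intro lim_imp_Limsup) auto
  finally show ?thesis by (simp add: one_ereal_def)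
qed

text \<open>The term \<open>4 / p\<close> is the price of the factor \<open>T ^ 4\<close>; the
  constants 2 and 36 vanish against \<open>ln T\<close>.\<close>

lemma beta_minus_ge:
  assumes e: "0 < e" "e < 1" and V: "0 < V" "V \<le> weak_coupling e" and p: "0 < p"
  shows "ereal (1 - e - 4 / p) \<le> beta_minus V \<omega> (ell2_delta 0) p"
proof -
  define g where "g = (\<lambda>T. 1 - e - 4 / p - (ln 2 + ln 36 / p) / ln T)"
  have "(g \<longlongrightarrow> 1 - e - 4 / p - 0) at_top"
    unfolding g_def by (intro tendsto_diff tendsto_const real_tendsto_divide_at_top[OF tendsto_const ln_at_top])
  then have "ereal (1 - e - 4 / p) = Liminf at_top (\<lambda>T. ereal (g T))"
    by (intro lim_imp_Liminf[symmetric]) auto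
  also have "\<dots> \<le> beta_minus V \<omega> (ell2_delta 0) p"
    unfolding beta_minus_def
  proof (rule Liminf_mono)
    show "eventually (\<lambda>T. ereal (g T) \<le> transport_ratio V \<omega> (ell2_delta 0) p T) at_top"
      using eventually_ge_at_top[of "4 powr (2 / e)"] eventually_gt_at_top[of 1]
    proof eventually_elim
      case (elim T)
      let ?r = "(T powr (1 - e) / 2) powr p / (36 * T ^ 4)"
      have pos: "0 < p * ln T" using elim p by simp
      have r: "0 < ?r" using elim by simp
      have lnr: "ln ?r = p * ((1 - e) * ln T - ln 2) - (ln 36 + 4 * ln T)"
        using elim by (simp add: ln_div ln_mult ln_powr ln_realpow)
      have "g T = (p * ((1 - e) * ln T - ln 2) - (ln 36 + 4 * ln T)) / (p * ln T)"
        using pos elim p by (simp add: g_def field_simps)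
      then have "g T = ln ?r / (p * ln T)" unfolding lnr .
      then have "ereal (g T) = ln_ennreal (ennreal ?r) / ereal (p * ln T)"
      proof -
        have d: "ereal (x / y) = ereal x / ereal y" if "0 < y" for x y :: real using that by simp
        show ?thesis unfolding ln_ennreal_ennreal[OF r] using \<open>g T = ln ?r / (p * ln T)\<close> d[OF pos, of "ln ?r"] by metis
      qed
      also have "\<dots> \<le> transport_ratio V \<omega> (ell2_delta 0) p T"
        unfolding transport_ratio_def using pos
        by (intro ereal_divide_right_mono ln_ennreal_mono time_average_lower_weak[OF e V p elim(1)]) auto
      finally show ?case .
    qed
  qed
  finally show ?thesis .
qed

lemma beta_inf_bounds:
  assumes e: "0 < e" "e < 1" and V: "0 < V" "V \<le> weak_coupling e"
  shows "ereal (1 - 2 * e) \<le> beta_minus_inf V \<omega> (ell2_delta 0)"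
    and "beta_minus_inf V \<omega> (ell2_delta 0) \<le> beta_plus_inf V \<omega> (ell2_delta 0)"
    and "beta_plus_inf V \<omega> (ell2_delta 0) \<le> 1"
proof -
  \<comment> \<open>The order \<open>4 / e\<close> makes the loss \<open>4 / p\<close> equal to
    \<open>e\<close>.\<close>
  have "ereal (1 - 2 * e) = ereal (1 - e - 4 / (4 / e))" using e by simp
  also have "\<dots> \<le> beta_minus V \<omega> (ell2_delta 0) (4 / e)"
    using e by (intro beta_minus_ge V) auto
  also have "\<dots> \<le> beta_minus_inf V \<omega> (ell2_delta 0)"
    unfolding beta_minus_inf_SUP using e by (intro SUP_upper) auto
  finally show "ereal (1 - 2 * e) \<le> beta_minus_inf V \<omega> (ell2_delta 0)" .
  show "beta_minus_inf V \<omega> (ell2_delta 0) \<le> beta_plus_inf V \<omega> (ell2_delta 0)"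
    unfolding beta_minus_inf_SUP beta_plus_inf_SUP by (intro SUP_mono') (rule beta_minus_le_plus)
  show "beta_plus_inf V \<omega> (ell2_delta 0) \<le> 1"
    unfolding beta_plus_inf_SUP
  proof (rule SUP_least)
    fix p :: real assume "p \<in> {0<..}"
    then have p: "0 < p" by simp
    have "beta_plus V \<omega> (ell2_delta 0) p \<le> beta_plus V \<omega> (ell2_delta 0) (real (nat \<lceil>p\<rceil>))"
      using p by (intro beta_mono) (auto simp: real_nat_ceiling_ge)
    also have "\<dots> \<le> 1" using p by (intro beta_plus_nat_le_1) simp
    finally show "beta_plus V \<omega> (ell2_delta 0) p \<le> 1" .
  qed
qed

text \<open>Uniformity holds because \<open>weak_coupling e\<close> does not depend on \<omega>. The
  two bounds also force finite values, so the default value 0 of \<open>real_of_ereal\<close> at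
  infinities does not interfere.\<close>

lemma uniform_limit_one_of_weak_coupling:
  fixes f :: "real \<Rightarrow> real \<Rightarrow> ereal"
  assumes "\<And>e V \<omega>. 0 < e \<Longrightarrow> e < 1 \<Longrightarrow> 0 < V \<Longrightarrow> V \<le> weak_coupling e \<Longrightarrow> ereal (1 - 2 * e) \<le> f V \<omega> \<and> f V \<omega> \<le> 1"
  shows "uniform_limit UNIV (\<lambda>V \<omega>. real_of_ereal (f V \<omega>)) (\<lambda>\<omega>. 1) (at_right 0)"
  unfolding uniform_limit_iff
proof (intro allI impI)
  fix d :: real assume d: "0 < d"
  define e where "e = min (1 / 2) (d / 4)"
  have e: "0 < e" "e < 1" "4 * e \<le> d" using d by (auto simp: e_def)
  show "eventually (\<lambda>V. \<forall>\<omega>\<in>UNIV. dist (real_of_ereal (f V \<omega>)) 1 < d) (at_right 0)"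
    using eventually_at_right_real[OF weak_coupling_pos[OF e(1)]]
  proof eventually_elim
    case (elim V)
    show ?case
    proof
      fix \<omega>
      have "ereal (1 - 2 * e) \<le> f V \<omega> \<and> f V \<omega> \<le> 1" using assms[OF e(1,2)] elim by simp
      then have "1 - 2 * e \<le> real_of_ereal (f V \<omega>) \<and> real_of_ereal (f V \<omega>) \<le> 1"
        by (cases "f V \<omega>") (auto simp: one_ereal_def)
      then show "dist (real_of_ereal (f V \<omega>)) 1 < d" using e d by (simp add: dist_real_def abs_if)
    qed
  qed
qed

theorem corollary4:
  shows "(\<forall>V>0. \<forall>\<omega>. (beta_plus V \<omega> (ell2_delta 0) \<longlongrightarrow> beta_plus_inf V \<omega> (ell2_delta 0)) at_top) \<and>
    (\<forall>V>0. \<forall>\<omega>. (beta_minus V \<omega> (ell2_delta 0) \<longlongrightarrow> beta_minus_inf V \<omega> (ell2_delta 0)) at_top) \<and>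
    uniform_limit UNIV (\<lambda>V \<omega>. real_of_ereal (beta_plus_inf V \<omega> (ell2_delta 0))) (\<lambda>\<omega>. 1) (at_right 0) \<and>
    uniform_limit UNIV (\<lambda>V \<omega>. real_of_ereal (beta_minus_inf V \<omega> (ell2_delta 0))) (\<lambda>\<omega>. 1) (at_right 0)"
proof (intro conjI allI impI uniform_limit_one_of_weak_coupling)
  show "(beta_plus V \<omega> (ell2_delta 0) \<longlongrightarrow> beta_plus_inf V \<omega> (ell2_delta 0)) at_top" for V \<omega>
    unfolding beta_plus_inf_SUP by (intro tendsto_SUP_at_top beta_mono)
  show "(beta_minus V \<omega> (ell2_delta 0) \<longlongrightarrow> beta_minus_inf V \<omega> (ell2_delta 0)) at_top" for V \<omega>
    unfolding beta_minus_inf_SUP by (intro tendsto_SUP_at_top beta_mono)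
qed (meson beta_inf_bounds order_trans)+

end
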